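(* Let $(x,y,h)$ be a standard triple in $\mathfrak{so}^*(2n)$, and for each $r\ge 0$ let $(W_r,\phi_r)$ be the associated multiplicity spaces; for odd $r$, $\phi_r$ is a non-degenerate Hermitian form on the quaternionic vector space $W_r$, of signature $(p_r,q_r)$. Then the adjoint orbit of $x$ is stable under negation if and only if for every odd $r$, $\phi_r$ has split signature, i.e. $p_r=q_r$. In particular, such nilpotent orbits admit no Gibbs state.
   Context: $\mathrm{SO}^*(2n)$ is the (connected) group of $\mathbb H$-linear automorphisms of $\mathbb H^n$ preserving a non-degenerate skew-Hermitian form $B$ (unique up to equivalence); $\mathfrak{so}^*(2n)$ is its Lie algebra; adjoint orbits are taken under this group. Sesquilinear forms are antilinear on the left and linear on the right. Standard triple: elements $(x,y,h)$ of a Lie algebra, with $x\ne0$, such that $[h,x]=2x$, $[h,y]=-2y$, $[x,y]=h$. With $X=\begin{pmatrix}0&1\\0&0\end{pmatrix}$, $Y=\begin{pmatrix}0&0\\1&0\end{pmatrix}$, $H=\begin{pmatrix}1&0\\0&-1\end{pmatrix}$, it defines an embedding of $\mathfrak{sl}(2,\mathbb R)$ by $X\mapsto x$, $Y\mapsto y$, $H\mapsto h$. For $r\ge0$, $V_r$ is the irreducible real $\mathfrak{sl}(2,\mathbb R)$-module of dimension $r+1$, with weight spaces $V_r(k)=\ker(H-k)$, and $B_r$ is a fixed nonzero invariant real bilinear form on it (unique up to scale; symmetric if $r$ is even, symplectic if $r$ is odd), normalized so that for $r=2m$ it has signature $(m+1,m)$, and for $r$ odd $B_r(v,X\cdot v)\ge0$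 for all $v\in V_r(-1)$. Multiplicity spaces: via the standard triple, $\mathbb H^n$ is an $\mathbb H$-linear $\mathfrak{sl}(2,\mathbb R)$-module with invariant form $B$, and there is an $\mathbb H$-linear isometric isomorphism of $\mathfrak{sl}(2,\mathbb R)$-modules $(\mathbb H^n,B)\simeq\bigoplus_r(V_r\otimes_{\mathbb R}W_r,\;B_r\otimes\phi_r)$ with $W_r$ quaternionic vector spaces on which $\mathfrak{sl}(2,\mathbb R)$ acts trivially; the isometry classes of the $(W_r,\phi_r)$ are well defined. Gibbs states: for a real semisimple Lie algebra $\mathfrak g$ with Killing form $\kappa$, an adjoint orbit $\mathcal O$ carries the symplectic form $\omega_{\mathcal O}|_y([X,y],[Y,y])=\kappa(y,[X,Y])$ and the Liouville form $\lambda_{\mathcal O}=\omega_{\mathcal O}^{\dim\mathcal O/2}$. For $\beta\in\mathfrak g^*$ put $Z(\beta)=\int_{\mathcal O}e^{-\langle\beta,y\rangle}|\lambda_{\mathcal O}|(y)\in(0,+\infty]$. $\mathcal O$ admits a Gibbs state (the probability distribution $Z(\beta)^{-1}e^{-\langle\beta,y\rangle}|\lambda_{\mathcal O}|(y)$) if $Z(\beta)<\infty$ for some $\beta$. *)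

theory Defs
  imports "HOL-Analysis.Analysis"
begin

section \<open>Quaternions\<close>

datatype quat = Quat (qre: real) (qi: real) (qj: real) (qk: real)

lemma quat_eq_iff: "a = b \<longleftrightarrow> qre a = qre b \<and> qi a = qi b \<and> qj a = qj b \<and> qk a = qk b"
  by (cases a; cases b) simp

instantiation quat :: ab_group_add
begin
definition "0 = Quat 0 0 0 0"
definition "a + b = Quat (qre a + qre b) (qi a + qi b) (qj a + qj b) (qk a + qk b)"
definition "- a = Quat (- qre a) (- qi a) (- qj a) (- qk a)"
definition "a - b = Quat (qre a - qre b) (qi a - qi b) (qj a - qj b) (qk a - qk b)"
instance
  by standard (simp_all add: zero_quat_def plus_quat_def uminus_quat_def minus_quat_def)
end

lemma quat_add_sel [simp]:
  "qre 0 = 0" "qi 0 = 0" "qj 0 = 0" "qk 0 = 0"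
  "qre (a + b) = qre a + qre b" "qi (a + b) = qi a + qi b"
  "qj (a + b) = qj a + qj b" "qk (a + b) = qk a + qk b"
  "qre (- a) = - qre a" "qi (- a) = - qi a" "qj (- a) = - qj a" "qk (- a) = - qk a"
  "qre (a - b) = qre a - qre b" "qi (a - b) = qi a - qi b"
  "qj (a - b) = qj a - qj b" "qk (a - b) = qk a - qk b"
  by (simp_all add: zero_quat_def plus_quat_def uminus_quat_def minus_quat_def)

instantiation quat :: real_algebra_1
begin
definition "1 = Quat 1 0 0 0"
definition "a * b = Quat
  (qre a * qre b - qi a * qi b - qj a * qj b - qk a * qk b)
  (qre a * qi b + qi a * qre b + qj a * qk b - qk a * qj b)
  (qre a * qj b - qi a * qk b + qj a * qre b + qk a * qi b)
  (qre a * qk b + qi a * qj b - qj a * qi b + qk a * qre b)"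
definition "scaleR s a = Quat (s * qre a) (s * qi a) (s * qj a) (s * qk a)"
instance
  by standard
    (auto simp: quat_eq_iff one_quat_def times_quat_def scaleR_quat_def algebra_simps)
end

lemma quat_mult_sel [simp]:
  "qre 1 = 1" "qi 1 = 0" "qj 1 = 0" "qk 1 = 0"
  "qre (a * b) = qre a * qre b - qi a * qi b - qj a * qj b - qk a * qk b"
  "qi (a * b) = qre a * qi b + qi a * qre b + qj a * qk b - qk a * qj b"
  "qj (a * b) = qre a * qj b - qi a * qk b + qj a * qre b + qk a * qi b"
  "qk (a * b) = qre a * qk b + qi a * qj b - qj a * qi b + qk a * qre b"
  "qre (s *\<^sub>R a) = s * qre a" "qi (s *\<^sub>R a) = s * qi a"
  "qj (s *\<^sub>R a) = s * qj a" "qk (s *\<^sub>R a) = s * qk a"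
  by (simp_all add: one_quat_def times_quat_def scaleR_quat_def)

definition qcnj :: "quat \<Rightarrow> quat" where
  "qcnj a = Quat (qre a) (- qi a) (- qj a) (- qk a)"

lemma qcnj_sel [simp]:
  "qre (qcnj a) = qre a" "qi (qcnj a) = - qi a" "qj (qcnj a) = - qj a" "qk (qcnj a) = - qk a"
  by (simp_all add: qcnj_def)

instantiation quat :: real_inner
begin
definition "inner a b = qre a * qre b + qi a * qi b + qj a * qj b + qk a * qk b"
definition norm_quat_def: "norm (a::quat) = sqrt (inner a a)"
definition sgn_quat_def: "sgn (a::quat) = a /\<^sub>R norm a"
definition dist_quat_def: "dist (a::quat) b = norm (a - b)"
definition uniformity_quat_def [code del]:
  "(uniformity :: (quat \<times> quat) filter) = (INF e\<in>{0 <..}. principal {(a, b). dist a b < e})"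
definition open_quat_def [code del]:
  "open (U :: quat set) \<longleftrightarrow> (\<forall>a\<in>U. eventually (\<lambda>(a', b). a' = a \<longrightarrow> b \<in> U) uniformity)"
instance
proof
  fix r :: real and a b c :: quat
  show "inner a b = inner b a" "inner (a + b) c = inner a c + inner b c"
    "inner (r *\<^sub>R a) b = r * inner a b" "0 \<le> inner a a"
    by (simp_all add: inner_quat_def algebra_simps)
  show "(inner a a = 0) = (a = 0)"
    by (auto simp: inner_quat_def quat_eq_iff add_nonneg_eq_0_iff)
qed (rule norm_quat_def sgn_quat_def dist_quat_def open_quat_def uniformity_quat_def)+
end

lemma norm_quat: "norm (a::quat) = sqrt ((qre a)\<^sup>2 + (qi a)\<^sup>2 + (qj a)\<^sup>2 + (qk a)\<^sup>2)"
  by (simp add: norm_quat_def inner_quat_def power2_eq_square)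

lemma quat_mult_qcnj: "a * qcnj a = ((norm a)\<^sup>2) *\<^sub>R 1" "qcnj a * a = ((norm a)\<^sup>2) *\<^sub>R 1"
  by (simp_all add: quat_eq_iff norm_quat power2_eq_square)

instantiation quat :: real_normed_div_algebra
begin
definition inverse_quat_def: "inverse (a::quat) = qcnj a /\<^sub>R (norm a)\<^sup>2"
definition divide_quat_def: "(a::quat) div b = a * inverse b"
instance
proof
  fix a b :: quat
  show "a \<noteq> 0 \<Longrightarrow> inverse a * a = 1" "a \<noteq> 0 \<Longrightarrow> a * inverse a = 1"
    by (simp_all add: inverse_quat_def quat_mult_qcnj)
  show "inverse (0::quat) = 0"
    by (simp add: inverse_quat_def quat_eq_iff)
  show "norm (a * b) = norm a * norm b"
    unfolding norm_quat real_sqrt_mult [symmetric] real_sqrt_eq_iff quat_mult_sel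
    by algebra
qed (rule divide_quat_def)
end

instantiation quat :: euclidean_space
begin
definition "Basis = {Quat 1 0 0 0, Quat 0 1 0 0, Quat 0 0 1 0, Quat 0 0 0 1}"
instance
proof
  show "(Basis :: quat set) \<noteq> {}" "finite (Basis :: quat set)"
    by (simp_all add: Basis_quat_def)
  show "inner u v = (if u = v then 1 else 0)" if "u \<in> Basis" "v \<in> Basis" for u v :: quat
    using that unfolding Basis_quat_def insert_iff empty_iff inner_quat_def
    by (elim disjE FalseE) simp_all
  show "(\<forall>u\<in>Basis. inner a u = 0) \<longleftrightarrow> a = 0" for a :: quat
    by (simp add: Basis_quat_def inner_quat_def) (simp add: quat_eq_iff)
qed
end


section \<open>Quaternionic vector spaces and forms\<close>

text \<open>Quaternionic vector spaces are right modules, so that forms which are antilinear on the left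
  and linear on the right satisfy \<open>\<phi> (u a) (v b) = qcnj a * \<phi> u v * b\<close>, and quaternionic
  matrices act linearly on column vectors from the left.\<close>

class quat_vector = real_vector +
  fixes scaleQ :: "'a \<Rightarrow> quat \<Rightarrow> 'a"  (infixl "*\<^sub>Q" 75)
  assumes scaleQ_add_left: "(v + w) *\<^sub>Q a = v *\<^sub>Q a + w *\<^sub>Q a"
    and scaleQ_add_right: "v *\<^sub>Q (a + b) = v *\<^sub>Q a + v *\<^sub>Q b"
    and scaleQ_scaleQ: "v *\<^sub>Q a *\<^sub>Q b = v *\<^sub>Q (a * b)"
    and scaleQ_of_real: "v *\<^sub>Q (of_real s) = s *\<^sub>R v"

instantiation quat :: quat_vector
begin
definition scaleQ_quat_def: "(v::quat) *\<^sub>Q a = v * a"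
instance
  by standard (simp_all add: scaleQ_quat_def algebra_simps of_real_def)
end

instantiation vec :: (quat_vector, finite) quat_vector
begin
definition scaleQ_vec_def: "v *\<^sub>Q a = (\<chi> i. v $ i *\<^sub>Q a)"
instance
  by standard
    (simp_all add: scaleQ_vec_def vec_eq_iff scaleQ_add_left scaleQ_add_right scaleQ_scaleQ
      scaleQ_of_real)
end

definition qsubspace :: "'w::quat_vector set \<Rightarrow> bool" where
  "qsubspace W \<longleftrightarrow> 0 \<in> W \<and> (\<forall>u\<in>W. \<forall>v\<in>W. u + v \<in> W) \<and> (\<forall>u\<in>W. \<forall>a. u *\<^sub>Q a \<in> W)"

definition sesquilinear_on :: "'w::quat_vector set \<Rightarrow> ('w \<Rightarrow> 'w \<Rightarrow> quat) \<Rightarrow> bool" where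
  "sesquilinear_on W \<phi> \<longleftrightarrow>
     (\<forall>u\<in>W. \<forall>v\<in>W. \<forall>w\<in>W. \<phi> (u + v) w = \<phi> u w + \<phi> v w \<and> \<phi> w (u + v) = \<phi> w u + \<phi> w v) \<and>
     (\<forall>u\<in>W. \<forall>v\<in>W. \<forall>a. \<phi> (u *\<^sub>Q a) v = qcnj a * \<phi> u v \<and> \<phi> u (v *\<^sub>Q a) = \<phi> u v * a)"

definition hermitian_on :: "'w::quat_vector set \<Rightarrow> ('w \<Rightarrow> 'w \<Rightarrow> quat) \<Rightarrow> bool" where
  "hermitian_on W \<phi> \<longleftrightarrow> sesquilinear_on W \<phi> \<and> (\<forall>u\<in>W. \<forall>v\<in>W. \<phi> v u = qcnj (\<phi> u v))"

definition skew_hermitian_on :: "'w::quat_vector set \<Rightarrow> ('w \<Rightarrow> 'w \<Rightarrow> quat) \<Rightarrow> bool" where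
  "skew_hermitian_on W \<phi> \<longleftrightarrow> sesquilinear_on W \<phi> \<and> (\<forall>u\<in>W. \<forall>v\<in>W. \<phi> v u = - qcnj (\<phi> u v))"

definition nondegenerate_on :: "'w::quat_vector set \<Rightarrow> ('w \<Rightarrow> 'w \<Rightarrow> quat) \<Rightarrow> bool" where
  "nondegenerate_on W \<phi> \<longleftrightarrow> (\<forall>u\<in>W. (\<forall>v\<in>W. \<phi> u v = 0) \<longrightarrow> u = 0)"

text \<open>Signature \<open>(p, q)\<close>: there is an orthogonal basis over the quaternions consisting of \<open>p\<close> vectors
  with \<open>\<phi> e e = 1\<close> and \<open>q\<close> vectors with \<open>\<phi> e e = -1\<close>. (Independence follows from the Gram matrix.)\<close>

definition has_signature :: "'w::quat_vector set \<Rightarrow> ('w \<Rightarrow> 'w \<Rightarrow> quat) \<Rightarrow> nat \<times> nat \<Rightarrow> bool" where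
  "has_signature W \<phi> = (\<lambda>(p, q). \<exists>e. (\<forall>i<p+q. e i \<in> W) \<and>
     (\<forall>w\<in>W. \<exists>c. w = (\<Sum>i<p+q. e i *\<^sub>Q c i)) \<and>
     (\<forall>i<p+q. \<forall>j<p+q. \<phi> (e i) (e j) = (if i \<noteq> j then 0 else if i < p then 1 else -1)))"


section \<open>The group, its Lie algebra, standard triples\<close>

definition SO_star :: "(quat^'n \<Rightarrow> quat^'n \<Rightarrow> quat) \<Rightarrow> (quat^'n^'n) set" where
  "SO_star B = {g. invertible g \<and> (\<forall>v w. B (g *v v) (g *v w) = B v w)}"

definition so_star :: "(quat^'n \<Rightarrow> quat^'n \<Rightarrow> quat) \<Rightarrow> (quat^'n^'n) set" where
  "so_star B = {A. \<forall>v w. B (A *v v) w + B v (A *v w) = 0}"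

definition adj_orbit :: "(quat^'n^'n) set \<Rightarrow> quat^'n^'n \<Rightarrow> (quat^'n^'n) set" where
  "adj_orbit G x = {g ** x ** matrix_inv g | g. g \<in> G}"

definition lie_bracket :: "quat^'n^'n \<Rightarrow> quat^'n^'n \<Rightarrow> quat^'n^'n" where
  "lie_bracket A C = A ** C - C ** A"

definition standard_triple ::
    "(quat^'n^'n) set \<Rightarrow> quat^'n^'n \<Rightarrow> quat^'n^'n \<Rightarrow> quat^'n^'n \<Rightarrow> bool" where
  "standard_triple L x y h \<longleftrightarrow> x \<in> L \<and> y \<in> L \<and> h \<in> L \<and> x \<noteq> 0 \<and>
     lie_bracket h x = 2 *\<^sub>R x \<and> lie_bracket h y = - (2 *\<^sub>R y) \<and> lie_bracket x y = h"


section \<open>Irreducible \<open>sl(2,\<real>)\<close>-modules and multiplicity spaces\<close>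

text \<open>\<open>V\<^sub>r\<close> is realized with a basis \<open>e\<^sub>0, \<dots>, e\<^sub>r\<close> such that \<open>H e\<^sub>k = (r - 2k) e\<^sub>k\<close>, \<open>Y e\<^sub>k = e\<^sub>k\<^sub>+\<^sub>1\<close>,
  \<open>X e\<^sub>k = k (r - k + 1) e\<^sub>k\<^sub>-\<^sub>1\<close>. An element of \<open>V\<^sub>r \<otimes> W\<close> is represented by its sequence of coefficients
  in \<open>W\<close>, i.e. \<open>f\<close> stands for the sum of the \<open>e\<^sub>k \<otimes> f k\<close>, and \<open>V\<^sub>r\<close> itself is the case \<open>W = \<real>\<close>.\<close>

definition Vtensor :: "nat \<Rightarrow> 'a::real_vector set \<Rightarrow> (nat \<Rightarrow> 'a) set" where
  "Vtensor r W = {f. (\<forall>k\<le>r. f k \<in> W) \<and> (\<forall>k>r. f k = 0)}"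

definition actH :: "nat \<Rightarrow> (nat \<Rightarrow> 'a::real_vector) \<Rightarrow> nat \<Rightarrow> 'a" where
  "actH r f k = (real r - 2 * real k) *\<^sub>R f k"

definition actX :: "nat \<Rightarrow> (nat \<Rightarrow> 'a::real_vector) \<Rightarrow> nat \<Rightarrow> 'a" where
  "actX r f k = (if k < r then (real (k + 1) * real (r - k)) *\<^sub>R f (k + 1) else 0)"

definition actY :: "nat \<Rightarrow> (nat \<Rightarrow> 'a::real_vector) \<Rightarrow> nat \<Rightarrow> 'a" where
  "actY r f k = (if 1 \<le> k \<and> k \<le> r then f (k - 1) else 0)"

abbreviation Vmod :: "nat \<Rightarrow> (nat \<Rightarrow> real) set" where
  "Vmod r \<equiv> Vtensor r UNIV"

text \<open>A bilinear form on \<open>V\<^sub>r\<close> is given by its Gram matrix \<open>b j k\<close> for \<open>j, k \<le> r\<close>.\<close>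

definition Vform :: "nat \<Rightarrow> (nat \<Rightarrow> nat \<Rightarrow> real) \<Rightarrow> (nat \<Rightarrow> real) \<Rightarrow> (nat \<Rightarrow> real) \<Rightarrow> real" where
  "Vform r b v w = (\<Sum>j\<le>r. \<Sum>k\<le>r. b j k * v j * w k)"

definition sl2_invariant :: "nat \<Rightarrow> (nat \<Rightarrow> nat \<Rightarrow> real) \<Rightarrow> bool" where
  "sl2_invariant r b \<longleftrightarrow> (\<forall>v\<in>Vmod r. \<forall>w\<in>Vmod r.
     Vform r b (actX r v) w + Vform r b v (actX r w) = 0 \<and>
     Vform r b (actY r v) w + Vform r b v (actY r w) = 0 \<and>
     Vform r b (actH r v) w + Vform r b v (actH r w) = 0)"

text \<open>With \<open>p + q = r + 1\<close>, vectors with this Gram matrix automatically form a basis of \<open>V\<^sub>r\<close>.\<close>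

definition V_signature :: "nat \<Rightarrow> (nat \<Rightarrow> nat \<Rightarrow> real) \<Rightarrow> nat \<times> nat \<Rightarrow> bool" where
  "V_signature r b = (\<lambda>(p, q). p + q = r + 1 \<and> (\<exists>e. (\<forall>i<p+q. e i \<in> Vmod r) \<and>
     (\<forall>i<p+q. \<forall>j<p+q. Vform r b (e i) (e j) = (if i \<noteq> j then 0 else if i < p then 1 else -1))))"

definition normalized_form :: "nat \<Rightarrow> (nat \<Rightarrow> nat \<Rightarrow> real) \<Rightarrow> bool" where
  "normalized_form r b \<longleftrightarrow> sl2_invariant r b \<and>
     (\<exists>v\<in>Vmod r. \<exists>w\<in>Vmod r. Vform r b v w \<noteq> 0) \<and>
     (even r \<longrightarrow> V_signature r b (r div 2 + 1, r div 2)) \<and>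
     (odd r \<longrightarrow> (\<forall>v\<in>Vmod r. actH r v = (\<lambda>k. - v k) \<longrightarrow> Vform r b v (actX r v) \<ge> 0))"

definition tensor_form ::
    "nat \<Rightarrow> (nat \<Rightarrow> nat \<Rightarrow> real) \<Rightarrow> ('w \<Rightarrow> 'w \<Rightarrow> quat) \<Rightarrow> (nat \<Rightarrow> 'w) \<Rightarrow> (nat \<Rightarrow> 'w) \<Rightarrow> quat" where
  "tensor_form r b \<phi> f g = (\<Sum>j\<le>r. \<Sum>k\<le>r. b j k *\<^sub>R \<phi> (f j) (g k))"

text \<open>The direct sum of the \<open>V\<^sub>r \<otimes> W\<^sub>r\<close>, as families with finitely many nonzero members.\<close>

definition isotypic_sum :: "(nat \<Rightarrow> 'w::quat_vector set) \<Rightarrow> (nat \<Rightarrow> nat \<Rightarrow> 'w) set" where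
  "isotypic_sum W = {F. (\<forall>r. F r \<in> Vtensor r (W r)) \<and> finite {r. F r \<noteq> (\<lambda>_. 0)}}"

text \<open>\<open>(W\<^sub>r, \<phi>\<^sub>r)\<close> is a family of multiplicity spaces: \<open>\<Psi>\<close> is a quaternion-linear isometric isomorphism
  of modules from the direct sum of the \<open>(V\<^sub>r \<otimes> W\<^sub>r, B\<^sub>r \<otimes> \<phi>\<^sub>r)\<close> to the given space, on which
  \<open>X, Y, H\<close> act through \<open>x, y, h\<close>.\<close>

definition multiplicity_spaces ::
    "(quat^'n \<Rightarrow> quat^'n \<Rightarrow> quat) \<Rightarrow> quat^'n^'n \<Rightarrow> quat^'n^'n \<Rightarrow> quat^'n^'n \<Rightarrow>
     (nat \<Rightarrow> nat \<Rightarrow> nat \<Rightarrow> real) \<Rightarrow> (nat \<Rightarrow> 'w::quat_vector set) \<Rightarrow> (nat \<Rightarrow> 'w \<Rightarrow> 'w \<Rightarrow> quat) \<Rightarrow> bool"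
  where
  "multiplicity_spaces B x y h b W \<phi> \<longleftrightarrow>
     (\<forall>r. qsubspace (W r) \<and> sesquilinear_on (W r) (\<phi> r)) \<and>
     (\<exists>\<Psi>. bij_betw \<Psi> (isotypic_sum W) UNIV \<and>
       (\<forall>F\<in>isotypic_sum W.
          (\<forall>G\<in>isotypic_sum W. \<Psi> (\<lambda>r k. F r k + G r k) = \<Psi> F + \<Psi> G) \<and>
          (\<forall>a. \<Psi> (\<lambda>r k. F r k *\<^sub>Q a) = \<Psi> F *\<^sub>Q a) \<and>
          \<Psi> (\<lambda>r. actX r (F r)) = x *v \<Psi> F \<and>
          \<Psi> (\<lambda>r. actY r (F r)) = y *v \<Psi> F \<and>
          \<Psi> (\<lambda>r. actH r (F r)) = h *v \<Psi> F \<and>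
          (\<forall>G\<in>isotypic_sum W.
             B (\<Psi> F) (\<Psi> G) =
               (\<Sum>r | F r \<noteq> (\<lambda>_. 0). tensor_form r (b r) (\<phi> r) (F r) (G r)))))"


section \<open>Killing form, Liouville measure and Gibbs states\<close>

text \<open>Trace of a linear endomorphism of a finite-dimensional subspace, computed in any basis.\<close>

definition trace_on :: "'a::real_vector set \<Rightarrow> ('a \<Rightarrow> 'a) \<Rightarrow> real" where
  "trace_on S f = (let E = (SOME E. E \<subseteq> S \<and> independent E \<and> span E = S)
                   in \<Sum>b\<in>E. representation E (f b) b)"

definition killing_form :: "(quat^'n^'n) set \<Rightarrow> quat^'n^'n \<Rightarrow> quat^'n^'n \<Rightarrow> real" where
  "killing_form L a c = trace_on L (\<lambda>z. lie_bracket a (lie_bracket c z))"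

definition orbit_tangent :: "(quat^'n^'n) set \<Rightarrow> quat^'n^'n \<Rightarrow> (quat^'n^'n) set" where
  "orbit_tangent L y = {lie_bracket X y | X. X \<in> L}"

text \<open>\<open>\<omega>\<^sub>y([X,y],[Y,y]) = \<kappa>(y,[X,Y])\<close>; by invariance of \<open>\<kappa>\<close> the choice of \<open>X\<close> and \<open>Y\<close> is irrelevant.\<close>

definition orbit_symplectic ::
    "(quat^'n^'n) set \<Rightarrow> quat^'n^'n \<Rightarrow> quat^'n^'n \<Rightarrow> quat^'n^'n \<Rightarrow> real" where
  "orbit_symplectic L y u v =
     (let X = (SOME X. X \<in> L \<and> lie_bracket X y = u);
          Y = (SOME Y. Y \<in> L \<and> lie_bracket Y y = v)
      in killing_form L y (lie_bracket X Y))"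

text \<open>The value \<open>(\<omega> \<and> \<dots> \<and> \<omega>)(v\<^sub>0, \<dots>, v\<^sub>2\<^sub>m\<^sub>-\<^sub>1)\<close> of the \<open>m\<close>-fold exterior power of a 2-form.\<close>

definition wedge_power :: "nat \<Rightarrow> ('a \<Rightarrow> 'a \<Rightarrow> real) \<Rightarrow> (nat \<Rightarrow> 'a) \<Rightarrow> real" where
  "wedge_power m \<omega> v =
     (\<Sum>\<sigma> | \<sigma> permutes {..<2*m}.
        of_int (sign \<sigma>) * (\<Prod>i<m. \<omega> (v (\<sigma> (2*i))) (v (\<sigma> (2*i+1))))) / 2 ^ m"

text \<open>The dimension of the tangent spaces is constant along an orbit.\<close>

definition orbit_dim :: "(quat^'n^'n) set \<Rightarrow> (quat^'n^'n) set \<Rightarrow> nat" where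
  "orbit_dim L Orb = dim (orbit_tangent L (SOME y. y \<in> Orb))"

text \<open>Local \<open>C\<^sup>1\<close> parametrizations of the orbit by open subsets \<open>U\<close> of \<open>\<real>\<^sup>d\<close>. The dimension \<open>d\<close> depends
  on the orbit, so \<open>\<real>\<^sup>d\<close> is the space of extensional functions on \<open>{..<d}\<close>; \<open>C\<^sup>1\<close> means that
  the partial derivatives \<open>c' i\<close> exist and are continuous.\<close>

definition orbit_param ::
    "(quat^'n^'n) set \<Rightarrow> (quat^'n^'n) set \<Rightarrow> (nat \<Rightarrow> real) set \<Rightarrow> ((nat \<Rightarrow> real) \<Rightarrow> quat^'n^'n) \<Rightarrow>
     (nat \<Rightarrow> (nat \<Rightarrow> real) \<Rightarrow> quat^'n^'n) \<Rightarrow> bool" where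
  "orbit_param L Orb U c c' \<longleftrightarrow>
     (let d = orbit_dim L Orb; Rd = product_topology (\<lambda>_. euclideanreal) {..<d} in
       openin Rd U \<and> inj_on c U \<and> c ` U \<subseteq> Orb \<and>
       (\<forall>i<d. \<forall>u\<in>U. ((\<lambda>t. c (u(i := t))) has_vector_derivative c' i u) (at (u i))) \<and>
       (\<forall>i<d. continuous_map (subtopology Rd U) euclidean (c' i)) \<and>
       (\<forall>u\<in>U. span ((\<lambda>i. c' i u) ` {..<d}) = orbit_tangent L (c u)))"

text \<open>The measure \<open>|\<lambda>|\<close> on the orbit, regarded as a Borel measure on the ambient space. In a local
  parametrization \<open>c\<close> it is the image of the measure with density
  \<open>|\<lambda>(c' 0, \<dots>, c' (d-1))|\<close> with respect to Lebesgue measure. These images are restrictions of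
  \<open>|\<lambda>|\<close> to the open subsets \<open>c ` U\<close>, countably many of which cover the orbit, so \<open>|\<lambda>|\<close> is their
  supremum in the lattice of measures.\<close>

definition liouville_measure :: "(quat^'n^'n) set \<Rightarrow> (quat^'n^'n) set \<Rightarrow> (quat^'n^'n) measure" where
  "liouville_measure L Orb =
     (let d = orbit_dim L Orb in
      SUP (U, c, c') \<in> {(U, c, c'). orbit_param L Orb U c c'}.
        distr (density (restrict_space (PiM {..<d} (\<lambda>_. lborel)) U)
                 (\<lambda>u. ennreal \<bar>wedge_power (d div 2) (orbit_symplectic L (c u)) (\<lambda>i. c' i u)\<bar>))
              borel c)"

definition partition_function ::
    "(quat^'n^'n) set \<Rightarrow> (quat^'n^'n) set \<Rightarrow> (quat^'n^'n \<Rightarrow> real) \<Rightarrow> ennreal" where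
  "partition_function L Orb \<beta> = (\<integral>\<^sup>+ y. ennreal (exp (- \<beta> y)) \<partial>liouville_measure L Orb)"

text \<open>Every linear functional on \<open>L\<close> is the restriction of one on the ambient space, and the partition
  function only depends on that restriction.\<close>

definition admits_gibbs_state :: "(quat^'n^'n) set \<Rightarrow> (quat^'n^'n) set \<Rightarrow> bool" where
  "admits_gibbs_state L Orb \<longleftrightarrow> (\<exists>\<beta>. linear \<beta> \<and> partition_function L Orb \<beta> < \<infinity>)"

end

(* Multiplication by signs on the weight spaces of the V_r turns x into -x. It changes B_r by the sign
   (-1)^r, which has to be compensated by an anti-isometry of (W_r, phi_r) for odd r; there is one if
   and only if the signature of phi_r is split. Conversely, on the kernel of x^(r+1) the form
   B v (x^r w) induces a multiple of phi_r on a quotient isomorphic to W_r. An element of the group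
   mapping x to -x changes its sign for odd r, so that phi_r is split by the law of inertia.

   If the orbit is stable under negation, so is its Liouville measure, and Z(beta) = Z(-beta). If
   these are finite, then so is the volume of the orbit, because 1 <= exp t + exp (-t). But the orbit
   is a cone and dilations by s multiply the volume by a positive power of s, so that the volume would
   vanish. It does not vanish, because the Killing form, 4 (n - 1) times the real part of the trace
   form, makes the orbit symplectic. *)
theory Submission
  imports Defs
begin

text \<open>Without determinants over the quaternions, invertibility comes from real linear algebra
  and signatures from elimination over a division ring. The scale 4 comes from exp((log 2) h), which
  conjugates \<open>x\<close> to \<open>4 x\<close> and has the eigenvalues 2^(r - 2 k) on V_r.
  \<open>liouville_measure\<close> is a supremum over all charts, measurable or not, so only
  inequalities come directly: a dilated chart is a chart, hence the measure is bounded by a rescaled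
  image of itself. For a finite volume this bound already forces zero. Nonvanishing takes a single
  chart whose density is continuous and positive. That chart uses the Cayley transform rather than
  the exponential: it is rational, and the difference of its values at two points has an exact
  formula, which yields injectivity and the derivative together and avoids an inverse function
  theorem. The power of s is half the dimension of the orbit. This is positive because a Darboux
  basis makes the dimension even and [h, x] = 2 x is a nonzero tangent vector. The factor n - 1 of
  the Killing form is nonzero because the quaternions themselves contain no standard triple.\<close>

section \<open>Quaternionic matrices\<close>

text \<open>Gaussian elimination works over a division ring as long as coefficients stay to the left
  of the unknowns, which matches coordinates in a right vector space. This stands in for dimension
  theory over the quaternions, both in the law of inertia and in bounding the length of orthogonal
  systems.\<close>

lemma underdetermined_system:
  fixes a :: "'i \<Rightarrow> 'j \<Rightarrow> 'a::division_ring"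
  assumes "finite I" "finite J" "card I < card J"
  shows "\<exists>c. (\<exists>j\<in>J. c j \<noteq> 0) \<and> (\<forall>i\<in>I. (\<Sum>j\<in>J. a i j * c j) = 0)"
  using assms
proof (induction I arbitrary: a J rule: finite_induct)
  case empty
  then show ?case by (intro exI[of _ "\<lambda>_. 1"]) (auto simp: card_gt_0_iff)
next
  case (insert i0 I)
  show ?case
  proof (cases "\<forall>j\<in>J. a i0 j = 0")
    case True
    have "card I < card J" using insert by simp
    then obtain c where c: "\<exists>j\<in>J. c j \<noteq> 0" "\<forall>i\<in>I. (\<Sum>j\<in>J. a i j * c j) = 0"
      using insert.IH[OF insert.prems(1), of a] by blast
    with True show ?thesis by (intro exI[of _ c]) auto
  next
    case False
    then obtain j0 where j0: "j0 \<in> J" "a i0 j0 \<noteq> 0" by blast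
    define J' where "J' = J - {j0}"
    have J: "J = insert j0 J'" "j0 \<notin> J'" "finite J'" using j0 insert.prems by (auto simp: J'_def)
    have "card I < card J'" using insert J by simp
    \<comment> \<open>Elimination of the unknown \<open>j0\<close> with the pivot
      \<open>a i0 j0\<close>; the order of the factors matters because multiplication does not
      commute.\<close>
    define a' where "a' i j = a i j - a i j0 * inverse (a i0 j0) * a i0 j" for i j
    obtain c where c: "\<exists>j\<in>J'. c j \<noteq> 0" "\<And>i. i \<in> I \<Longrightarrow> (\<Sum>j\<in>J'. a' i j * c j) = 0"
      using insert.IH[OF J(3) \<open>card I < card J'\<close>, of a'] by blast
    define s where "s = (\<Sum>j\<in>J'. a i0 j * c j)"
    define c' where "c' = c(j0 := - inverse (a i0 j0) * s)"
    have c'J: "(\<Sum>j\<in>J'. a i j * c' j) = (\<Sum>j\<in>J'. a i j * c j)" for i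
      using J(2) by (intro sum.cong) (auto simp: c'_def)
    have *: "(\<Sum>j\<in>J. a i j * c' j) = - (a i j0 * inverse (a i0 j0) * s) + (\<Sum>j\<in>J'. a i j * c j)" for i
      unfolding J(1) using J(2,3) c'J by (simp add: c'_def mult.assoc)
    have "(\<Sum>j\<in>J. a i0 j * c' j) = 0"
      unfolding * using j0 by (simp add: s_def)
    moreover have "(\<Sum>j\<in>J. a i j * c' j) = 0" if "i \<in> I" for i
      unfolding * using c(2)[OF that] 
      by (simp add: a'_def left_diff_distrib sum_subtractf s_def sum_distrib_left mult.assoc)
    moreover have "\<exists>j\<in>J. c' j \<noteq> 0" using c(1) J by (auto simp: c'_def)
    ultimately show ?thesis by blast
  qed
qed

section \<open>Conjugation, right scalars and quaternion-linear maps\<close>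

lemma qcnj_simps [simp]:
  "qcnj (qcnj a) = a" "qcnj (a + c) = qcnj a + qcnj c" "qcnj (a * c) = qcnj c * qcnj a"
  "qcnj (- a) = - qcnj a" "qcnj (a - c) = qcnj a - qcnj c" "qcnj 0 = 0" "qcnj 1 = 1"
  "qcnj (s *\<^sub>R a) = s *\<^sub>R qcnj a" "qcnj (of_real s) = of_real s" "qcnj a = 0 \<longleftrightarrow> a = 0"
  by (auto simp: quat_eq_iff of_real_def algebra_simps)

lemma qcnj_sum: "qcnj (sum f A) = (\<Sum>i\<in>A. qcnj (f i))"
  by (induction A rule: infinite_finite_induct) auto

lemma scaleQ_simps [simp]:
  fixes v :: "'a::quat_vector"
  shows "v *\<^sub>Q 0 = 0" "(0::'a) *\<^sub>Q a = 0" "v *\<^sub>Q 1 = v" "(- v) *\<^sub>Q a = - (v *\<^sub>Q a)"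
    "v *\<^sub>Q (- a) = - (v *\<^sub>Q a)"
proof -
  show "v *\<^sub>Q 0 = 0" using scaleQ_of_real[of v 0] by simp
  have *: "(0::'a) *\<^sub>Q a = 0" for a using scaleQ_add_left[of "0::'a" 0 a] by simp
  then show "(0::'a) *\<^sub>Q a = 0" .
  show "v *\<^sub>Q 1 = v" using scaleQ_of_real[of v 1] by simp
  show "(- v) *\<^sub>Q a = - (v *\<^sub>Q a)" using scaleQ_add_left[of v "-v" a] * 
    by (simp add: eq_neg_iff_add_eq_0 add.commute)
  show "v *\<^sub>Q (- a) = - (v *\<^sub>Q a)" using scaleQ_add_right[of v a "-a"] \<open>v *\<^sub>Q 0 = 0\<close>
    by (simp add: eq_neg_iff_add_eq_0 add.commute)
qed

lemma scaleQ_sum_left: "(\<Sum>i\<in>A. f i) *\<^sub>Q a = (\<Sum>i\<in>A. f i *\<^sub>Q a)"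
  by (induction A rule: infinite_finite_induct) (auto simp: scaleQ_add_left)

lemma scaleR_scaleQ: "(s *\<^sub>R v) *\<^sub>Q a = s *\<^sub>R (v *\<^sub>Q a)"
proof -
  have "(s *\<^sub>R v) *\<^sub>Q a = v *\<^sub>Q (of_real s * a)"
    by (simp flip: scaleQ_of_real add: scaleQ_scaleQ)
  also have "of_real s * a = a * of_real s" by (simp add: of_real_def)
  finally show ?thesis by (simp flip: scaleQ_of_real add: scaleQ_scaleQ)
qed

lemma matrix_vector_mult_scaleQ: "(A :: quat^'n^'m) *v (v *\<^sub>Q a) = (A *v v) *\<^sub>Q a"
  by (simp add: vec_eq_iff matrix_vector_mult_def scaleQ_vec_def scaleQ_quat_def sum_distrib_right mult.assoc)

lemma qmat_scaleR_vec: "(s *\<^sub>R A) *v v = s *\<^sub>R ((A :: quat^'n^'m) *v v)"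
  by (simp add: vec_eq_iff matrix_vector_mult_def scaleR_sum_right)

lemma vec_eq_sum_axis_scaleQ: "(v :: quat^'n) = (\<Sum>i\<in>UNIV. axis i 1 *\<^sub>Q (v $ i))"
proof -
  have "axis i 1 $ j * v $ i = (if j = i then v $ i else 0)" for i j by (simp add: axis_def)
  then show ?thesis
    by (simp add: vec_eq_iff scaleQ_vec_def scaleQ_quat_def)
qed

lemma matrix_of_quat_linear:
  fixes f :: "quat^'n \<Rightarrow> quat^'m"
  assumes add: "\<And>v w. f (v + w) = f v + f w" and scale: "\<And>v a. f (v *\<^sub>Q a) = f v *\<^sub>Q a"
  obtains A where "\<And>v. f v = A *v v"
proof
  have "f 0 = 0" using add[of 0 0] by simp
  then have sum: "f (sum g I) = (\<Sum>i\<in>I. f (g i))" for I :: "'n set" and g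
    by (induction I rule: infinite_finite_induct) (auto simp: add)
  fix v
  have "f v = (\<Sum>i\<in>UNIV. f (axis i 1) *\<^sub>Q (v $ i))"
    by (subst vec_eq_sum_axis_scaleQ[of v]) (simp add: sum scale)
  then show "f v = (\<chi> j i. f (axis i 1) $ j) *v v"
    by (simp add: vec_eq_iff matrix_vector_mult_def scaleQ_vec_def scaleQ_quat_def)
qed

lemma qmat_eqI: "(\<And>v. A *v v = C *v v) \<Longrightarrow> A = (C :: quat^'n^'m)"
  by (simp add: matrix_eq)

text \<open>An injective real-linear endomorphism of a finite-dimensional space is bijective, and
  its inverse inherits quaternion-linearity, so it is again given by a matrix.\<close>

lemma invertible_quat_matrixI:
  fixes A :: "quat^'n^'n"
  assumes "\<And>v. A *v v = 0 \<Longrightarrow> v = 0"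
  shows "invertible A"
proof -
  have lin: "linear (\<lambda>v. A *v v)" by (rule matrix_vector_mul_linear)
  have inj: "inj (\<lambda>v. A *v v)" using assms linear_injective_0[OF lin] by blast
  have surj: "surj (\<lambda>v. A *v v)" using linear_injective_imp_surjective[OF lin inj] by simp
  define g where "g = inv (\<lambda>v. A *v v)"
  have Ag: "A *v g v = v" for v using surj_f_inv_f[OF surj, of v] by (simp add: g_def)
  have gA: "g (A *v v) = v" for v using inv_f_f[OF inj, of v] by (simp add: g_def)
  have "g (v + w) = g v + g w" for v w
    using gA[of "g v + g w"] by (simp add: matrix_vector_right_distrib Ag)
  moreover have "g (v *\<^sub>Q a) = g v *\<^sub>Q a" for v a
    using gA[of "g v *\<^sub>Q a"] by (simp add: matrix_vector_mult_scaleQ Ag)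
  ultimately obtain C where C: "\<And>v. g v = C *v v" using matrix_of_quat_linear by blast
  have "A ** C = mat 1" "C ** A = mat 1"
    by (rule qmat_eqI; simp add: matrix_vector_mul_assoc[symmetric] C[symmetric] Ag gA)+
  then show ?thesis unfolding invertible_def by blast
qed

lemma qmat_inv:
  assumes "invertible (A :: quat^'n^'n)"
  shows "A ** matrix_inv A = mat 1" "matrix_inv A ** A = mat 1"
  using someI_ex[OF assms[unfolded invertible_def]] unfolding matrix_inv_def by blast+

lemma qmat_inv_unique:
  assumes "A ** C = mat 1" "C ** A = mat (1::quat)"
  shows "matrix_inv A = (C :: quat^'n^'n)" "invertible A"
proof -
  show i: "invertible A" using assms unfolding invertible_def by blast
  have "matrix_inv A = matrix_inv A ** (A ** C)" by (simp add: assms)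
  also have "\<dots> = C" by (simp add: matrix_mul_assoc qmat_inv[OF i])
  finally show "matrix_inv A = C" .
qed

section \<open>The isometry group and its adjoint orbits\<close>

lemma SO_star_one: "mat 1 \<in> SO_star B"
  by (auto simp: SO_star_def invertible_def intro!: exI[of _ "mat 1"])

lemma SO_star_mult:
  assumes "g \<in> SO_star B" "k \<in> SO_star B"
  shows "g ** k \<in> SO_star B" "matrix_inv (g ** k) = matrix_inv k ** matrix_inv g"
proof -
  have inv: "invertible g" "invertible k" using assms by (auto simp: SO_star_def)
  have 1: "(g ** k) ** (matrix_inv k ** matrix_inv g) = mat 1"
    by (metis inv qmat_inv(1) matrix_mul_assoc matrix_mul_rid)
  have 2: "(matrix_inv k ** matrix_inv g) ** (g ** k) = mat 1"
    by (metis inv qmat_inv(2) matrix_mul_assoc matrix_mul_rid)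
  show "matrix_inv (g ** k) = matrix_inv k ** matrix_inv g"
    by (rule qmat_inv_unique[OF 1 2])
  show "g ** k \<in> SO_star B"
    using assms qmat_inv_unique(2)[OF 1 2]
    by (auto simp: SO_star_def matrix_vector_mul_assoc[symmetric])
qed

lemma SO_star_inv:
  assumes "g \<in> SO_star B" shows "matrix_inv g \<in> SO_star B" "matrix_inv (matrix_inv g) = g"
proof -
  have inv: "invertible g" and B: "\<And>v w. B (g *v v) (g *v w) = B v w" using assms by (auto simp: SO_star_def)
  note i = qmat_inv[OF inv]
  show "matrix_inv (matrix_inv g) = g" by (rule qmat_inv_unique[OF i(2,1)])
  have "B (matrix_inv g *v v) (matrix_inv g *v w) = B v w" for v w
    using B[of "matrix_inv g *v v" "matrix_inv g *v w"] by (simp add: matrix_vector_mul_assoc i)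
  with qmat_inv_unique(2)[OF i(2,1)] show "matrix_inv g \<in> SO_star B" by (simp add: SO_star_def)
qed

text \<open>The intertwining relation avoids \<open>matrix_inv\<close>; orbit membership is handled
  in this form from here on.\<close>

lemma adj_orbit_memI:
  assumes "g \<in> SO_star B" "g ** x = y ** g" shows "y \<in> adj_orbit (SO_star B) x"
proof -
  have "invertible g" using assms by (simp add: SO_star_def)
  then have "g ** x ** matrix_inv g = y"
    unfolding assms(2) by (simp add: matrix_mul_assoc[symmetric] qmat_inv)
  with assms(1) show ?thesis unfolding adj_orbit_def by blast
qed

lemma adj_orbit_memE:
  assumes "y \<in> adj_orbit (SO_star B) x" obtains g where "g \<in> SO_star B" "g ** x = y ** g"
proof -
  obtain g where g: "g \<in> SO_star B" "y = g ** x ** matrix_inv g" using assms by (auto simp: adj_orbit_def)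
  then have "invertible g" by (simp add: SO_star_def)
  then have "y ** g = g ** x" unfolding g(2) by (simp add: matrix_mul_assoc[symmetric] qmat_inv)
  with g(1) that show ?thesis by metis
qed

lemma qmat_scaleR:
  "(s *\<^sub>R A) ** C = s *\<^sub>R (A ** (C :: quat^'n^'m))" "A ** (s *\<^sub>R C) = s *\<^sub>R (A ** C)"
  by (simp_all add: vec_eq_iff matrix_matrix_mult_def scaleR_sum_right)

text \<open>Conjugation commutes with real scalars: if \<open>g\<close> takes \<open>x\<close> to
  \<open>s x\<close> and \<open>k\<close> takes \<open>x\<close> to \<open>y\<close>, then
  \<open>k ** g\<close> takes \<open>x\<close> to \<open>s y\<close>. One scaled point therefore
  scales the whole orbit.\<close>

lemma scaleR_adj_orbit:
  assumes "s *\<^sub>R x \<in> adj_orbit (SO_star B) x" "y \<in> adj_orbit (SO_star B) x"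
  shows "s *\<^sub>R y \<in> adj_orbit (SO_star B) x"
proof -
  obtain g where g: "g \<in> SO_star B" "g ** x = (s *\<^sub>R x) ** g" using assms(1) by (rule adj_orbit_memE)
  obtain k where k: "k \<in> SO_star B" "k ** x = y ** k" using assms(2) by (rule adj_orbit_memE)
  have "(k ** g) ** x = (s *\<^sub>R y) ** (k ** g)"
    by (metis g(2) k(2) matrix_mul_assoc qmat_scaleR)
  then show ?thesis using adj_orbit_memI[OF SO_star_mult(1)[OF k(1) g(1)]] by blast
qed

lemma uminus_adj_orbit_iff:
  "uminus ` adj_orbit (SO_star B) x = adj_orbit (SO_star B) x \<longleftrightarrow> - x \<in> adj_orbit (SO_star B) x"
proof
  have x: "x \<in> adj_orbit (SO_star B) x"
    by (rule adj_orbit_memI[OF SO_star_one]) simp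
  show "- x \<in> adj_orbit (SO_star B) x" if "uminus ` adj_orbit (SO_star B) x = adj_orbit (SO_star B) x"
    using x that by blast
  assume "- x \<in> adj_orbit (SO_star B) x"
  then have *: "- y \<in> adj_orbit (SO_star B) x" if "y \<in> adj_orbit (SO_star B) x" for y
    using scaleR_adj_orbit[of "-1" x B y] that by simp
  show "uminus ` adj_orbit (SO_star B) x = adj_orbit (SO_star B) x"
  proof (intro equalityI subsetI)
    show "y \<in> uminus ` adj_orbit (SO_star B) x" if "y \<in> adj_orbit (SO_star B) x" for y
      using *[OF that] by (metis image_eqI minus_minus)
  qed (use * in auto)
qed

section \<open>Sesquilinear forms and signatures\<close>

lemma qsubspaceD:
  assumes "qsubspace W"
  shows "0 \<in> W" "u \<in> W \<Longrightarrow> v \<in> W \<Longrightarrow> u + v \<in> W" "u \<in> W \<Longrightarrow> u *\<^sub>Q a \<in> W"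
    "u \<in> W \<Longrightarrow> s *\<^sub>R u \<in> W" "u \<in> W \<Longrightarrow> - u \<in> W" "u \<in> W \<Longrightarrow> v \<in> W \<Longrightarrow> u - v \<in> W"
proof -
  show 1: "0 \<in> W" "u \<in> W \<Longrightarrow> v \<in> W \<Longrightarrow> u + v \<in> W" "u \<in> W \<Longrightarrow> u *\<^sub>Q a \<in> W" for u v a
    using assms by (auto simp: qsubspace_def)
  show "u \<in> W \<Longrightarrow> s *\<^sub>R u \<in> W" using 1(3)[of u "of_real s"] by (simp add: scaleQ_of_real)
  show 2: "u \<in> W \<Longrightarrow> - u \<in> W" for u using 1(3)[of u "-1"] by simp
  show "u \<in> W \<Longrightarrow> v \<in> W \<Longrightarrow> u - v \<in> W" using 1(2)[of u "-v"] 2[of v] by simp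
qed

lemma qsubspace_sum: "qsubspace W \<Longrightarrow> (\<And>i. i \<in> I \<Longrightarrow> e i \<in> W) \<Longrightarrow> (\<Sum>i\<in>I. e i) \<in> W"
  by (induction I rule: infinite_finite_induct) (auto intro: qsubspaceD)

lemma sesquilinear_onD:
  assumes "sesquilinear_on W \<phi>"
  shows "u \<in> W \<Longrightarrow> v \<in> W \<Longrightarrow> w \<in> W \<Longrightarrow> \<phi> (u + v) w = \<phi> u w + \<phi> v w"
    "u \<in> W \<Longrightarrow> v \<in> W \<Longrightarrow> w \<in> W \<Longrightarrow> \<phi> w (u + v) = \<phi> w u + \<phi> w v"
    "u \<in> W \<Longrightarrow> v \<in> W \<Longrightarrow> \<phi> (u *\<^sub>Q a) v = qcnj a * \<phi> u v"
    "u \<in> W \<Longrightarrow> v \<in> W \<Longrightarrow> \<phi> u (v *\<^sub>Q a) = \<phi> u v * a"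
    "u \<in> W \<Longrightarrow> v \<in> W \<Longrightarrow> \<phi> (s *\<^sub>R u) v = s *\<^sub>R \<phi> u v"
    "u \<in> W \<Longrightarrow> v \<in> W \<Longrightarrow> \<phi> u (s *\<^sub>R v) = s *\<^sub>R \<phi> u v"
    "u \<in> W \<Longrightarrow> v \<in> W \<Longrightarrow> \<phi> (- u) v = - \<phi> u v"
    "u \<in> W \<Longrightarrow> v \<in> W \<Longrightarrow> \<phi> u (- v) = - \<phi> u v"
    "v \<in> W \<Longrightarrow> \<phi> 0 v = 0" "v \<in> W \<Longrightarrow> \<phi> v 0 = 0"
proof -
  note D = assms[unfolded sesquilinear_on_def]
  show "u \<in> W \<Longrightarrow> v \<in> W \<Longrightarrow> w \<in> W \<Longrightarrow> \<phi> (u + v) w = \<phi> u w + \<phi> v w"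
    "u \<in> W \<Longrightarrow> v \<in> W \<Longrightarrow> w \<in> W \<Longrightarrow> \<phi> w (u + v) = \<phi> w u + \<phi> w v"
    using D by blast+
  show 1: "u \<in> W \<Longrightarrow> v \<in> W \<Longrightarrow> \<phi> (u *\<^sub>Q a) v = qcnj a * \<phi> u v"
    "u \<in> W \<Longrightarrow> v \<in> W \<Longrightarrow> \<phi> u (v *\<^sub>Q a) = \<phi> u v * a" for u v a
    using D by blast+
  show "u \<in> W \<Longrightarrow> v \<in> W \<Longrightarrow> \<phi> (s *\<^sub>R u) v = s *\<^sub>R \<phi> u v"
    "u \<in> W \<Longrightarrow> v \<in> W \<Longrightarrow> \<phi> u (s *\<^sub>R v) = s *\<^sub>R \<phi> u v"
    using 1[of u v "of_real s"] by (simp_all add: scaleQ_of_real) (simp_all add: of_real_def)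
  show "u \<in> W \<Longrightarrow> v \<in> W \<Longrightarrow> \<phi> (- u) v = - \<phi> u v"
    "u \<in> W \<Longrightarrow> v \<in> W \<Longrightarrow> \<phi> u (- v) = - \<phi> u v"
    using 1[of u v "-1"] by simp_all
  show "v \<in> W \<Longrightarrow> \<phi> 0 v = 0" "v \<in> W \<Longrightarrow> \<phi> v 0 = 0"
    using 1[of v v 0] by simp_all
qed

lemma sesquilinear_on_sum:
  assumes W: "qsubspace W" and \<phi>: "sesquilinear_on W \<phi>" and e: "\<And>i. i \<in> I \<Longrightarrow> e i \<in> W" and v: "v \<in> W"
  shows "\<phi> (\<Sum>i\<in>I. e i) v = (\<Sum>i\<in>I. \<phi> (e i) v)" "\<phi> v (\<Sum>i\<in>I. e i) = (\<Sum>i\<in>I. \<phi> v (e i))"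
  using e
  by (induction I rule: infinite_finite_induct)
    (auto simp: sesquilinear_onD[OF \<phi>] v qsubspace_sum[OF W])

text \<open>Keeping the Gram condition apart from spanning lets one notion serve orthonormal bases,
  their subfamilies of one sign, and orthogonal systems of unknown length.\<close>

definition diagonal_gram :: "('w::quat_vector \<Rightarrow> 'w \<Rightarrow> quat) \<Rightarrow> nat set \<Rightarrow> (nat \<Rightarrow> 'w) \<Rightarrow> (nat \<Rightarrow> real) \<Rightarrow> bool" where
  "diagonal_gram \<phi> I e s \<longleftrightarrow> (\<forall>i\<in>I. \<forall>j\<in>I. \<phi> (e i) (e j) = (if i = j then of_real (s i) else 0))"

lemma diagonal_gram_coeff:
  assumes W: "qsubspace W" and \<phi>: "sesquilinear_on W \<phi>" and e: "\<And>i. i \<in> I \<Longrightarrow> e i \<in> W"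
    and g: "diagonal_gram \<phi> I e s" and I: "finite I" "i \<in> I"
  shows "\<phi> (e i) (\<Sum>j\<in>I. e j *\<^sub>Q c j) = of_real (s i) * c i"
proof -
  have "\<phi> (e i) (\<Sum>j\<in>I. e j *\<^sub>Q c j) = (\<Sum>j\<in>I. \<phi> (e i) (e j *\<^sub>Q c j))"
    by (rule sesquilinear_on_sum[OF W \<phi>]) (use e I qsubspaceD[OF W] in auto)
  also have "\<dots> = (\<Sum>j\<in>I. if j = i then of_real (s i) * c i else 0)"
    using g I e by (intro sum.cong) (auto simp: diagonal_gram_def sesquilinear_onD[OF \<phi>])
  finally show ?thesis using I by simp
qed

lemma diagonal_gram_form:
  assumes W: "qsubspace W" and \<phi>: "sesquilinear_on W \<phi>" and e: "\<And>i. i \<in> I \<Longrightarrow> e i \<in> W"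
    and g: "diagonal_gram \<phi> I e s" and I: "finite I"
  shows "\<phi> (\<Sum>i\<in>I. e i *\<^sub>Q c i) (\<Sum>j\<in>I. e j *\<^sub>Q d j) = (\<Sum>i\<in>I. s i *\<^sub>R (qcnj (c i) * d i))"
proof -
  have v: "(\<Sum>j\<in>I. e j *\<^sub>Q d j) \<in> W" by (intro qsubspace_sum qsubspaceD W e)
  have "\<phi> (\<Sum>i\<in>I. e i *\<^sub>Q c i) (\<Sum>j\<in>I. e j *\<^sub>Q d j) = (\<Sum>i\<in>I. \<phi> (e i *\<^sub>Q c i) (\<Sum>j\<in>I. e j *\<^sub>Q d j))"
    by (rule sesquilinear_on_sum[OF W \<phi>]) (use e v qsubspaceD[OF W] in auto)
  also have "\<dots> = (\<Sum>i\<in>I. s i *\<^sub>R (qcnj (c i) * d i))"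
    using diagonal_gram_coeff[OF W \<phi> e g I] e v
    by (intro sum.cong) (auto simp: sesquilinear_onD[OF \<phi>] of_real_def)
  finally show ?thesis .
qed

lemma qcnj_mult_self: "qcnj a * a = of_real ((norm a)\<^sup>2)"
  by (simp add: quat_mult_qcnj of_real_def)

lemma qre_of_real [simp]: "qre (of_real s) = s" "qre ((of_real s)\<^sup>2) = s\<^sup>2"
  by (simp_all add: of_real_def power2_eq_square)

lemma qre_sum: "qre (sum f A) = (\<Sum>i\<in>A. qre (f i))"
  by (induction A rule: infinite_finite_induct) auto

text \<open>Sylvester's law of inertia: a linear relation among the projections of the \<open>f j\<close> to the span
  of the \<open>e i\<close> of sign \<open>\<sigma>\<close> yields a vector on which the form has both signs.\<close>

lemma diagonal_gram_card_le:
  assumes W: "qsubspace W" and \<phi>: "sesquilinear_on W \<phi>"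
    and e: "\<And>i. i \<in> I \<Longrightarrow> e i \<in> W" "diagonal_gram \<phi> I e s" "finite I"
    and s: "\<And>i. i \<in> I \<Longrightarrow> s i = 1 \<or> s i = -1"
    and span: "\<And>w. w \<in> W \<Longrightarrow> \<exists>c. w = (\<Sum>i\<in>I. e i *\<^sub>Q c i)"
    and f: "\<And>j. j \<in> J \<Longrightarrow> f j \<in> W" "diagonal_gram \<phi> J f (\<lambda>_. \<sigma>)" "finite J"
    and \<sigma>: "\<sigma> = 1 \<or> \<sigma> = -1"
  shows "card J \<le> card {i\<in>I. s i = \<sigma>}"
proof (rule ccontr)
  define P where "P = {i\<in>I. s i = \<sigma>}"
  assume "\<not> ?thesis"
  then have "card P < card J" by (simp add: P_def)
  moreover have "finite P" using e(3) by (simp add: P_def)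
  ultimately obtain c where c: "\<exists>j\<in>J. c j \<noteq> 0" "\<And>i. i \<in> P \<Longrightarrow> (\<Sum>j\<in>J. \<phi> (e i) (f j) * c j) = 0"
    using underdetermined_system[of P J "\<lambda>i j. \<phi> (e i) (f j)"] f(3) by blast
  define v where "v = (\<Sum>j\<in>J. f j *\<^sub>Q c j)"
  have v: "v \<in> W" unfolding v_def by (intro qsubspace_sum qsubspaceD W f)
  obtain d where d: "v = (\<Sum>i\<in>I. e i *\<^sub>Q d i)" using span[OF v] by blast
  have d0: "d i = 0" if "i \<in> P" for i
  proof -
    have i: "i \<in> I" using that by (simp add: P_def)
    have "\<phi> (e i) v = (\<Sum>j\<in>J. \<phi> (e i) (f j *\<^sub>Q c j))"
      unfolding v_def by (rule sesquilinear_on_sum[OF W \<phi>]) (use e i f qsubspaceD[OF W] in auto)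
    also have "\<dots> = (\<Sum>j\<in>J. \<phi> (e i) (f j) * c j)"
      using f(1) e(1) i by (intro sum.cong) (auto simp: sesquilinear_onD[OF \<phi>])
    also have "\<dots> = 0" using c(2) that .
    finally have "of_real (s i) * d i = 0"
      using diagonal_gram_coeff[OF W \<phi> e i, of d] by (simp add: d)
    then show ?thesis using s[OF i] by auto
  qed
  have "\<sigma> * qre (\<phi> v v) = (\<Sum>i\<in>I. \<sigma> * s i * (norm (d i))\<^sup>2)"
    unfolding d by (subst diagonal_gram_form[OF W \<phi> e], assumption) (simp add: qre_sum qcnj_mult_self
      sum_distrib_left mult_ac del: quat_mult_sel(5))
  also have "\<dots> \<le> 0"
  proof (intro sum_nonpos)
    fix i assume i: "i \<in> I"
    show "\<sigma> * s i * (norm (d i))\<^sup>2 \<le> 0"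
      using d0[of i] s[OF i] \<sigma> i by (cases "i \<in> P") (auto simp: P_def)
  qed
  finally have 1: "\<sigma> * qre (\<phi> v v) \<le> 0" .
  have "\<sigma> * qre (\<phi> v v) = (\<Sum>i\<in>J. \<sigma> * \<sigma> * (norm (c i))\<^sup>2)"
    unfolding v_def by (subst diagonal_gram_form[OF W \<phi> f], assumption) (simp add: qre_sum qcnj_mult_self
      sum_distrib_left mult_ac del: quat_mult_sel(5))
  also have "\<dots> > 0"
  proof -
    obtain j where j: "j \<in> J" "c j \<noteq> 0" using c by blast
    show ?thesis using \<sigma> by (intro sum_pos2[OF f(3) j(1)]) (use j(2) in auto)
  qed
  finally show False using 1 by simp
qed

definition signature_sign :: "nat \<Rightarrow> nat \<Rightarrow> real" where
  "signature_sign p i = (if i < p then 1 else -1)"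

lemma has_signature_iff:
  "has_signature W \<phi> (p, q) \<longleftrightarrow> (\<exists>e. (\<forall>i<p+q. e i \<in> W) \<and> (\<forall>w\<in>W. \<exists>c. w = (\<Sum>i<p+q. e i *\<^sub>Q c i)) \<and>
     diagonal_gram \<phi> {..<p+q} e (signature_sign p))"
proof -
  have "diagonal_gram \<phi> {..<p+q} e (signature_sign p) \<longleftrightarrow>
    (\<forall>i<p+q. \<forall>j<p+q. \<phi> (e i) (e j) = (if i \<noteq> j then 0 else if i < p then 1 else -1))" for e
    unfolding diagonal_gram_def signature_sign_def lessThan_iff Ball_def
    by (intro all_cong1 imp_cong refl) auto
  then show ?thesis unfolding has_signature_def by simp
qed

lemma card_signature_sign:
  "card {i\<in>{..<p+q}. signature_sign p i = 1} = p" "card {i\<in>{..<p+q}. signature_sign p i = -1} = q"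
proof -
  have "{i\<in>{..<p+q}. signature_sign p i = 1} = {..<p}" "{i\<in>{..<p+q}. signature_sign p i = -1} = {p..<p+q}"
    by (auto simp: signature_sign_def)
  then show "card {i\<in>{..<p+q}. signature_sign p i = 1} = p" "card {i\<in>{..<p+q}. signature_sign p i = -1} = q"
    by simp_all
qed

text \<open>This gives \<open>p\<close> and \<open>q\<close> an intrinsic meaning as bounds on
  definite orthonormal systems. Uniqueness of the signature follows from it, and so does the
  comparison of \<open>p\<close> with \<open>q\<close> under an anti-isometry.\<close>

lemma has_signature_maximal:
  assumes W: "qsubspace W" and \<phi>: "sesquilinear_on W \<phi>" and sig: "has_signature W \<phi> (p, q)"
    and J: "finite J"
    and f: "\<And>j. j \<in> J \<Longrightarrow> f j \<in> W"
  shows "diagonal_gram \<phi> J f (\<lambda>_. 1) \<Longrightarrow> card J \<le> p" "diagonal_gram \<phi> J f (\<lambda>_. -1) \<Longrightarrow> card J \<le> q"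
proof -
  obtain e where e: "\<forall>i<p+q. e i \<in> W" "\<forall>w\<in>W. \<exists>c. w = (\<Sum>i<p+q. e i *\<^sub>Q c i)" 
     "diagonal_gram \<phi> {..<p+q} e (signature_sign p)" using sig unfolding has_signature_iff by blast
  have *: "card J \<le> card {i\<in>{..<p+q}. signature_sign p i = \<sigma>}"
    if "diagonal_gram \<phi> J f (\<lambda>_. \<sigma>)" "\<sigma> = 1 \<or> \<sigma> = -1" for \<sigma>
    using e by (intro diagonal_gram_card_le[OF W \<phi> _ e(3) _ _ _ f that(1) J that(2)])
      (auto simp: signature_sign_def)
  show "diagonal_gram \<phi> J f (\<lambda>_. 1) \<Longrightarrow> card J \<le> p" "diagonal_gram \<phi> J f (\<lambda>_. -1) \<Longrightarrow> card J \<le> q"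
    using *[of 1] *[of "-1"] unfolding card_signature_sign by auto
qed

lemma diagonal_gram_signature_split:
  assumes "diagonal_gram \<phi> {..<p+q} e (signature_sign p)"
  shows "diagonal_gram \<phi> {..<p} e (\<lambda>_. 1)" "diagonal_gram \<phi> {p..<p+q} e (\<lambda>_. -1)"
  using assms by (auto simp: diagonal_gram_def signature_sign_def)

lemma has_signature_unique:
  assumes W: "qsubspace W" and \<phi>: "sesquilinear_on W \<phi>"
    and "has_signature W \<phi> s" "has_signature W \<phi> s'"
  shows "s = s'"
proof -
  have le: "p' \<le> p \<and> q' \<le> q" if s: "has_signature W \<phi> (p, q)" "has_signature W \<phi> (p', q')" for p q p' q'
  proof -
    obtain e where e: "\<forall>i<p'+q'. e i \<in> W" "diagonal_gram \<phi> {..<p'+q'} e (signature_sign p')"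
      using s(2) unfolding has_signature_iff by blast
    show ?thesis
      using has_signature_maximal(1)[OF W \<phi> s(1), of "{..<p'}" e]
        has_signature_maximal(2)[OF W \<phi> s(1), of "{p'..<p'+q'}" e]
        diagonal_gram_signature_split[OF e(2)] e(1) by auto
  qed
  obtain p q p' q' where [simp]: "s = (p, q)" "s' = (p', q')" by (cases s; cases s')
  show ?thesis using le[of p q p' q'] le[of p' q' p q] assms(3,4) by simp
qed

text \<open>An orthonormal system of maximal length spans: otherwise its orthogonal complement would
  be nonzero and nondegenerate, yet totally isotropic by maximality, which polarization rules out.
  The assumed bound on orthogonal systems takes the place of finite dimension of
  \<open>W\<close>.\<close>

lemma has_signature_exists:
  assumes W: "qsubspace W" and herm: "hermitian_on W \<phi>" and nd: "nondegenerate_on W \<phi>"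
    and bound: "\<And>m e s. (\<And>i. i < m \<Longrightarrow> e i \<in> W) \<Longrightarrow> (\<And>i. i < m \<Longrightarrow> s i \<noteq> 0) \<Longrightarrow>
       diagonal_gram \<phi> {..<m} e s \<Longrightarrow> m \<le> N"
  shows "\<exists>s. has_signature W \<phi> s"
proof -
  have \<phi>: "sesquilinear_on W \<phi>" and hs: "\<And>u v. u \<in> W \<Longrightarrow> v \<in> W \<Longrightarrow> \<phi> v u = qcnj (\<phi> u v)"
    using herm unfolding hermitian_on_def by blast+
  define sys where "sys p q e \<longleftrightarrow> (\<forall>i<p+q. e i \<in> W) \<and> diagonal_gram \<phi> {..<p+q} e (signature_sign p)" for p q e
  define Q where "Q m \<longleftrightarrow> (\<exists>p q e. sys p q e \<and> m = p + q)" for m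
  have bQ: "m \<le> N" if Qm: "Q m" for m
  proof -
    obtain p q e where "sys p q e" "m = p + q" using Qm unfolding Q_def by blast
    then show ?thesis using bound[of "p + q" e "signature_sign p"] by (simp add: sys_def signature_sign_def)
  qed
  have "Q 0" unfolding Q_def sys_def by (intro exI[of _ 0]) (auto simp: diagonal_gram_def)
  then have "Q (Greatest Q)" using bQ by (rule GreatestI_nat)
  then obtain p q e where s: "sys p q e" and max: "p + q = Greatest Q" unfolding Q_def by auto
  have no_ext: False if u: "u \<in> W" "\<And>i. i < p + q \<Longrightarrow> \<phi> (e i) u = 0" "\<phi> u u \<noteq> 0" for u
  proof -
    \<comment> \<open>A self-conjugate quaternion is real, so the value of a Hermitian form on the
      diagonal has a sign and \<open>u\<close> can be normalized.\<close>
    have "a = of_real (qre a)" if "a = qcnj a" for a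
      using that unfolding quat_eq_iff by (simp add: of_real_def)
    then have real: "\<phi> u u = of_real (qre (\<phi> u u))" using hs u(1) by blast
    define t where "t = qre (\<phi> u u)"
    have t: "\<phi> u u = of_real t" "t \<noteq> 0" using real u(3) by (auto simp: t_def)
    define w where "w = (1 / sqrt \<bar>t\<bar>) *\<^sub>R u"
    have w: "w \<in> W" using u(1) by (simp add: w_def qsubspaceD[OF W])
    have "\<phi> w w = (1 / \<bar>t\<bar>) *\<^sub>R \<phi> u u"
      unfolding w_def using u(1) by (simp add: sesquilinear_onD[OF \<phi>] qsubspaceD[OF W])
    then have ww: "\<phi> w w = of_real (sgn t)" using t by (simp add: of_real_def sgn_real_def)
    have ew: "\<phi> (e i) w = 0" "\<phi> w (e i) = 0" if "i < p + q" for i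
    proof -
      have i: "e i \<in> W" using s that by (simp add: sys_def)
      show *: "\<phi> (e i) w = 0" using i u(1) u(2)[OF that] by (simp add: w_def sesquilinear_onD[OF \<phi>])
      show "\<phi> w (e i) = 0" using hs[OF i w] * by simp
    qed
    have g: "\<phi> (e i) (e j) = (if i = j then of_real (signature_sign p i) else 0)" if "i < p + q" "j < p + q"
      for i j
      using s that by (auto simp: sys_def diagonal_gram_def)
    have eW: "e i \<in> W" if "i < p + q" for i using s that by (simp add: sys_def)
    have "Q (Suc (p + q))"
    proof (cases "t > 0")
      case True
      \<comment> \<open>Positive vectors are listed before negative ones, so a new positive vector
        is inserted at position \<open>p\<close>.\<close>
      define e' where "e' i = (if i < p then e i else if i = p then w else e (i - 1))" for i
      have "sys (Suc p) q e'"
        unfolding sys_def diagonal_gram_def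
        using True by (auto simp: e'_def w eW ew ww g signature_sign_def)
      then show ?thesis unfolding Q_def by force
    next
      case False
      define e' where "e' i = (if i < p + q then e i else w)" for i
      have "sys p (Suc q) e'"
        unfolding sys_def diagonal_gram_def
        using False t by (auto simp: e'_def w eW ew ww g signature_sign_def less_Suc_eq)
      then show ?thesis unfolding Q_def by force
    qed
    then have "Suc (p + q) \<le> Greatest Q" using bQ by (rule Greatest_le_nat)
    then show False using max by simp
  qed
  have eW: "e i \<in> W" if "i < p + q" for i using s that by (simp add: sys_def)
  have gram: "diagonal_gram \<phi> {..<p+q} e (signature_sign p)" using s by (simp add: sys_def)
  \<comment> \<open>Orthogonal projection to the complement of the \<open>e i\<close>; each sign is
    its own inverse.\<close>
  define pr where "pr w = w - (\<Sum>i<p+q. e i *\<^sub>Q (of_real (signature_sign p i) * \<phi> (e i) w))" for w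
  have sW: "(\<Sum>i<p+q. e i *\<^sub>Q c i) \<in> W" for c
    by (intro qsubspace_sum qsubspaceD W) (use eW in auto)
  have prW: "pr w \<in> W" if "w \<in> W" for w
    unfolding pr_def by (intro qsubspaceD(6) sW W that)
  have sub: "\<phi> u (v - v') = \<phi> u v - \<phi> u v'" if "u \<in> W" "v \<in> W" "v' \<in> W" for u v v'
    using sesquilinear_onD(2)[OF \<phi>, of v "- v'" u] that by (simp add: sesquilinear_onD[OF \<phi>] qsubspaceD[OF W])
  have epr: "\<phi> (e i) (pr w) = 0" if "w \<in> W" "i < p + q" for w i
    using diagonal_gram_coeff[OF W \<phi>, of "{..<p+q}", OF _ gram] eW that
    by (simp add: pr_def sub sW) (simp add: signature_sign_def)
  have "\<exists>c. w = (\<Sum>i<p+q. e i *\<^sub>Q c i)" if w: "w \<in> W" for w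
  proof (cases "pr w = 0")
    case True
    then show ?thesis unfolding pr_def by (metis eq_iff_diff_eq_0)
  next
    case False
    then obtain v where v: "v \<in> W" "\<phi> (pr w) v \<noteq> 0"
      using nd prW[OF w] unfolding nondegenerate_on_def by blast
    have pe: "\<phi> (pr w) (e i) = 0" if "i < p + q" for i
      using hs[OF eW[OF that] prW[OF w]] epr[OF w that] by simp
    have 0: "\<phi> (pr w) (\<Sum>i<p+q. e i *\<^sub>Q c i) = 0" for c
    proof -
      have "\<phi> (pr w) (\<Sum>i<p+q. e i *\<^sub>Q c i) = (\<Sum>i<p+q. \<phi> (pr w) (e i *\<^sub>Q c i))"
        by (rule sesquilinear_on_sum[OF W \<phi>]) (use eW prW w qsubspaceD[OF W] in auto)
      also have "\<dots> = 0"
        using pe eW prW[OF w] by (intro sum.neutral) (auto simp: sesquilinear_onD[OF \<phi>])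
      finally show ?thesis .
    qed
    have "\<phi> (pr w) (pr v) = \<phi> (pr w) v"
      unfolding pr_def[of v] using sub[OF prW[OF w] v(1) sW] 0 by simp
    with v have a: "\<phi> (pr w) (pr v) \<noteq> 0" by simp
    define u where "u = pr v *\<^sub>Q inverse (\<phi> (pr w) (pr v))"
    have u: "u \<in> W" unfolding u_def by (intro qsubspaceD W prW v)
    have wu: "\<phi> (pr w) u = 1" using a prW v w by (simp add: u_def sesquilinear_onD[OF \<phi>])
    have uw: "\<phi> u (pr w) = 1" using hs[OF prW[OF w] u] wu by simp
    have eu: "\<phi> (e i) u = 0" if "i < p + q" for i
      using epr[OF v(1) that] prW v eW[OF that] by (simp add: u_def sesquilinear_onD[OF \<phi>])
    \<comment> \<open>Maximality makes all three vectors isotropic, whereas the two mixed terms of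
      the third value are both 1 and add up to 2.\<close>
    have z: "\<phi> (pr w) (pr w) = 0" "\<phi> u u = 0" "\<phi> (pr w + u) (pr w + u) = 0"
      using no_ext[of "pr w"] no_ext[of u] no_ext[of "pr w + u"] u eu epr[OF w] prW[OF w] eW
      by (auto simp: sesquilinear_onD[OF \<phi>] qsubspaceD[OF W])
    have "\<phi> (pr w + u) (pr w + u) = of_real 2"
      using z(1,2) u prW[OF w] wu uw by (simp add: sesquilinear_onD[OF \<phi>] qsubspaceD[OF W])
    with z(3) show ?thesis by (simp add: of_real_def)
  qed
  then have "has_signature W \<phi> (p, q)" unfolding has_signature_iff using eW gram by blast
  then show ?thesis by blast
qed

section \<open>Isotypic decompositions\<close>

text \<open>Invariance under \<open>H\<close> pairs only opposite weights, so the Gram matrix is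
  antidiagonal. Invariance under \<open>Y\<close> relates neighbouring entries with a minus sign.
  The form is thus determined by its corner entry \<open>b 0 r\<close>.\<close>

lemma sl2_invariant_gram:
  assumes "sl2_invariant r b"
  shows "j \<le> r \<Longrightarrow> k \<le> r \<Longrightarrow> j + k \<noteq> r \<Longrightarrow> b j k = 0" "j \<le> r \<Longrightarrow> b j (r - j) = (-1) ^ j * b 0 r"
proof -
  define u where "u c j = (\<lambda>m::nat. if m = j then c else (0::real))" for c j
  have uV: "u c j \<in> Vmod r" if "j \<le> r" for c j using that by (auto simp: u_def Vtensor_def)
  have form: "Vform r b (u c j) (u d k) = (if j \<le> r \<and> k \<le> r then b j k * c * d else 0)" for c d j k
  proof -
    have "Vform r b (u c j) (u d k) = (\<Sum>j'\<le>r. if j' = j then (\<Sum>k'\<le>r. if k'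
      = k then b j k * c * d else 0) else 0)"
      unfolding Vform_def u_def
      by (intro sum.cong refl) (simp add: if_distrib[where f = "\<lambda>x. _ * x"] cong: if_cong)
    then show ?thesis by simp
  qed
  have H: "actH r (u 1 j) = u (real r - 2 * real j) j" for j by (auto simp: fun_eq_iff actH_def u_def)
  have Y: "actY r (u 1 j) = u (if j < r then 1 else 0) (Suc j)" if "j \<le> r" for j
    using that by (auto simp: fun_eq_iff actY_def u_def)
  note inv = assms[unfolded sl2_invariant_def, rule_format]
  show 1: "b j k = 0" if "j \<le> r" "k \<le> r" "j + k \<noteq> r" for j k
  proof -
    \<comment> \<open>The weights r - 2 j and r - 2 k of the two basis vectors add up to this
      factor.\<close>
    have "2 * (real r - real j - real k) * b j k = 0"
      using inv[OF uV uV, of j k 1 1] that unfolding H form by (simp add: algebra_simps)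
    moreover have "real r - real j - real k \<noteq> 0" using that(3) by linarith
    ultimately show ?thesis by simp
  qed
  show "b j (r - j) = (-1) ^ j * b 0 r" if "j \<le> r"
    using that
  proof (induction j)
    case (Suc j)
    have Yj: "actY r (u 1 j) = u 1 (Suc j)" using Y[of j] Suc by simp
    have Yk: "actY r (u 1 (r - Suc j)) = u 1 (r - j)"
      using Y[of "r - Suc j"] Suc by (simp add: Suc_diff_Suc)
    have "b (Suc j) (r - Suc j) + b j (r - j) = 0"
      using inv[OF uV uV, of j "r - Suc j" 1 1] Suc.prems unfolding Yj Yk form by simp
    then show ?case using Suc by (simp add: algebra_simps)
  qed simp
qed

lemma normalized_form_nonzero:
  assumes "normalized_form r b" shows "b 0 r \<noteq> 0"
proof
  assume "b 0 r = 0"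
  moreover have inv: "sl2_invariant r b" using assms by (simp add: normalized_form_def)
  ultimately have "b j k = 0" if "j \<le> r" "k \<le> r" for j k
    using sl2_invariant_gram(1)[OF inv that] sl2_invariant_gram(2)[OF inv that(1)]
    by (metis add_diff_cancel_left' mult_zero_right)
  then have "Vform r b v w = 0" for v w unfolding Vform_def by simp
  then show False using assms by (auto simp: normalized_form_def)
qed

section \<open>Coefficient calculus in a fixed isotypic decomposition\<close>

locale isotypic_decomposition =
  fixes B :: "quat^'n \<Rightarrow> quat^'n \<Rightarrow> quat" and x :: "quat^'n^'n"
    and b :: "nat \<Rightarrow> nat \<Rightarrow> nat \<Rightarrow> real"
    and W :: "nat \<Rightarrow> 'w::quat_vector set" and \<phi> :: "nat \<Rightarrow> 'w \<Rightarrow> 'w \<Rightarrow> quat"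
    and \<Psi> :: "(nat \<Rightarrow> nat \<Rightarrow> 'w) \<Rightarrow> quat^'n"
  assumes skew: "skew_hermitian_on UNIV B" and nondeg: "nondegenerate_on UNIV B"
    and normalized: "\<And>r. normalized_form r (b r)"
    and W: "\<And>r. qsubspace (W r)" and \<phi>: "\<And>r. sesquilinear_on (W r) (\<phi> r)"
    and bij: "bij_betw \<Psi> (isotypic_sum W) UNIV"
    and \<Psi>_add: "\<And>F G. F \<in> isotypic_sum W \<Longrightarrow> G \<in> isotypic_sum W \<Longrightarrow> \<Psi> (\<lambda>r k. F r k + G r k) = \<Psi> F + \<Psi> G"
    and \<Psi>_scaleQ: "\<And>F a. F \<in> isotypic_sum W \<Longrightarrow> \<Psi> (\<lambda>r k. F r k *\<^sub>Q a) = \<Psi> F *\<^sub>Q a"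
    and \<Psi>_X: "\<And>F. F \<in> isotypic_sum W \<Longrightarrow> \<Psi> (\<lambda>r. actX r (F r)) = x *v \<Psi> F"
    and \<Psi>_form: "\<And>F G. F \<in> isotypic_sum W \<Longrightarrow> G \<in> isotypic_sum W \<Longrightarrow>
       B (\<Psi> F) (\<Psi> G) = (\<Sum>r | F r \<noteq> (\<lambda>_. 0). tensor_form r (b r) (\<phi> r) (F r) (G r))"
begin

abbreviation "\<M> \<equiv> isotypic_sum W"

abbreviation "xpow \<equiv> \<lambda>m. (\<lambda>v. x *v v) ^^ m"

lemmas \<phi>_simps = sesquilinear_onD[OF \<phi>]
lemmas W_closed = qsubspaceD[OF W]

lemma b_offdiag: "j \<le> r \<Longrightarrow> k \<le> r \<Longrightarrow> j + k \<noteq> r \<Longrightarrow> b r j k = 0"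
  and b_antidiag: "j \<le> r \<Longrightarrow> b r j (r - j) = (-1) ^ j * b r 0 r"
  using sl2_invariant_gram[of r "b r"] normalized[of r] by (auto simp: normalized_form_def)

lemma b_nonzero: "b r 0 r \<noteq> 0" by (rule normalized_form_nonzero[OF normalized])

lemma isotypic_sumD:
  assumes "F \<in> \<M>"
  shows "F r k \<in> W r" "r < k \<Longrightarrow> F r k = 0" "finite {r. F r \<noteq> (\<lambda>_. 0)}"
proof -
  have F: "\<And>r. F r \<in> Vtensor r (W r)" "finite {r. F r \<noteq> (\<lambda>_. 0)}" using assms by (auto simp: isotypic_sum_def)
  show "F r k \<in> W r" "r < k \<Longrightarrow> F r k = 0" using F(1)[of r] W_closed(1)[of r]
    by (cases "k \<le> r"; auto simp: Vtensor_def)+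
  show "finite {r. F r \<noteq> (\<lambda>_. 0)}" by fact
qed

lemma isotypic_sumI:
  assumes "\<And>r k. k \<le> r \<Longrightarrow> F r k \<in> W r" "\<And>r k. r < k \<Longrightarrow> F r k = 0" "finite S" "\<And>r k. r \<notin> S \<Longrightarrow> F r k = 0"
  shows "F \<in> \<M>"
proof -
  have "{r. F r \<noteq> (\<lambda>_. 0)} \<subseteq> S" using assms(4) by (auto simp: fun_eq_iff)
  then show ?thesis using assms finite_subset by (auto simp: isotypic_sum_def Vtensor_def)
qed

lemma tensor_form_antidiag:
  "tensor_form r (b r) \<psi> f g = (\<Sum>j\<le>r. (-1) ^ j *\<^sub>R b r 0 r *\<^sub>R \<psi> (f j) (g (r - j)))"
  unfolding tensor_form_def
proof (intro sum.cong refl)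
  fix j assume "j \<in> {..r}"
  then have j: "j \<le> r" by simp
  have "(\<Sum>k\<le>r. b r j k *\<^sub>R \<psi> (f j) (g k)) = (\<Sum>k\<le>r. if k
    = r - j then b r j (r - j) *\<^sub>R \<psi> (f j) (g (r - j)) else 0)"
    using b_offdiag[OF j] j by (intro sum.cong refl) auto
  also have "\<dots> = (-1) ^ j *\<^sub>R b r 0 r *\<^sub>R \<psi> (f j) (g (r - j))" using j b_antidiag[OF j] by simp
  finally show "(\<Sum>k\<le>r. b r j k *\<^sub>R \<psi> (f j) (g k)) = \<dots>" .
qed

text \<open>Any finite set of indices outside which \<open>F\<close> vanishes may be used, so that a
  family and its transform can be evaluated over the same set.\<close>

lemma form_sum:
  assumes F: "F \<in> \<M>" and G: "G \<in> \<M>" and S: "finite S" "\<And>r k. r \<notin> S \<Longrightarrow> F r k = 0"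
  shows "B (\<Psi> F) (\<Psi> G) = (\<Sum>r\<in>S. \<Sum>j\<le>r. (-1) ^ j *\<^sub>R b r 0 r *\<^sub>R \<phi> r (F r j) (G r (r - j)))"
  unfolding \<Psi>_form[OF F G] tensor_form_antidiag
proof (rule sum.mono_neutral_left[OF S(1)])
  show "{r. F r \<noteq> (\<lambda>_. 0)} \<subseteq> S" using S(2) by (auto simp: fun_eq_iff)
  show "\<forall>r\<in>S - {r. F r \<noteq> (\<lambda>_. 0)}. (\<Sum>j\<le>r. (-1) ^ j *\<^sub>R b r 0 r *\<^sub>R \<phi> r (F r j) (G r (r - j))) = 0"
    using isotypic_sumD(1)[OF G] by (auto simp: \<phi>_simps intro!: sum.neutral)
qed

text \<open>The pure tensor of the j-th basis vector of V_r with \<open>w\<close>, placed in the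
  r-th summand.\<close>

definition incl :: "nat \<Rightarrow> nat \<Rightarrow> 'w \<Rightarrow> nat \<Rightarrow> nat \<Rightarrow> 'w" where
  "incl r j w = (\<lambda>r' k. if r' = r \<and> k = j then w else 0)"

lemma incl_in: "j \<le> r \<Longrightarrow> w \<in> W r \<Longrightarrow> incl r j w \<in> \<M>"
  by (rule isotypic_sumI[of _ "{r}"]) (auto simp: incl_def W_closed)

lemma \<Psi>_incl_add:
  "j \<le> r \<Longrightarrow> u \<in> W r \<Longrightarrow> v \<in> W r \<Longrightarrow> \<Psi> (incl r j (u + v)) = \<Psi> (incl r j u) + \<Psi> (incl r j v)"
  using \<Psi>_add[OF incl_in incl_in, of j r u j r v] unfolding incl_def
  by (simp add: if_distrib[where f = "\<lambda>a. _ + a"] if_distrib[where f = "\<lambda>a. a + _"] cong: if_cong)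

lemma \<Psi>_incl_scaleQ:
  "j \<le> r \<Longrightarrow> u \<in> W r \<Longrightarrow> \<Psi> (incl r j (u *\<^sub>Q a)) = \<Psi> (incl r j u) *\<^sub>Q a"
  using \<Psi>_scaleQ[OF incl_in, of j r u a] unfolding incl_def
  by (simp add: if_distrib[where f = "\<lambda>w. w *\<^sub>Q a"] cong: if_cong)

lemma \<Psi>_inj: "F \<in> \<M> \<Longrightarrow> G \<in> \<M> \<Longrightarrow> \<Psi> F = \<Psi> G \<longleftrightarrow> F = G"
  using bij by (auto simp: bij_betw_def inj_on_def)

definition \<Psi>' :: "quat^'n \<Rightarrow> nat \<Rightarrow> nat \<Rightarrow> 'w" where "\<Psi>' = inv_into (\<M>) \<Psi>"

lemma \<Psi>': "\<Psi>' v \<in> \<M>" "\<Psi> (\<Psi>' v) = v"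
proof -
  have "v \<in> \<Psi> ` \<M>" using bij by (simp add: bij_betw_def)
  then show "\<Psi>' v \<in> \<M>" "\<Psi> (\<Psi>' v) = v"
    unfolding \<Psi>'_def by (rule inv_into_into, rule f_inv_into_f)
qed

lemma zero_in: "(\<lambda>_ _. 0) \<in> \<M>"
  by (rule isotypic_sumI[of _ "{}"]) (auto simp: W_closed)

lemma \<Psi>_zero: "\<Psi> (\<lambda>_ _. 0) = 0"
  using \<Psi>_add[OF zero_in zero_in] by simp

lemma \<Psi>_incl_eq_0: "j \<le> r \<Longrightarrow> w \<in> W r \<Longrightarrow> \<Psi> (incl r j w) = 0 \<longleftrightarrow> w = 0"
  using \<Psi>_inj[OF incl_in zero_in, of j r w] unfolding \<Psi>_zero by (auto simp: incl_def fun_eq_iff)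

lemma form_incl:
  assumes j: "j \<le> r" and w: "w \<in> W r" and G: "G \<in> \<M>"
  shows "B (\<Psi> (incl r j w)) (\<Psi> G) = ((-1) ^ j * b r 0 r) *\<^sub>R \<phi> r w (G r (r - j))"
proof -
  have "B (\<Psi> (incl r j w)) (\<Psi> G) = (\<Sum>j'\<le>r. (-1) ^ j' *\<^sub>R b r 0 r *\<^sub>R \<phi> r (incl r j w r j') (G r (r - j')))"
    by (subst form_sum[OF incl_in[OF j w] G, of "{r}"]) (auto simp: incl_def)
  also have "\<dots> = (\<Sum>j'\<le>r. if j' = j then (-1) ^ j *\<^sub>R b r 0 r *\<^sub>R \<phi> r w (G r (r - j)) else 0)"
    using isotypic_sumD(1)[OF G] by (intro sum.cong refl) (auto simp: incl_def \<phi>_simps)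
  finally show ?thesis using j by simp
qed

text \<open>The Gram entries at (0, r) and (r, 0) differ by the sign (-1)^r. For odd
  \<open>r\<close> this sign cancels the one in the skew-symmetry of \<open>B\<close>.\<close>

lemma hermitian:
  assumes "odd r" shows "hermitian_on (W r) (\<phi> r)"
  unfolding hermitian_on_def
proof (intro conjI \<phi> ballI)
  fix u v assume uv: "u \<in> W r" "v \<in> W r"
  have "B (\<Psi> (incl r 0 v)) (\<Psi> (incl r r u)) = - qcnj (B (\<Psi> (incl r r u)) (\<Psi> (incl r 0 v)))"
    using skew unfolding skew_hermitian_on_def by blast
  also have "B (\<Psi> (incl r 0 v)) (\<Psi> (incl r r u)) = b r 0 r *\<^sub>R \<phi> r v u"
    using form_incl[of 0 r v "incl r r u"] uv by (simp add: incl_in) (simp add: incl_def)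
  also have "B (\<Psi> (incl r r u)) (\<Psi> (incl r 0 v)) = - b r 0 r *\<^sub>R \<phi> r u v"
    using form_incl[of r r u "incl r 0 v"] uv assms by (simp add: incl_in) (simp add: incl_def)
  finally have "b r 0 r *\<^sub>R \<phi> r v u = b r 0 r *\<^sub>R qcnj (\<phi> r u v)" by simp
  then show "\<phi> r v u = qcnj (\<phi> r u v)" using b_nonzero by simp
qed

text \<open>The Gram matrix is antidiagonal, so a vector \<open>u\<close> in the radical of
  \<open>\<phi> r\<close> makes its tensor with the basis vector of index 0 a radical vector of
  \<open>B\<close>.\<close>

lemma nondegenerate: "nondegenerate_on (W r) (\<phi> r)"
  unfolding nondegenerate_on_def
proof (intro ballI impI)
  fix u assume u: "u \<in> W r" and z: "\<forall>v\<in>W r. \<phi> r u v = 0"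
  have "B (\<Psi> (incl r 0 u)) w = 0" for w
  proof -
    obtain G where G: "G \<in> \<M>" "w = \<Psi> G" using bij by (auto simp: bij_betw_def)
    show ?thesis unfolding G(2) using form_incl[OF _ u G(1), of 0] z isotypic_sumD(1)[OF G(1)] by simp
  qed
  then have "\<Psi> (incl r 0 u) = 0" using nondeg unfolding nondegenerate_on_def by blast
  then show "u = 0" using \<Psi>_incl_eq_0[of 0 r u] u by simp
qed

text \<open>Tensoring with the basis vector of index 0 embeds \<open>W r\<close> quaternion-linearly
  in the ambient space. More than n vectors satisfy a linear relation there, but an orthogonal
  system with nonzero diagonal satisfies none.\<close>

lemma card_diagonal_gram_le:
  assumes e: "\<And>i. i < m \<Longrightarrow> e i \<in> W r" and s: "\<And>i. i < m \<Longrightarrow> s i \<noteq> 0" and g: "diagonal_gram (\<phi> r) {..<m} e s"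
  shows "m \<le> CARD('n)"
proof (rule ccontr)
  assume "\<not> m \<le> CARD('n)"
  then have "card (UNIV :: 'n set) < card {..<m}" by simp
  then obtain c where c: "\<exists>j\<in>{..<m}. c j \<noteq> 0" 
     "\<forall>i\<in>(UNIV::'n set). (\<Sum>j<m. \<Psi> (incl r 0 (e j)) $ i * c j) = 0"
    using underdetermined_system[of "UNIV :: 'n set" "{..<m}" "\<lambda>i j. \<Psi> (incl r 0 (e j)) $ i"] by auto
  have *: "k \<le> m \<Longrightarrow> \<Psi> (incl r 0 (\<Sum>j<k. e j *\<^sub>Q c j)) = (\<Sum>j<k. \<Psi> (incl r 0 (e j)) *\<^sub>Q c j)" for k
  proof (induction k)
    case 0
    then show ?case by (simp add: \<Psi>_incl_eq_0 W_closed)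
  next
    case (Suc k)
    have "(\<Sum>j<k. e j *\<^sub>Q c j) \<in> W r" using Suc e by (intro qsubspace_sum W_closed W) auto
    then show ?case using Suc e by (simp add: \<Psi>_incl_add \<Psi>_incl_scaleQ W_closed)
  qed
  have "(\<Sum>j<m. \<Psi> (incl r 0 (e j)) *\<^sub>Q c j) = 0"
    using c(2) by (simp add: vec_eq_iff scaleQ_vec_def scaleQ_quat_def)
  moreover have sW: "(\<Sum>j<m. e j *\<^sub>Q c j) \<in> W r" using e by (intro qsubspace_sum W_closed W) auto
  ultimately have z: "(\<Sum>j<m. e j *\<^sub>Q c j) = 0" using *[of m] \<Psi>_incl_eq_0[OF _ sW, of 0] by simp
  obtain j where j: "j < m" "c j \<noteq> 0" using c(1) by auto
  have "of_real (s j) * c j = 0"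
    using diagonal_gram_coeff[OF W \<phi>, of "{..<m}" e r s j c] e g j z by (simp add: \<phi>_simps)
  then show False using s j by simp
qed

lemma signature:
  assumes "odd r" shows "\<exists>!s. has_signature (W r) (\<phi> r) s"
proof -
  have "\<exists>s. has_signature (W r) (\<phi> r) s"
    using has_signature_exists[OF W hermitian[OF assms] nondegenerate] card_diagonal_gram_le by blast
  then show ?thesis using has_signature_unique[OF W \<phi>, of r] by blast
qed

section \<open>Group elements acting on coefficients, and dilations of \<open>x\<close>\<close>

text \<open>The group element multiplies the \<open>k\<close>-th coefficient in \<open>V\<^sub>r \<otimes> W\<^sub>r\<close> by \<open>l r k\<close> and applies \<open>T r\<close> to it.\<close>

lemma scaleR_in_orbit:
  fixes T :: "nat \<Rightarrow> 'w \<Rightarrow> 'w" and l :: "nat \<Rightarrow> nat \<Rightarrow> real"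
  assumes TW: "\<And>r u. u \<in> W r \<Longrightarrow> T r u \<in> W r"
    and T_add: "\<And>r u v. u \<in> W r \<Longrightarrow> v \<in> W r \<Longrightarrow> T r (u + v) = T r u + T r v"
    and T_scaleQ: "\<And>r u a. u \<in> W r \<Longrightarrow> T r (u *\<^sub>Q a) = T r u *\<^sub>Q a"
    and T_form: "\<And>r u v. u \<in> W r \<Longrightarrow> v \<in> W r \<Longrightarrow> \<phi> r (T r u) (T r v) = \<epsilon> r *\<^sub>R \<phi> r u v"
    and l: "\<And>r j. j \<le> r \<Longrightarrow> l r j * l r (r - j) * \<epsilon> r = 1" "\<And>r j. j < r \<Longrightarrow> l r j = s * l r (Suc j)"
  shows "s *\<^sub>R x \<in> adj_orbit (SO_star B) x"
proof -
  define G where "G F = (\<lambda>r k. l r k *\<^sub>R T r (F r k))" for F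
  have T0: "T r 0 = 0" for r using T_scaleQ[of 0 r 0] W_closed(1) by simp
  have T_scaleR: "T r (t *\<^sub>R u) = t *\<^sub>R T r u" if "u \<in> W r" for r t u
    using T_scaleQ[OF that, of "of_real t"] by (simp add: scaleQ_of_real)
  have GI: "G F \<in> \<M>" if "F \<in> \<M>" for F
    using isotypic_sumD[OF that]
    by (intro isotypic_sumI[of _ "{r. F r \<noteq> (\<lambda>_. 0)}"]) (auto simp: G_def TW W_closed T0)
  have \<Psi>'_eq: "\<Psi>' (\<Psi> F) = F" if "F \<in> \<M>" for F
    using that \<Psi>_inj[OF \<Psi>'(1) that] \<Psi>'(2) by blast
  define f where "f v = \<Psi> (G (\<Psi>' v))" for v
  have add_in: "(\<lambda>r k. F r k + F' r k) \<in> \<M>" if "F \<in> \<M>" "F' \<in> \<M>" for F F'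
    using isotypic_sumD[OF that(1)] isotypic_sumD[OF that(2)]
    by (intro isotypic_sumI[of _ "{r. F r \<noteq> (\<lambda>_. 0)} \<union> {r. F' r \<noteq> (\<lambda>_. 0)}"]) (auto simp: W_closed)
  have scale_in: "(\<lambda>r k. F r k *\<^sub>Q a) \<in> \<M>" if "F \<in> \<M>" for F a
    using isotypic_sumD[OF that]
    by (intro isotypic_sumI[of _ "{r. F r \<noteq> (\<lambda>_. 0)}"]) (auto simp: W_closed)
  have X_in: "(\<lambda>r. actX r (F r)) \<in> \<M>" if "F \<in> \<M>" for F
    using isotypic_sumD[OF that]
    by (intro isotypic_sumI[of _ "{r. F r \<noteq> (\<lambda>_. 0)}"]) (auto simp: W_closed actX_def)
  have "f (v + w) = f v + f w" for v w
  proof -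
    have "\<Psi>' (v + w) = (\<lambda>r k. \<Psi>' v r k + \<Psi>' w r k)"
      using \<Psi>_add[OF \<Psi>'(1) \<Psi>'(1), of v w] \<Psi>'_eq[OF add_in[OF \<Psi>'(1) \<Psi>'(1), of v w]] by (simp add: \<Psi>'(2))
    then have "G (\<Psi>' (v + w)) = (\<lambda>r k. G (\<Psi>' v) r k + G (\<Psi>' w) r k)"
      by (simp add: G_def T_add isotypic_sumD(1)[OF \<Psi>'(1)] scaleR_add_right)
    then show ?thesis unfolding f_def by (simp add: \<Psi>_add GI \<Psi>'(1))
  qed
  moreover have "f (v *\<^sub>Q a) = f v *\<^sub>Q a" for v a
  proof -
    have "\<Psi>' (v *\<^sub>Q a) = (\<lambda>r k. \<Psi>' v r k *\<^sub>Q a)"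
      using \<Psi>_scaleQ[OF \<Psi>'(1), of v a] \<Psi>'_eq[OF scale_in[OF \<Psi>'(1), of v a]] by (simp add: \<Psi>'(2))
    then have "G (\<Psi>' (v *\<^sub>Q a)) = (\<lambda>r k. G (\<Psi>' v) r k *\<^sub>Q a)"
      by (simp add: G_def T_scaleQ isotypic_sumD(1)[OF \<Psi>'(1)] scaleR_scaleQ)
    then show ?thesis unfolding f_def by (simp add: \<Psi>_scaleQ GI \<Psi>'(1))
  qed
  ultimately obtain g where g: "\<And>v. f v = g *v v" using matrix_of_quat_linear by blast
  have form: "B (g *v v) (g *v w) = B v w" for v w
  proof -
    define F F' where "F = \<Psi>' v" and "F' = \<Psi>' w"
    have F: "F \<in> \<M>" "F' \<in> \<M>" using \<Psi>' by (auto simp: F_def F'_def)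
    define S where "S = {r. F r \<noteq> (\<lambda>_. 0)}"
    have S: "finite S" "\<And>r k. r \<notin> S \<Longrightarrow> F r k = 0" "\<And>r k. r \<notin> S \<Longrightarrow> G F r k = 0"
      using isotypic_sumD(3)[OF F(1)] by (auto simp: S_def G_def T0)
    have "B (g *v v) (g *v w) = B (\<Psi> (G F)) (\<Psi> (G F'))" by (simp add: g[symmetric] f_def F_def F'_def)
    also have "\<dots> = (\<Sum>r\<in>S. \<Sum>j\<le>r. (-1) ^ j *\<^sub>R b r 0 r *\<^sub>R \<phi> r (G F r j) (G F' r (r - j)))"
      by (rule form_sum[OF GI[OF F(1)] GI[OF F(2)] S(1,3)])
    also have "\<dots> = (\<Sum>r\<in>S. \<Sum>j\<le>r. (-1) ^ j *\<^sub>R b r 0 r *\<^sub>R \<phi> r (F r j) (F' r (r - j)))"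
    proof (intro sum.cong refl)
      fix r j :: nat assume "j \<in> {..r}"
      \<comment> \<open>The pairing joins coefficient \<open>j\<close> to coefficient
        \<open>r - j\<close>, so exactly these two factors meet \<open>\<epsilon> r\<close>.\<close>
      then have "l r j * l r (r - j) * \<epsilon> r = 1" using l(1) by simp
      then show "(-1) ^ j *\<^sub>R b r 0 r *\<^sub>R \<phi> r (G F r j) (G F' r (r - j))
        = (-1) ^ j *\<^sub>R b r 0 r *\<^sub>R \<phi> r (F r j) (F' r (r - j))"
        using isotypic_sumD(1)[OF F(1)] isotypic_sumD(1)[OF F(2)]
        by (simp add: G_def \<phi>_simps W_closed TW T_form mult_ac)
    qed
    also have "\<dots> = B (\<Psi> F) (\<Psi> F')" by (rule form_sum[OF F S(1,2), symmetric])
    finally show ?thesis by (simp add: F_def F'_def \<Psi>')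
  qed
  have "invertible g"
  proof (rule invertible_quat_matrixI)
    fix v assume "g *v v = 0"
    \<comment> \<open>An isometry of a nondegenerate form has trivial kernel.\<close>
    have "sesquilinear_on UNIV B" using skew by (simp add: skew_hermitian_on_def)
    then have "B v w = 0" for w using form[of v w] \<open>g *v v = 0\<close> by (simp add: sesquilinear_onD)
    then show "v = 0" using nondeg by (simp add: nondegenerate_on_def)
  qed
  then have "g \<in> SO_star B" using form by (simp add: SO_star_def)
  moreover have "g ** x = (s *\<^sub>R x) ** g"
  proof (rule qmat_eqI)
    fix v
    define F where "F = \<Psi>' v"
    have F: "F \<in> \<M>" using \<Psi>' by (auto simp: F_def)
    have "\<Psi>' (x *v v) = (\<lambda>r. actX r (F r))"
      using \<Psi>_X[OF F] \<Psi>'_eq[OF X_in[OF F]] by (simp add: F_def \<Psi>')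
    then have "(g ** x) *v v = \<Psi> (G (\<lambda>r. actX r (F r)))"
      by (simp add: g[symmetric] f_def matrix_vector_mul_assoc[symmetric])
    \<comment> \<open>\<open>actX\<close> moves index k + 1 to k, so the recursion of
      \<open>l\<close> produces the factor \<open>s\<close>. It is written as a quaternion in order
      to pass through \<open>\<Psi>\<close>.\<close>
    also have "G (\<lambda>r. actX r (F r)) = (\<lambda>r k. actX r (G F r) k *\<^sub>Q (of_real s))"
      by (auto simp: G_def actX_def fun_eq_iff T0 T_scaleR isotypic_sumD(1)[OF F] l(2) scaleQ_of_real)
    also have "\<Psi> \<dots> = \<Psi> (\<lambda>r. actX r (G F r)) *\<^sub>Q of_real s"
      by (rule \<Psi>_scaleQ[OF X_in[OF GI[OF F]]])
    also have "\<dots> = s *\<^sub>R (x *v (g *v v))"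
      unfolding \<Psi>_X[OF GI[OF F]] by (simp add: g[symmetric] f_def scaleQ_of_real F_def)
    also have "\<dots> = ((s *\<^sub>R x) ** g) *v v"
      by (simp add: matrix_vector_mul_assoc[symmetric] qmat_scaleR_vec)
    finally show "(g ** x) *v v = ((s *\<^sub>R x) ** g) *v v" .
  qed
  ultimately show ?thesis by (rule adj_orbit_memI)
qed

text \<open>The factors 2^(r - 2 j) are the eigenvalues of exp((log 2) h) on V_r. Conjugation by
  this element multiplies \<open>x\<close>, of weight 2, by 2^2. Opposite weights give inverse
  factors, so the form is preserved.\<close>

lemma four_scaleR_in_orbit: "4 *\<^sub>R x \<in> adj_orbit (SO_star B) x"
proof (rule scaleR_in_orbit[where T = "\<lambda>_ u. u" and l = "\<lambda>r j. 2 ^ r / 4 ^ j" and \<epsilon> = "\<lambda>_. 1"])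
  fix r j :: nat assume j: "j \<le> r"
  have "(2::real) ^ r * 2 ^ r = 4 ^ r" by (simp add: power_mult_distrib[symmetric])
  also have "\<dots> = 4 ^ j * 4 ^ (r - j)" using j by (simp add: power_add[symmetric])
  finally show "2 ^ r / 4 ^ j * (2 ^ r / 4 ^ (r - j)) * (1::real) = 1" by simp
qed auto

text \<open>For odd \<open>r\<close> an orthonormal basis with as many positive as negative vectors
  admits an exchange of the two halves, which is the anti-isometry required to compensate the sign
  (-1)^r.\<close>

lemma uminus_in_orbit:
  assumes split: "\<And>r p q. odd r \<Longrightarrow> has_signature (W r) (\<phi> r) (p, q) \<Longrightarrow> p = q"
  shows "- x \<in> adj_orbit (SO_star B) x"
proof -
  have "\<exists>T. (\<forall>u\<in>W r. T u \<in> W r) \<and> (\<forall>u\<in>W r. \<forall>v\<in>W r. T (u + v) = T u + T v) \<and>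
      (\<forall>u\<in>W r. \<forall>a. T (u *\<^sub>Q a) = T u *\<^sub>Q a) \<and> (\<forall>u\<in>W r. \<forall>v\<in>W r. \<phi> r (T u) (T v) = (-1) ^ r *\<^sub>R \<phi> r u v)" for r
  proof (cases "even r")
    case True
    then show ?thesis by (intro exI[of _ "\<lambda>u. u"]) simp
  next
    case False
    obtain p q where pq: "has_signature (W r) (\<phi> r) (p, q)" using signature[OF False] by auto
    with split False have "p = q" by blast
    with pq obtain e where e: "\<forall>i<p+p. e i \<in> W r" "\<forall>w\<in>W r. \<exists>c. w = (\<Sum>i<p+p. e i *\<^sub>Q c i)"
        "diagonal_gram (\<phi> r) {..<p+p} e (signature_sign p)" unfolding has_signature_iff by blast
    define \<sigma> where "\<sigma> i = (if i < p then p + i else i - p)" for i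
    define e' where "e' i = e (\<sigma> i)" for i
    have g: "diagonal_gram (\<phi> r) {..<p+p} e' (\<lambda>i. - signature_sign p i)"
      using e(3) by (auto simp: diagonal_gram_def e'_def \<sigma>_def signature_sign_def)
    \<comment> \<open>The sign times \<open>\<phi> r (e i) u\<close> is the i-th coordinate of
      \<open>u\<close>, so \<open>T\<close> carries \<open>e i\<close> to the vector
      \<open>e' i\<close> of opposite sign.\<close>
    define T where "T u = (\<Sum>i<p+p. e' i *\<^sub>Q (signature_sign p i *\<^sub>R \<phi> r (e i) u))" for u
    have e'W: "e' i \<in> W r" if "i \<in> {..<p+p}" for i using e(1) that by (auto simp: e'_def \<sigma>_def)
    have eW: "e i \<in> W r" if "i \<in> {..<p+p}" for i using e(1) that by auto
    have "T u \<in> W r" if "u \<in> W r" for u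
      unfolding T_def using e'W by (intro qsubspace_sum W_closed W) auto
    moreover have "T (u + v) = T u + T v" if "u \<in> W r" "v \<in> W r" for u v
      using that eW by (simp add: T_def \<phi>_simps scaleR_add_right scaleQ_add_right sum.distrib)
    moreover have "T (u *\<^sub>Q a) = T u *\<^sub>Q a" if "u \<in> W r" for u a
      using that eW by (simp add: T_def \<phi>_simps scaleQ_sum_left scaleQ_scaleQ)
    moreover have "\<phi> r (T u) (T v) = (-1) ^ r *\<^sub>R \<phi> r u v" if uv: "u \<in> W r" "v \<in> W r" for u v
    proof -
      obtain c d where c: "u = (\<Sum>i<p+p. e i *\<^sub>Q c i)" and d: "v = (\<Sum>i<p+p. e i *\<^sub>Q d i)"
        using e(2) uv by meson
      have co: "signature_sign p i *\<^sub>R \<phi> r (e i) (\<Sum>i<p+p. e i *\<^sub>Q c i) = c i" if "i < p + p" for i c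
        using diagonal_gram_coeff[OF W \<phi> eW e(3), of i c] that by (simp add: signature_sign_def)
      have "\<phi> r (T u) (T v) = \<phi> r (\<Sum>i<p+p. e' i *\<^sub>Q c i) (\<Sum>i<p+p. e' i *\<^sub>Q d i)"
        unfolding T_def by (subst c, subst d) (simp add: co)
      also have "\<dots> = - \<phi> r u v"
        unfolding c d using diagonal_gram_form[OF W \<phi> e'W g, of c d] diagonal_gram_form[OF W \<phi> eW e(3), of c
          d]
        by (simp add: sum_negf)
      finally show ?thesis using False by simp
    qed
    ultimately show ?thesis by blast
  qed
  then obtain T where T: "\<And>r u. u \<in> W r \<Longrightarrow> T r u \<in> W r"
     "\<And>r u v. u \<in> W r \<Longrightarrow> v \<in> W r \<Longrightarrow> T r (u + v) = T r u + T r v"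
     "\<And>r u a. u \<in> W r \<Longrightarrow> T r (u *\<^sub>Q a) = T r u *\<^sub>Q a"
     "\<And>r u v. u \<in> W r \<Longrightarrow> v \<in> W r \<Longrightarrow> \<phi> r (T r u) (T r v) = (-1) ^ r *\<^sub>R \<phi> r u v"
    by metis
  have "(-1) *\<^sub>R x \<in> adj_orbit (SO_star B) x"
  proof (rule scaleR_in_orbit[where T = T and l = "\<lambda>r j. (-1) ^ j" and \<epsilon> = "\<lambda>r. (-1) ^ r", OF T])
    fix r j :: nat assume "j \<le> r"
    then show "(-1) ^ j * (-1) ^ (r - j) * (-1) ^ r = (1::real)"
      by (simp add: power_add[symmetric])
  qed auto
  then show ?thesis by simp
qed

section \<open>Powers of \<open>x\<close> and the forms they induce\<close>

lemma actX_iterate_in: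
  "F \<in> \<M> \<Longrightarrow> (\<lambda>r. (actX r ^^ m) (F r)) \<in> \<M> \<and>
    \<Psi> (\<lambda>r. (actX r ^^ m) (F r)) = xpow m (\<Psi> F)"
proof (induction m)
  case (Suc m)
  then have *: "(\<lambda>r. (actX r ^^ m) (F r)) \<in> \<M>" by blast
  have "(\<lambda>r. actX r ((actX r ^^ m) (F r))) \<in> \<M>"
    using isotypic_sumD[OF *]
    by (intro isotypic_sumI[of _ "{r. (actX r ^^ m) (F r) \<noteq> (\<lambda>_. 0)}"]) (auto simp: W_closed actX_def)
  with Suc \<Psi>_X[OF *] show ?case by simp
qed auto

end

lemma actX_less: "k < r \<Longrightarrow> actX r f k = (real (k + 1) * real (r - k)) *\<^sub>R f (Suc k)"
  by (simp add: actX_def)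

lemma actX_eq_0: "f (Suc k) = 0 \<Longrightarrow> actX r f k = 0"
  by (simp add: actX_def)

lemma actX_iterate_eq_0:
  assumes "\<forall>k>r. f k = 0" "r < k + m" shows "(actX r ^^ m) f k = 0"
  using assms by (induction m arbitrary: k) (auto simp: actX_eq_0)

text \<open>The scalar is a product of structure constants, one for each step from index k + m down
  to k. All of them are nonzero within V_r, and they are the same for every
  \<open>f\<close>.\<close>

lemma actX_iterate:
  assumes "k + m \<le> r"
  shows "\<exists>c. c \<noteq> 0 \<and> (\<forall>f. (actX r ^^ m) f k = c *\<^sub>R (f (k + m) :: 'a::real_vector))"
  using assms
proof (induction m arbitrary: k)
  case 0
  then show ?case by (intro exI[of _ 1]) simp
next
  case (Suc m)
  have "Suc k + m \<le> r" using Suc.prems by simp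
  from Suc.IH[OF this] obtain c
    where c: "c \<noteq> 0" "\<And>f. (actX r ^^ m) f (Suc k) = c *\<^sub>R (f (Suc k + m) :: 'a)" by blast
  show ?case using c Suc.prems
    by (intro exI[of _ "real (k + 1) * real (r - k) * c"]) (auto simp: actX_less)
qed

context isotypic_decomposition begin

text \<open>On the kernel of the (r + 1)-st power only coefficients of index at most
  \<open>r\<close> survive, and the r-th power moves these to index 0. Since index 0 pairs with the
  last index of each module, V_r alone contributes. The left side involves just \<open>B\<close> and
  \<open>x\<close>, so isometries that change the sign of \<open>x\<close> can be followed through
  it.\<close>

lemma kernel_form:
  obtains c where "c \<noteq> 0" "\<And>F F'. F \<in> \<M> \<Longrightarrow> F' \<in> \<M> \<Longrightarrow>
    xpow (Suc r) (\<Psi> F) = 0 \<Longrightarrow> xpow (Suc r) (\<Psi> F') = 0 \<Longrightarrow>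
    B (\<Psi> F) (xpow r (\<Psi> F')) = c *\<^sub>R \<phi> r (F r r) (F' r r)"
proof -
  have low: "F r' k = 0" if "F \<in> \<M>" "xpow (Suc r) (\<Psi> F) = 0" "r < k" for F r' k
  proof (cases "k \<le> r'")
    case True
    have "(\<lambda>r'. (actX r' ^^ Suc r) (F r')) = (\<lambda>_ _. 0)"
      using actX_iterate_in[OF that(1), of "Suc r"] \<Psi>_inj[OF _ zero_in] \<Psi>_zero that(2) by metis
    \<comment> \<open>The (r + 1)-st power moves index \<open>k\<close> to \<open>k - Suc r\<close>,
      which is a true subtraction because r < k.\<close>
    then have 0: "(actX r' ^^ Suc r) (F r') (k - Suc r) = 0" by meson
    have "k - Suc r + Suc r \<le> r'" using True that(3) by simp
    then obtain c where c: "c \<noteq> 0" "\<And>f. (actX r' ^^ Suc r) f (k - Suc r)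
      = c *\<^sub>R (f (k - Suc r + Suc r) :: 'w)"
      using actX_iterate by blast
    from 0 c(1) that(3) show ?thesis unfolding c(2) by simp
  qed (use that isotypic_sumD(2) in auto)
  have "0 + r \<le> r" by simp
  then obtain c where c: "c \<noteq> 0" "\<And>f. (actX r ^^ r) f 0 = c *\<^sub>R (f (0 + r) :: 'w)" using actX_iterate by blast
  show ?thesis
  \<comment> \<open>The sign and \<open>b r 0 r\<close> form the Gram entry at (r, 0);
    \<open>c\<close> comes from the r-th power of \<open>X\<close>.\<close>
  proof (rule that[of "(-1) ^ r * b r 0 r * c"])
    show "(-1) ^ r * b r 0 r * c \<noteq> 0" using c b_nonzero by simp
    fix F F' assume F: "F \<in> \<M>" "F' \<in> \<M>"
      and k: "xpow (Suc r) (\<Psi> F) = 0" "xpow (Suc r) (\<Psi> F') = 0"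
    define XF where "XF = (\<lambda>r'. (actX r' ^^ r) (F' r'))"
    have XF: "XF \<in> \<M>" "xpow r (\<Psi> F') = \<Psi> XF"
      using actX_iterate_in[OF F(2), of r] by (auto simp: XF_def)
    have XF0: "XF r' i = 0" if "i \<noteq> 0" for r' i
    proof (cases "i + r \<le> r'")
      case True
      then obtain c where c: "\<And>f. (actX r' ^^ r) f i = c *\<^sub>R (f (i + r) :: 'w)" using actX_iterate by blast
      show ?thesis unfolding XF_def c using low[OF F(2) k(2), of "i + r" r'] that by simp
    next
      case False
      then show ?thesis unfolding XF_def using isotypic_sumD(2)[OF F(2)] by (intro actX_iterate_eq_0) auto
    qed
    have XF_small: "XF r' i = 0" if "r' < r" for r' i
      unfolding XF_def using isotypic_sumD(2)[OF F(2)] that by (intro actX_iterate_eq_0) auto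
    define S where "S = insert r {r. F r \<noteq> (\<lambda>_. 0)}"
    have S: "finite S" "r \<in> S" "\<And>r k. r \<notin> S \<Longrightarrow> F r k = 0" using isotypic_sumD(3)[OF F(1)] by (auto simp: S_def)
    have "B (\<Psi> F) (\<Psi> XF) = (\<Sum>r'\<in>S. \<Sum>j\<le>r'. (-1) ^ j *\<^sub>R b r' 0 r' *\<^sub>R \<phi> r' (F r' j) (XF r' (r' - j)))"
      by (rule form_sum[OF F(1) XF(1) S(1,3)])
    also have "\<dots> = (\<Sum>r'\<in>S. \<Sum>j\<le>r'. if r' = r \<and> j
      = r then ((-1) ^ r * b r 0 r * c) *\<^sub>R \<phi> r (F r r) (F' r r) else 0)"
    proof (intro sum.cong refl)
      fix r' j :: nat assume "j \<in> {..r'}"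
      then have j: "j \<le> r'" by simp
      have in_W: "F r' j \<in> W r'" "XF r' i \<in> W r'" "F' r r \<in> W r" "F r r \<in> W r" for i
        using isotypic_sumD(1) F XF by auto
      \<comment> \<open>Modules smaller than V_r are killed by the r-th power. In larger ones the
        last index exceeds \<open>r\<close>, where the kernel condition makes the coefficient of
        \<open>F\<close> vanish.\<close>
      consider "r' < r" | "r' = r" "j = r" | "r' \<ge> r" "j < r'" | "r' > r" "j = r'" using j by linarith
      then show "(-1) ^ j *\<^sub>R b r' 0 r' *\<^sub>R \<phi> r' (F r' j) (XF r' (r' - j)) =
        (if r' = r \<and> j = r then ((-1) ^ r * b r 0 r * c) *\<^sub>R \<phi> r (F r r) (F' r r) else 0)"
      proof cases
        case 1
        then show ?thesis using XF_small[OF 1] in_W by (simp add: \<phi>_simps)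
      next
        case 2
        have "XF r 0 = c *\<^sub>R F' r r" unfolding XF_def c(2) by simp
        then show ?thesis using 2 in_W by (simp add: \<phi>_simps)
      next
        case 3
        then have "XF r' (r' - j) = 0" by (intro XF0) simp
        then show ?thesis using 3 in_W by (simp add: \<phi>_simps)
      next
        case 4
        then have "F r' j = 0" using low[OF F(1) k(1)] by simp
        then show ?thesis using 4 in_W by (simp add: \<phi>_simps)
      qed
    qed
    also have "\<dots> = (\<Sum>r'\<in>S. if r' = r then ((-1) ^ r * b r 0 r * c) *\<^sub>R \<phi> r (F r r) (F' r r) else 0)"
      by (intro sum.cong refl) auto
    also have "\<dots> = ((-1) ^ r * b r 0 r * c) *\<^sub>R \<phi> r (F r r) (F' r r)" using S(1,2) by simp
    finally show "B (\<Psi> F) (xpow r (\<Psi> F')) = ((-1) ^ r * b r 0 r * c) *\<^sub>R \<phi> r (F r r) (F' r r)"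
      unfolding XF(2) .
  qed
qed

text \<open>An element of the group mapping \<open>x\<close> to \<open>-x\<close> preserves the kernel of \<open>x ^ (r + 1)\<close> and changes the
  sign of the form \<open>B v (x ^ r w)\<close> on it when \<open>r\<close> is odd. This form induces \<open>\<phi> r\<close>, up to a scalar.\<close>

lemma uminus_in_orbit_imp_split:
  assumes "- x \<in> adj_orbit (SO_star B) x" and r: "odd r" and sig: "has_signature (W r) (\<phi> r) (p, q)"
  shows "p = q"
proof -
  obtain g where g: "g \<in> SO_star B" "g ** x = (- x) ** g" using adj_orbit_memE[OF assms(1)] .
  have Bg: "B (g *v v) (g *v w) = B v w" for v w using g by (simp add: SO_star_def)
  have sesq: "sesquilinear_on UNIV B" using skew unfolding skew_hermitian_on_def by blast
  have B_minus: "B v (- w) = - B v w" for v w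
    by (rule sesquilinear_onD(8)[OF sesq]) auto
  have "g *v (x *v v) = - (x *v (g *v v))" for v
  proof -
    have "g *v (x *v v) = ((- x) ** g) *v v" by (simp add: matrix_vector_mul_assoc g(2))
    also have "\<dots> = ((-1) *\<^sub>R x) *v (g *v v)" by (simp add: matrix_vector_mul_assoc)
    finally show ?thesis unfolding qmat_scaleR_vec by simp
  qed
  then have gx: "x *v (g *v v) = g *v (- (x *v v))" for v
    using linear_neg[OF matrix_vector_mul_linear, of g "x *v v"] by simp
  have x_minus: "x *v (- v) = - (x *v v)" for v by (rule linear_neg[OF matrix_vector_mul_linear])
  have gxm: "xpow m (g *v v) = g *v ((-1) ^ m *\<^sub>R xpow m v)" for m v
  proof (induction m)
    case (Suc m)
    have "x *v (g *v (t *\<^sub>R u)) = g *v ((- t) *\<^sub>R (x *v u))" for t u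
      unfolding gx by (simp add: linear_cmul[OF matrix_vector_mul_linear])
    with Suc show ?case by simp
  qed simp
  obtain c where c: "c \<noteq> 0" "\<And>F F'. F \<in> \<M> \<Longrightarrow> F' \<in> \<M> \<Longrightarrow>
    xpow (Suc r) (\<Psi> F) = 0 \<Longrightarrow> xpow (Suc r) (\<Psi> F') = 0 \<Longrightarrow>
    B (\<Psi> F) (xpow r (\<Psi> F')) = c *\<^sub>R \<phi> r (F r r) (F' r r)"
    using kernel_form[of r] by blast
  \<comment> \<open>The coefficient of lowest weight in V_r identifies the quotient of the kernel
    with \<open>W r\<close>; \<open>T\<close> is the map that \<open>g\<close> induces on
    it.\<close>
  define T where "T w = \<Psi>' (g *v \<Psi> (incl r r w)) r r" for w
  have TW: "T w \<in> W r" for w unfolding T_def by (rule isotypic_sumD(1)[OF \<Psi>'(1)])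
  have ker: "xpow (Suc r) (\<Psi> (incl r r w)) = 0" if "w \<in> W r" for w
  proof -
    have "(actX r' ^^ Suc r) (incl r r w r') k = 0" for r' k
    proof (cases "r' = r")
      case True
      then show ?thesis by (intro actX_iterate_eq_0) (auto simp: incl_def)
    next
      case False
      have "(actX r' ^^ m) (\<lambda>_. 0) = (\<lambda>_. 0::'w)" for m by (induction m) (auto simp: actX_eq_0 fun_eq_iff)
      with False show ?thesis by (simp add: incl_def actX_eq_0)
    qed
    then have "(\<lambda>r'. (actX r' ^^ Suc r) (incl r r w r')) = (\<lambda>_ _. 0)" by blast
    then show ?thesis using actX_iterate_in[OF incl_in[OF order_refl that], of "Suc r"] \<Psi>_zero by metis
  qed
  have T: "\<phi> r (T u) (T v) = - \<phi> r u v" if uv: "u \<in> W r" "v \<in> W r" for u v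
  proof -
    have gker: "xpow (Suc r) (\<Psi> (\<Psi>' (g *v \<Psi> (incl r r w)))) = 0" if "w \<in> W r" for w
      unfolding \<Psi>'(2) gxm ker[OF that] by simp
    have "c *\<^sub>R \<phi> r (T u) (T v) = B (g *v \<Psi> (incl r r u)) (xpow r (g *v \<Psi> (incl r r v)))"
      using c(2)[OF \<Psi>'(1) \<Psi>'(1) gker[OF uv(1)] gker[OF uv(2)]] by (simp add: T_def \<Psi>'(2))
    also have "\<dots> = - B (\<Psi> (incl r r u)) (xpow r (\<Psi> (incl r r v)))"
      unfolding gxm Bg using r by (simp add: B_minus)
    also have "\<dots> = c *\<^sub>R (- \<phi> r u v)"
      using c(2)[OF incl_in[OF order_refl uv(1)] incl_in[OF order_refl uv(2)] ker[OF uv(1)] ker[OF uv(2)]]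
      by (simp add: incl_def)
    finally show ?thesis using c(1) scaleR_left_imp_eq by blast
  qed
  obtain e where e: "\<forall>i<p+q. e i \<in> W r" "diagonal_gram (\<phi> r) {..<p+q} e (signature_sign p)"
    using sig unfolding has_signature_iff by blast
  \<comment> \<open>The images of the p positive vectors form a negative system and those of the q
    negative ones a positive system, hence p \<le> q and q \<le> p.\<close>
  have "diagonal_gram (\<phi> r) {..<p} (\<lambda>i. T (e i)) (\<lambda>_. -1)" "diagonal_gram (\<phi> r) {p..<p+q} (\<lambda>i. T (e i)) (\<lambda>_.
    1)"
    using diagonal_gram_signature_split[OF e(2)] e(1) by (auto simp: diagonal_gram_def T)
  then have "card {..<p} \<le> q" "card {p..<p+q} \<le> p"
    by (intro has_signature_maximal[OF W \<phi> sig _ TW]; simp)+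
  then show "p = q" by simp
qed

end

section \<open>Traces and the Killing form\<close>

lemma trace_on_basis:
  assumes "subspace S"
  obtains E where "E \<subseteq> S" "independent E" "span E = S" "\<And>f. trace_on S f = (\<Sum>b\<in>E. representation E (f b) b)"
proof -
  define E where "E = (SOME E. E \<subseteq> S \<and> independent E \<and> span E = S)"
  have "\<exists>E. E \<subseteq> S \<and> independent E \<and> span E = S"
    using basis_exists[of S] assms by (metis span_subspace)
  from someI_ex[OF this] show thesis
    using that[of E] unfolding E_def[symmetric] by (simp add: trace_on_def E_def[symmetric])
qed

text \<open>Composing with a projection onto \<open>S\<close> extends \<open>f\<close> to the
  ambient space without changing its trace. This replaces the arbitrarily chosen basis in
  \<open>trace_on\<close> by the standard basis, in which matrix computations are possible.\<close>

lemma trace_on_projection: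
  fixes S :: "'a::euclidean_space set"
  assumes S: "subspace S" and f: "linear f" "\<And>z. z \<in> S \<Longrightarrow> f z \<in> S"
    and P: "linear P" "\<And>z. P z \<in> S" "\<And>z. z \<in> S \<Longrightarrow> P z = z"
  shows "trace_on S f = (\<Sum>b\<in>Basis. inner (f (P b)) b)"
proof -
  obtain E where E: "E \<subseteq> S" "independent E" "span E = S" "\<And>f. trace_on S f = (\<Sum>b\<in>E. representation E (f b) b)"
    using trace_on_basis[OF assms(1)] by blast
  have fin: "finite E" using E(2) by (rule independent_imp_finite)
  have 1: "inner (f (P b)) b = (\<Sum>e\<in>E. representation E (P b) e * inner (f e) b)" for b
  proof -
    have "P b = (\<Sum>e\<in>E. representation E (P b) e *\<^sub>R e)"
      using real_vector.sum_representation_eq[OF E(2) _ fin order_refl, of "P b"] P(2) E(3) by simp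
    then have "f (P b) = (\<Sum>e\<in>E. representation E (P b) e *\<^sub>R f e)"
      by (metis (no_types, lifting) linear_cmul[OF f(1)] linear_sum[OF f(1)] sum.cong)
    then show ?thesis by (simp add: inner_sum_left)
  qed
  have 2: "(\<Sum>b\<in>Basis. representation E (P b) e * inner (f e) b) = representation E (f e) e" if e: "e \<in> E"
    for e
  proof -
    have "f e = P (\<Sum>b\<in>Basis. inner (f e) b *\<^sub>R b)"
      using e E(1) f(2) P(3) by (auto simp: euclidean_representation)
    also have "\<dots> = (\<Sum>b\<in>Basis. inner (f e) b *\<^sub>R P b)"
      by (simp add: linear_sum[OF P(1)] linear_cmul[OF P(1)])
    finally have "representation E (f e) e = representation E (\<Sum>b\<in>Basis. inner (f e) b *\<^sub>R P b) e" by simp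
    also have "\<dots> = (\<Sum>b\<in>Basis. representation E (inner (f e) b *\<^sub>R P b) e)"
      by (subst real_vector.representation_sum[OF E(2)]) (use P(2) E(3) S subspace_scale in auto)
    also have "\<dots> = (\<Sum>b\<in>Basis. representation E (P b) e * inner (f e) b)"
      using P(2) E(3) by (simp add: real_vector.representation_scale[OF E(2)] mult.commute)
    finally show ?thesis by simp
  qed
  have "(\<Sum>b\<in>Basis. inner (f (P b)) b) = (\<Sum>e\<in>E. \<Sum>b\<in>Basis. representation E (P b) e * inner (f e) b)"
    unfolding 1 by (rule sum.swap)
  then show ?thesis unfolding E(4) by (simp add: 2)
qed

lemma sum_Basis_vec:
  "(\<Sum>b\<in>(Basis :: ('a::euclidean_space^'n) set). f b) = (\<Sum>i\<in>UNIV. \<Sum>e\<in>Basis. f (axis i e))"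
proof -
  have "bij_betw (\<lambda>(i, e). axis i e) (UNIV \<times> Basis) (Basis :: ('a^'n) set)"
    unfolding bij_betw_def by (auto simp: inj_on_def Basis_vec_def axis_eq_axis)
  from sum.reindex_bij_betw[OF this, of f] show ?thesis
    by (simp add: sum.cartesian_product case_prod_unfold)
qed

section \<open>Matrix arithmetic and the real trace form\<close>

lemma qmat_minus:
  "(- A) ** C = - (A ** (C :: quat^'n^'m))" "A ** (- C) = - (A ** C)" "(- A) *v v = - (A *v v)"
  by (simp_all add: vec_eq_iff matrix_matrix_mult_def matrix_vector_mult_def sum_negf)

lemma qmat_distrib:
  "A ** (C + D) = A ** C + A ** (D :: quat^'n^'m)" "(C + D) ** E = C ** E + D ** (E :: quat^'k^'n)"
  "A ** (C - D) = A ** C - A ** D" "(C - D) ** E = C ** E - D ** E" "A ** 0 = 0" "0 ** E = 0"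
  by (simp_all add: vec_eq_iff matrix_matrix_mult_def algebra_simps sum.distrib sum_subtractf)

text \<open>Only the real part of a quaternionic trace is cyclic, since qre (a c) = qre (c a)
  although a c and c a differ.\<close>

definition re_trace :: "quat^'n^'n \<Rightarrow> real" where
  "re_trace A = (\<Sum>i\<in>UNIV. qre (A $ i $ i))"

definition ctranspose :: "quat^'n^'m \<Rightarrow> quat^'m^'n" where
  "ctranspose A = (\<chi> i j. qcnj (A $ j $ i))"

lemma re_trace_simps:
  "re_trace (A + C) = re_trace A + re_trace C" "re_trace (- A) = - re_trace A" 
  "re_trace (A - C) = re_trace A - re_trace C" "re_trace (s *\<^sub>R A) = s * re_trace A" "re_trace 0 = 0"
  "re_trace (ctranspose A) = re_trace A" "re_trace (mat 1 :: quat^'n^'n) = real CARD('n)"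
  by (simp_all add: re_trace_def sum.distrib sum_negf sum_subtractf sum_distrib_left ctranspose_def mat_def)

lemma re_trace_commute: "re_trace (A ** C) = re_trace (C ** A)"
proof -
  have "qre (a * c) = qre (c * a)" for a c :: quat by simp
  then have "re_trace (A ** C) = (\<Sum>i\<in>UNIV. \<Sum>k\<in>UNIV. qre (C $ k $ i * A $ i $ k))"
    unfolding re_trace_def matrix_matrix_mult_def by (simp add: qre_sum del: quat_mult_sel(5))
  also have "\<dots> = re_trace (C ** A)"
    unfolding re_trace_def matrix_matrix_mult_def by (simp add: qre_sum del: quat_mult_sel(5)) (rule sum.swap)
  finally show ?thesis .
qed

lemma ctranspose_simps:
  "ctranspose (ctranspose A) = A" "ctranspose (A + C) = ctranspose A + ctranspose C"
  "ctranspose (A - C) = ctranspose A - ctranspose C" "ctranspose (s *\<^sub>R A) = s *\<^sub>R ctranspose A"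
  "ctranspose (- A) = - ctranspose A" "ctranspose (mat 1) = mat 1"
  by (simp_all add: ctranspose_def vec_eq_iff mat_def)

lemma ctranspose_mult: "ctranspose (A ** C) = ctranspose C ** ctranspose A"
  by (simp add: ctranspose_def vec_eq_iff matrix_matrix_mult_def qcnj_sum)

text \<open>The left side is the sum of the squared norms of all entries.\<close>

lemma re_trace_mult_ctranspose_eq_0: "re_trace (A ** ctranspose A) = 0 \<Longrightarrow> A = (0 :: quat^'n^'n)"
proof -
  have "qre (a * qcnj a) = (norm a)\<^sup>2" for a
    using quat_mult_qcnj(1)[of a] by (metis mult.right_neutral quat_mult_sel(1,9))
  then have "re_trace (A ** ctranspose A) = (\<Sum>i\<in>UNIV. \<Sum>k\<in>UNIV. (norm (A $ i $ k))\<^sup>2)"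
    unfolding re_trace_def matrix_matrix_mult_def ctranspose_def by (simp add: qre_sum del: quat_mult_sel(5))
  moreover assume "re_trace (A ** ctranspose A) = 0"
  ultimately show "A = 0" by (simp add: sum_nonneg_eq_0_iff sum_nonneg vec_eq_iff)
qed

text \<open>\<open>axis k (axis l e)\<close> is the elementary matrix with entry \<open>e\<close> in
  row \<open>k\<close> and column \<open>l\<close>; these matrices with \<open>e\<close> in
  \<open>Basis\<close> form the standard basis.\<close>

lemma matrix_mult_axis_axis:
  "(p ** axis k (axis l e) ** q) $ i $ j = p $ i $ k * e * q $ l $ (j :: 'n)" for p q :: "quat^'n^'n"
proof -
  have "(p ** axis k (axis l e)) $ i $ m = (if m = l then p $ i $ k * e else 0)" for m
  proof -
    have "(p ** axis k (axis l e)) $ i $ m = (\<Sum>k'\<in>UNIV. if k' = k then (if m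
      = l then p $ i $ k * e else 0) else 0)"
    proof -
      have *: "axis k (axis l e) $ k' $ m = (if k' = k \<and> m = l then e else 0)" for k' by (simp add: axis_def)
      show ?thesis unfolding matrix_matrix_mult_def vec_lambda_beta * by (intro sum.cong refl) simp
    qed
    then show ?thesis by simp
  qed
  then have "(p ** axis k (axis l e) ** q) $ i $ j = (\<Sum>m\<in>UNIV. (if m
    = l then p $ i $ k * e else 0) * q $ m $ j)"
    by (subst matrix_matrix_mult_def) simp
  also have "\<dots> = (\<Sum>m\<in>UNIV. if m = l then p $ i $ k * e * q $ l $ j else 0)"
    by (intro sum.cong refl) auto
  finally show ?thesis by simp
qed

text \<open>Real traces of two endomorphisms of the quaternions. At p = q = 1 they are the traces of
  the identity and of conjugation, namely 4 and 1 - 3.\<close>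

lemma quat_Basis_traces:
  "(\<Sum>e\<in>Basis. inner (p * e * q) e) = 4 * qre p * qre q"
  "(\<Sum>e\<in>Basis. inner (p * qcnj e * q) e) = - 2 * qre (qcnj p * q)"
  by (simp_all add: Basis_quat_def inner_quat_def algebra_simps)

lemma trace_mult_left_right:
  fixes p q :: "quat^'n^'n"
  shows "(\<Sum>z\<in>Basis. inner (p ** z ** q) z) = 4 * re_trace p * re_trace q"
proof -
  have "(\<Sum>z\<in>Basis. inner (p ** z ** q) z) = (\<Sum>i\<in>UNIV. \<Sum>j\<in>UNIV. \<Sum>e\<in>Basis. inner (p $ i $ i * e * q $ j $ j) e)"
    unfolding sum_Basis_vec by (simp add: inner_axis matrix_mult_axis_axis)
  also have "\<dots> = 4 * re_trace p * re_trace q"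
    unfolding quat_Basis_traces re_trace_def
    by (simp add: sum_distrib_left sum_distrib_right mult.assoc) (rule sum.swap)
  finally show ?thesis .
qed

lemma trace_mult_ctranspose:
  fixes p q :: "quat^'n^'n"
  shows "(\<Sum>z\<in>Basis. inner (p ** ctranspose z ** q) z) = - 2 * re_trace (ctranspose p ** q)"
proof -
  have [simp]: "ctranspose (axis i (axis j e)) = axis j (axis i (qcnj e))" for i j :: 'n and e
    by (auto simp: ctranspose_def vec_eq_iff axis_def)
  have "(\<Sum>z\<in>Basis. inner (p ** ctranspose z ** q) z)
    = (\<Sum>i\<in>UNIV. \<Sum>j\<in>UNIV. \<Sum>e\<in>Basis. inner (p $ i $ j * qcnj e * q $ i $ j) e)"
    unfolding sum_Basis_vec by (simp add: inner_axis matrix_mult_axis_axis)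
  also have "\<dots> = (\<Sum>j\<in>UNIV. \<Sum>i\<in>UNIV. - 2 * qre (qcnj (p $ i $ j) * q $ i $ j))"
    unfolding quat_Basis_traces by (rule sum.swap)
  also have "\<dots> = - 2 * re_trace (ctranspose p ** q)"
    unfolding re_trace_def matrix_matrix_mult_def ctranspose_def
    by (simp add: qre_sum sum_distrib_left del: quat_mult_sel(5) mult_minus_left)
  finally show ?thesis .
qed

lemma lie_bracket_linear:
  "lie_bracket (A + C) D = lie_bracket A D + lie_bracket C D"
    "lie_bracket D (A + C) = lie_bracket D A + lie_bracket D C"
  "lie_bracket (s *\<^sub>R A) D = s *\<^sub>R lie_bracket A D" "lie_bracket D (s *\<^sub>R A) = s *\<^sub>R lie_bracket D A"
  "lie_bracket A A = 0" "lie_bracket A 0 = 0" "lie_bracket 0 A = 0"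
  by (simp_all add: lie_bracket_def qmat_distrib qmat_scaleR scaleR_diff_right)

lemma re_trace_lie_bracket:
  "re_trace (A ** lie_bracket C D) = re_trace (lie_bracket A C ** D)"
  by (simp add: lie_bracket_def qmat_distrib re_trace_simps matrix_mul_assoc)
    (metis matrix_mul_assoc re_trace_commute)

section \<open>The adjoint with respect to the form, and the Killing form\<close>

locale quaternionic_skew_form =
  fixes B :: "quat^'n \<Rightarrow> quat^'n \<Rightarrow> quat"
  assumes skew: "skew_hermitian_on UNIV B" and nondeg: "nondegenerate_on UNIV B"
begin

abbreviation "L \<equiv> so_star B"

definition J :: "quat^'n^'n" where "J = (\<chi> i j. B (axis i 1) (axis j 1))"

definition Ji :: "quat^'n^'n" where "Ji = matrix_inv J"

lemma B_sesquilinear: "sesquilinear_on UNIV B"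
  using skew unfolding skew_hermitian_on_def by blast

lemma qsubspace_UNIV: "qsubspace UNIV" by (simp add: qsubspace_def)

lemma B_eq: "B v w = (\<Sum>i\<in>UNIV. qcnj (v $ i) * (J *v w) $ i)"
proof -
  note sums = sesquilinear_on_sum[OF qsubspace_UNIV B_sesquilinear]
  have "B v w = B (\<Sum>i\<in>UNIV. axis i 1 *\<^sub>Q (v $ i)) (\<Sum>i\<in>UNIV. axis i 1 *\<^sub>Q (w $ i))"
    by (simp flip: vec_eq_sum_axis_scaleQ)
  also have "\<dots> = (\<Sum>i\<in>UNIV. qcnj (v $ i) * (J *v w) $ i)"
    by (simp add: sums sesquilinear_onD[OF B_sesquilinear] J_def matrix_vector_mult_def sum_distrib_left
      sum_distrib_right mult.assoc)
      (rule sum.swap)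
  finally show ?thesis .
qed

lemma B_axis: "B (axis i 1) w = (J *v w) $ i"
proof -
  have "qcnj (axis i 1 $ j) * c = (if j = i then c else 0)" for j c by (simp add: axis_def)
  then show ?thesis by (simp add: B_eq)
qed

lemma B_eqI: "(\<forall>v w. B v (A *v w) = B v (C *v w)) \<longleftrightarrow> J ** A = J ** C"
proof
  assume "\<forall>v w. B v (A *v w) = B v (C *v w)"
  then show "J ** A = J ** C"
    by (intro qmat_eqI) (simp add: vec_eq_iff matrix_vector_mul_assoc[symmetric] B_axis[symmetric])
qed (simp add: B_eq matrix_vector_mul_assoc)

lemma J_skew: "ctranspose J = - J"
proof -
  have "B (axis i 1) (axis j 1) = - qcnj (B (axis j 1) (axis i 1))" for i j
    using skew unfolding skew_hermitian_on_def by blast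
  then have "qcnj (B (axis j 1) (axis i 1)) = - B (axis i 1) (axis j 1)" for i j
    by (rule equation_minus_iff[THEN iffD1])
  then show ?thesis by (simp add: ctranspose_def J_def vec_eq_iff)
qed

lemma J_inverse: "J ** Ji = mat 1" "Ji ** J = mat 1"
proof -
  have "invertible J"
  proof (rule invertible_quat_matrixI)
    fix w assume w: "J *v w = 0"
    have "B w v = 0" for v
    proof -
      have "B w v = - qcnj (B v w)" using skew unfolding skew_hermitian_on_def by blast
      then show ?thesis using w by (simp add: B_eq[of v w])
    qed
    then show "w = 0" using nondeg by (simp add: nondegenerate_on_def)
  qed
  then show "J ** Ji = mat 1" "Ji ** J = mat 1" by (simp_all add: Ji_def qmat_inv)
qed

lemma J_cancel: "J ** (Ji ** A) = A" "Ji ** (J ** A) = A"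
  by (simp_all add: matrix_mul_assoc J_inverse)

lemma Ji_skew: "ctranspose Ji = - Ji"
proof -
  have "ctranspose Ji ** ctranspose J = mat 1" using J_inverse
    by (simp add: ctranspose_mult[symmetric] ctranspose_simps)
  then have "(ctranspose Ji ** (- J)) ** (- Ji) = - Ji" by (simp add: J_skew)
  moreover have "(- J) ** (- Ji) = mat 1"
    using J_inverse by (simp add: qmat_minus)
  ultimately show ?thesis by (simp add: matrix_mul_assoc[symmetric])
qed

lemma B_adjoint: "B (A *v v) w = B v ((Ji ** ctranspose A ** J) *v w)"
proof -
  have "B (A *v v) w = (\<Sum>i\<in>UNIV. \<Sum>k\<in>UNIV. qcnj (v $ k) * qcnj (A $ i $ k) * (J *v w) $ i)"
    by (simp add: B_eq matrix_vector_mult_def[of A] qcnj_sum sum_distrib_right)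
  also have "\<dots> = (\<Sum>k\<in>UNIV. qcnj (v $ k) * (ctranspose A *v (J *v w)) $ k)"
  proof -
    have "(ctranspose A *v u) $ k = (\<Sum>i\<in>UNIV. qcnj (A $ i $ k) * u $ i)" for u k
      by (simp add: matrix_vector_mult_def ctranspose_def)
    then show ?thesis by (subst sum.swap) (simp add: sum_distrib_left mult.assoc)
  qed
  also have "ctranspose A *v (J *v w) = J *v ((Ji ** ctranspose A ** J) *v w)"
    by (simp add: matrix_vector_mul_assoc matrix_mul_assoc J_inverse)
  finally show ?thesis by (simp add: B_eq)
qed

text \<open>The adjoint with respect to \<open>B\<close>, an anti-involution. \<open>L\<close> is
  its -1 eigenspace and the group is cut out by \<open>adjoint_star g ** g = mat 1\<close>, so both
  are governed by matrix equations.\<close>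

definition adjoint_star :: "quat^'n^'n \<Rightarrow> quat^'n^'n" where
  "adjoint_star A = Ji ** ctranspose A ** J"

lemma B_star: "B (A *v v) w = B v (adjoint_star A *v w)"
  by (simp add: B_adjoint adjoint_star_def)

lemma B_cancel: "(\<forall>v w. B v (A *v w) = B v (C *v w)) \<longleftrightarrow> A = C"
proof
  assume "\<forall>v w. B v (A *v w) = B v (C *v w)"
  then have "Ji ** (J ** A) = Ji ** (J ** C)" using B_eqI by metis
  then show "A = C" by (simp add: J_cancel)
qed simp

lemma star_star: "adjoint_star (adjoint_star A) = A"
proof -
  have "adjoint_star (adjoint_star A) = Ji ** (J ** A ** Ji) ** J"
    by (simp add: adjoint_star_def ctranspose_mult ctranspose_simps J_skew Ji_skew qmat_minus
      matrix_mul_assoc)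
  then show ?thesis by (simp add: matrix_mul_assoc[symmetric] J_inverse J_cancel)
qed

lemma star_mult: "adjoint_star (A ** C) = adjoint_star C ** adjoint_star A"
  by (simp add: adjoint_star_def ctranspose_mult matrix_mul_assoc[symmetric] J_cancel)

lemma star_linear:
  "adjoint_star (A + C) = adjoint_star A + adjoint_star C" "adjoint_star (A - C)
    = adjoint_star A - adjoint_star C"
  "adjoint_star (s *\<^sub>R A) = s *\<^sub>R adjoint_star A" "adjoint_star (- A) = - adjoint_star A"
    "adjoint_star (mat 1) = mat 1"
  by (simp_all add: adjoint_star_def ctranspose_simps qmat_distrib qmat_scaleR qmat_minus J_inverse)

lemma re_trace_star: "re_trace (adjoint_star A) = re_trace A"
  unfolding adjoint_star_def by (subst re_trace_commute) (simp add: matrix_mul_assoc J_inverse re_trace_simps)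

lemma L_iff: "A \<in> L \<longleftrightarrow> adjoint_star A = - A"
proof -
  have minus: "B v (- A *v w) = - B v (A *v w)" for v w
    using sesquilinear_onD(8)[OF B_sesquilinear] by (simp add: qmat_minus)
  have "A \<in> L \<longleftrightarrow> (\<forall>v w. B v (adjoint_star A *v w) = B v (- A *v w))"
    unfolding so_star_def B_star minus by (simp add: eq_neg_iff_add_eq_0)
  then show ?thesis unfolding B_cancel .
qed

lemma SO_iff: "g \<in> SO_star B \<longleftrightarrow> invertible g \<and> adjoint_star g ** g = mat 1"
proof -
  have "(\<forall>v w. B (g *v v) (g *v w) = B v w) \<longleftrightarrow> (\<forall>v w. B v ((adjoint_star g ** g) *v w) = B v (mat 1 *v w))"
    unfolding B_star by (simp add: matrix_vector_mul_assoc)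
  then show ?thesis unfolding B_cancel by (simp add: SO_star_def)
qed

lemma L_subspace: "subspace L"
  by (rule subspaceI) (auto simp: L_iff star_linear star_linear(3)[of 0 0, simplified])

lemma L_bracket: "A \<in> L \<Longrightarrow> C \<in> L \<Longrightarrow> lie_bracket A C \<in> L"
  by (simp add: qmat_minus L_iff lie_bracket_def star_linear star_mult)

lemma re_trace_L: "A \<in> L \<Longrightarrow> re_trace A = 0"
  using re_trace_star[of A] by (simp add: L_iff re_trace_simps)

text \<open>This evaluates the mixed terms that arise from the map taking z to a z* c in the trace
  of ad a ad c.\<close>

lemma re_trace_L_star:
  assumes "A \<in> L" "C \<in> L" shows "re_trace (ctranspose (A ** Ji) ** (J ** C)) = re_trace (A ** C)"
proof -
  have "ctranspose (A ** Ji) ** (J ** C) = - (Ji ** ctranspose A ** J) ** C"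
    by (simp add: qmat_minus ctranspose_mult Ji_skew matrix_mul_assoc)
  also have "Ji ** ctranspose A ** J = - A" using assms(1) by (simp add: L_iff adjoint_star_def)
  finally show ?thesis by simp
qed

text \<open>The projection \<open>z \<mapsto> (z - z\<^sup>*) / 2\<close> onto the Lie algebra reduces the Killing form to traces of the
  maps \<open>z \<mapsto> p z q\<close> and \<open>z \<mapsto> p z\<^sup>* q\<close> on all matrices.\<close>

lemma killing_form_eq:
  assumes a: "a \<in> L" and c: "c \<in> L"
  shows "killing_form L a c = 4 * (real CARD('n) - 1) * re_trace (a ** c)"
proof -
  define f where "f = (\<lambda>z. lie_bracket a (lie_bracket c z))"
  define P where "P z = (1/2) *\<^sub>R (z - adjoint_star z)" for z
  have f: "linear f" by (rule linearI) (simp_all add: f_def lie_bracket_linear)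
  have P: "linear P" by (rule linearI) (simp_all add: P_def star_linear algebra_simps)
  have PL: "P z \<in> L" for z by (simp add: L_iff P_def star_linear star_star flip: scaleR_minus_right)
  have "trace_on L f = (\<Sum>z\<in>Basis. inner (f (P z)) z)"
  proof (rule trace_on_projection[OF L_subspace f _ P PL])
    show "f z \<in> L" if "z \<in> L" for z using that a c by (simp add: f_def L_bracket)
    show "P z = z" if "z \<in> L" for z
    proof -
      have "P z = (1/2) *\<^sub>R (2 *\<^sub>R z)" using that by (simp add: P_def L_iff scaleR_2)
      then show ?thesis by simp
    qed
  qed
  also have "\<dots> = (\<Sum>z\<in>Basis. (1/2) * (
     (inner ((a ** c) ** z ** mat 1) z - inner (a ** z ** c) z - inner (c ** z ** a) z + inner (mat 1 ** z **
       (c ** a)) z)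
   - (inner ((a ** c ** Ji) ** ctranspose z ** J) z - inner ((a ** Ji) ** ctranspose z ** (J ** c)) z
    - inner ((c ** Ji) ** ctranspose z ** (J ** a)) z + inner (Ji ** ctranspose z ** (J ** (c ** a))) z)))"
  proof (intro sum.cong refl)
    fix z
    have fz: "f z = (a ** c) ** z ** mat 1 - a ** z ** c - c ** z ** a + mat 1 ** z ** (c ** a)" for z
      by (simp add: f_def lie_bracket_def qmat_distrib matrix_mul_assoc)
    have "f (P z) = (1/2) *\<^sub>R (f z - f (adjoint_star z))"
      unfolding P_def by (simp add: linear_cmul[OF f] linear_diff[OF f])
    then show "inner (f (P z)) z = (1/2) * (
     (inner ((a ** c) ** z ** mat 1) z - inner (a ** z ** c) z - inner (c ** z ** a) z + inner (mat 1 ** z **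
       (c ** a)) z)
   - (inner ((a ** c ** Ji) ** ctranspose z ** J) z - inner ((a ** Ji) ** ctranspose z ** (J ** c)) z
    - inner ((c ** Ji) ** ctranspose z ** (J ** a)) z + inner (Ji ** ctranspose z ** (J ** (c ** a))) z))"
      unfolding fz adjoint_star_def
      by (simp add: inner_diff_left inner_add_left matrix_mul_assoc)
  qed
  \<comment> \<open>With t = \<open>re_trace (a ** c)\<close>, the unstarred maps contribute 8 n t,
    because \<open>a\<close> and \<open>c\<close> have trace zero, and the four starred ones
    contribute -8 t. Half of the sum is 4 (n - 1) t.\<close>
  also have "\<dots> = (1/2) * (4 * re_trace (a ** c) * real CARD('n) - 4 * re_trace a * re_trace c - 4 * re_trace c
    * re_trace a
      + 4 * real CARD('n) * re_trace (c ** a)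
     + 2 * (re_trace (ctranspose (a ** c ** Ji) ** J) - re_trace (ctranspose (a ** Ji) ** (J ** c))
          - re_trace (ctranspose (c ** Ji) ** (J ** a)) + re_trace (ctranspose Ji ** (J ** (c ** a)))))"
    unfolding sum_distrib_left[symmetric] sum_subtractf sum.distrib trace_mult_left_right
      trace_mult_ctranspose
    by (simp add: re_trace_simps)
  also have "re_trace (ctranspose (a ** c ** Ji) ** J) = - re_trace (a ** c)"
  proof -
    have "ctranspose (a ** c ** Ji) ** J = - adjoint_star (a ** c)"
      by (subst ctranspose_mult) (simp add: adjoint_star_def Ji_skew qmat_minus)
    then show ?thesis by (simp add: re_trace_simps re_trace_star)
  qed
  also have "re_trace (ctranspose Ji ** (J ** (c ** a))) = - re_trace (a ** c)"
    by (simp add: Ji_skew J_cancel qmat_minus re_trace_simps re_trace_commute[of a c])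
  also note re_trace_L_star[OF a c] also note re_trace_L_star[OF c a]
  finally have "trace_on L f = 4 * (real CARD('n) - 1) * re_trace (a ** c)"
    by (simp add: re_trace_L[OF a] re_trace_L[OF c] re_trace_commute[of c a] algebra_simps)
  then show ?thesis by (simp add: killing_form_def f_def)
qed

text \<open>The trace form is invariant under the involution, so \<open>z\<close> in the -1
  eigenspace is orthogonal to the +1 eigenspace as well. Hence it is orthogonal to every matrix, in
  particular to its own conjugate transpose.\<close>

lemma re_trace_nondegenerate:
  assumes z: "z \<in> L" and 0: "\<And>c. c \<in> L \<Longrightarrow> re_trace (z ** c) = 0"
  shows "z = 0"
proof -
  have "re_trace (z ** m) = 0" for m
  proof -
    have "m - adjoint_star m \<in> L" by (simp add: L_iff star_linear star_star)
    then have 1: "re_trace (z ** m) = re_trace (z ** adjoint_star m)"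
      using 0 by (fastforce simp: qmat_distrib re_trace_simps)
    have "re_trace (z ** adjoint_star m) = re_trace (adjoint_star (m ** adjoint_star z))"
      by (simp add: star_mult star_star)
    also have "\<dots> = - re_trace (z ** m)"
      using z unfolding re_trace_star by (simp add: qmat_minus L_iff re_trace_simps re_trace_commute[of m z])
    finally show ?thesis using 1 by simp
  qed
  then show ?thesis by (rule re_trace_mult_ctranspose_eq_0)
qed

lemma killing_form_scaleR:
  assumes "a \<in> L" "c \<in> L" shows "killing_form L (s *\<^sub>R a) c = s * killing_form L a c"
  using assms subspace_scale[OF L_subspace] by (simp add: killing_form_eq qmat_scaleR re_trace_simps)

end

text \<open>For n = 1, [h, x] = 2 x would read h - x h x^(-1) = 2 in the quaternions, but
  conjugation preserves real parts. This case must be excluded because the constant of the Killing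
  form vanishes in it.\<close>

lemma standard_triple_card:
  assumes "standard_triple G x y (h :: quat^'n^'n)" shows "CARD('n) \<noteq> 1"
proof
  assume "CARD('n) = 1"
  then obtain i :: 'n where U: "UNIV = {i}" by (auto simp: card_1_singleton_iff)
  have one: "A = 0 \<longleftrightarrow> A $ i $ i = 0" for A :: "quat^'n^'n"
    using U by (auto simp: vec_eq_iff) (metis UNIV_I singletonD)
  have x0: "x $ i $ i \<noteq> 0" and hx: "lie_bracket h x = 2 *\<^sub>R x" using assms one
    by (auto simp: standard_triple_def)
  define p q where "p = x $ i $ i" and "q = h $ i $ i"
  have "q * p - p * q = 2 *\<^sub>R p"
    using arg_cong[OF hx, of "\<lambda>A. A $ i $ i"]
      by (simp add: lie_bracket_def matrix_matrix_mult_def U p_def q_def)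
  then have "(q * p - p * q) * inverse p = 2 *\<^sub>R 1" using x0 by (simp add: p_def)
  then have "q - p * q * inverse p = 2 *\<^sub>R 1" using x0 by (simp add: p_def left_diff_distrib mult.assoc)
  then have 1: "qre (q - p * q * inverse p) = 2" by simp
  have comm: "qre (a * c) = qre (c * a)" for a c by simp
  have "qre (p * q * inverse p) = qre (inverse p * (p * q))" by (rule comm)
  also have "\<dots> = qre q" using x0 by (simp add: p_def mult.assoc[symmetric] del: quat_mult_sel)
  finally show False using 1 by (simp del: quat_mult_sel)
qed

section \<open>Symplectic linear algebra\<close>

text \<open>The Gram matrix of a Darboux basis listed as consecutive hyperbolic pairs (2 i, 2 i +
  1), the pairing built into \<open>wedge_power\<close>.\<close>

definition std_symplectic :: "nat \<Rightarrow> nat \<Rightarrow> real" where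
  "std_symplectic j k = (if even j \<and> k = Suc j then 1 else if even k \<and> j = Suc k then -1 else 0)"

lemma std_symplectic_minus: "std_symplectic k j = - std_symplectic j k"
  by (auto simp: std_symplectic_def)

text \<open>A permutation mapping pairs \<open>{2 i, 2 i + 1}\<close> to pairs is reduced to the identity by moving whole
  pairs, which is even, and by swapping the members of a pair, which changes both signs.\<close>

lemma sign_pairing:
  assumes "\<sigma> permutes {..<2*k}" "(\<Prod>i<k. std_symplectic (\<sigma> (2*i)) (\<sigma> (2*i+1))) \<noteq> 0"
  shows "of_int (sign \<sigma>) * (\<Prod>i<k. std_symplectic (\<sigma> (2*i)) (\<sigma> (2*i+1))) = 1"
  using assms
proof (induction k arbitrary: \<sigma>)
  case (Suc k)
  define \<mu> where "\<mu> \<sigma> i = std_symplectic (\<sigma> (2*i)) (\<sigma> (2*i+1))" for \<sigma> :: "nat \<Rightarrow> nat" and i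
  have nz: "\<mu> \<sigma> i \<noteq> 0" if "i < Suc k" for i using Suc.prems(2) that by (auto simp: \<mu>_def less_Suc_eq)
  define j where "j = inv \<sigma> (2*k)"
  have j: "\<sigma> j = 2*k" using permutes_inverses(1)[OF Suc.prems(1)] by (simp add: j_def)
  have "j < 2 * Suc k" using permutes_in_image[OF Suc.prems(1), of j] j by simp
  define p where "p = j div 2"
  have p: "p < Suc k" using \<open>j < 2 * Suc k\<close> by (simp add: p_def)
  have jp: "j = 2*p \<or> j = 2*p+1" by (auto simp: p_def)
  \<comment> \<open>A nonzero factor at \<open>p\<close> forces the values there to be partners, so
    the value 2 k is accompanied by 2 k + 1.\<close>
  have pair: "(\<sigma> (2*p) = 2*k \<and> \<sigma> (2*p+1) = 2*k+1) \<or> (\<sigma> (2*p) = 2*k+1 \<and> \<sigma> (2*p+1) = 2*k)"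
    using nz[OF p] j jp by (auto simp: \<mu>_def std_symplectic_def split: if_splits)
  define \<tau> where "\<tau> = Transposition.transpose (2*p) (2*k) \<circ> Transposition.transpose (2*p+1) (2*k+1)"
  define \<sigma>' where "\<sigma>' = \<sigma> \<circ> \<tau>"
  have \<tau>: "\<tau> permutes {..<2 * Suc k}" unfolding \<tau>_def
    by (intro permutes_compose permutes_swap_id) (use p in auto)
  have \<sigma>': "\<sigma>' permutes {..<2 * Suc k}" unfolding \<sigma>'_def by (rule permutes_compose[OF \<tau> Suc.prems(1)])
  have perm: "permutation \<tau>" "permutation \<sigma>" "permutation \<sigma>'"
    using \<tau> \<sigma>' Suc.prems(1) by (auto intro: permutation_permutes[THEN iffD2])
  \<comment> \<open>The two transpositions are both trivial if p = k and both odd otherwise.\<close>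
  have "sign \<tau> = 1" unfolding \<tau>_def
    by (subst sign_compose) (auto simp: sign_swap_id permutation_swap_id)
  then have s': "sign \<sigma>' = sign \<sigma>" unfolding \<sigma>'_def using perm by (simp add: sign_compose)
  have tr: "\<tau> (2*i) = 2 * Transposition.transpose p k i" "\<tau> (2*i+1) = 2 * Transposition.transpose p k i + 1"
    for i
  proof -
    have "2 * a + 1 \<noteq> 2 * c" for a c :: nat by presburger
    then have "2 * a + 1 \<noteq> 2 * c" "2 * c \<noteq> 2 * a + 1" for a c :: nat by metis+
    then show "\<tau> (2*i) = 2 * Transposition.transpose p k i" "\<tau> (2*i+1)
      = 2 * Transposition.transpose p k i + 1"
      by (simp_all only: \<tau>_def o_def Transposition.transpose_def split: if_split) auto
  qed
  have \<mu>': "\<mu> \<sigma>' i = \<mu> \<sigma> (Transposition.transpose p k i)" for i unfolding \<mu>_def \<sigma>'_def o_def tr ..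
  have "Transposition.transpose p k permutes {..<Suc k}" by (rule permutes_swap_id) (use p in auto)
  then have nz': "\<mu> \<sigma>' i \<noteq> 0" if "i < Suc k" for i
    unfolding \<mu>' using nz permutes_in_image[of "Transposition.transpose p k" "{..<Suc k}" i] that by simp
  have prod': "(\<Prod>i<Suc k. \<mu> \<sigma>' i) = (\<Prod>i<Suc k. \<mu> \<sigma> i)"
    using \<open>Transposition.transpose p k permutes {..<Suc k}\<close> prod.permute[of "Transposition.transpose p k"
      "{..<Suc k}" "\<mu> \<sigma>"] by (simp only: o_def \<mu>'[symmetric])
  have last: "(\<sigma>' (2*k) = 2*k \<and> \<sigma>' (2*k+1) = 2*k+1) \<or> (\<sigma>' (2*k) = 2*k+1 \<and> \<sigma>' (2*k+1) = 2*k)"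
    using pair unfolding \<sigma>'_def o_def tr by simp
  have main: "of_int (sign \<rho>) * (\<Prod>i<k. \<mu> \<rho> i) = 1"
    if \<rho>: "\<rho> permutes {..<2 * Suc k}" "\<rho> (2*k) = 2*k" "\<rho> (2*k+1) = 2*k+1" "(\<Prod>i<k. \<mu> \<rho> i) \<noteq> 0" for \<rho>
  proof -
    have "\<rho> permutes {..<2*k}"
    proof (rule permutes_superset[OF \<rho>(1)])
      fix i assume "i \<in> {..<2 * Suc k} - {..<2*k}"
      then have "i = 2*k \<or> i = 2*k+1" by auto
      then show "\<rho> i = i" using \<rho> by auto
    qed
    from Suc.IH[OF this] \<rho>(4) show ?thesis by (simp add: \<mu>_def)
  qed
  have "of_int (sign \<sigma>') * (\<Prod>i<Suc k. \<mu> \<sigma>' i) = 1"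
    using last
  proof
    assume l: "\<sigma>' (2*k) = 2*k \<and> \<sigma>' (2*k+1) = 2*k+1"
    then have "\<mu> \<sigma>' k = 1" by (simp add: \<mu>_def std_symplectic_def)
    moreover have "(\<Prod>i<k. \<mu> \<sigma>' i) \<noteq> 0" using nz' by auto
    ultimately show ?thesis using main[OF \<sigma>'] l by simp
  next
    assume l: "\<sigma>' (2*k) = 2*k+1 \<and> \<sigma>' (2*k+1) = 2*k"
    then have k: "\<mu> \<sigma>' k = -1" by (simp add: \<mu>_def std_symplectic_def)
    define \<rho> where "\<rho> = \<sigma>' \<circ> Transposition.transpose (2*k) (2*k+1)"
    have "\<rho> permutes {..<2 * Suc k}" unfolding \<rho>_def
      by (rule permutes_compose[OF _ \<sigma>'], rule permutes_swap_id) auto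
    moreover have "sign \<rho> = - sign \<sigma>'"
      unfolding \<rho>_def by (subst sign_compose[OF perm(3)]) (auto simp: permutation_swap_id sign_swap_id)
    moreover have "\<mu> \<rho> i = \<mu> \<sigma>' i" if "i < k" for i
      using that by (simp add: \<mu>_def \<rho>_def Transposition.transpose_def)
    then have "(\<Prod>i<k. \<mu> \<rho> i) = (\<Prod>i<k. \<mu> \<sigma>' i)" by (intro prod.cong) auto
    moreover have "(\<Prod>i<k. \<mu> \<sigma>' i) \<noteq> 0" using nz' by auto
    ultimately show ?thesis using main[of \<rho>] l k by (simp add: \<rho>_def)
  qed
  then show ?case unfolding prod' s' by (simp add: \<mu>_def)
qed simp

text \<open>By \<open>sign_pairing\<close> each nonzero term of the sum equals 1, so nothing
  cancels, and the identity permutation contributes such a term.\<close>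

lemma wedge_power_standard_pos:
  assumes "\<And>j k. j < 2*m \<Longrightarrow> k < 2*m \<Longrightarrow> \<omega> (v j) (v k) = std_symplectic j k"
  shows "wedge_power m \<omega> v > 0"
proof -
  define t where "t \<sigma> = of_int (sign \<sigma>) * (\<Prod>i<m. std_symplectic (\<sigma> (2*i)) (\<sigma> (2*i+1)))" for \<sigma>
  have t: "of_int (sign \<sigma>) * (\<Prod>i<m. \<omega> (v (\<sigma> (2*i))) (v (\<sigma> (2*i+1)))) = t \<sigma>"
    if "\<sigma> permutes {..<2*m}" for \<sigma>
    unfolding t_def using permutes_in_image[OF that]
      by (intro arg_cong2[of _ _ _ _ "(*)"] prod.cong refl assms) auto
  have "0 < (\<Sum>\<sigma> | \<sigma> permutes {..<2*m}. t \<sigma>)"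
  proof (rule sum_pos2)
    show "finite {\<sigma>. \<sigma> permutes {..<2*m}}" by (simp add: finite_permutations)
    show "id \<in> {\<sigma>. \<sigma> permutes {..<2*m}}" by (simp add: permutes_id)
    show "0 < t id" by (simp add: t_def std_symplectic_def sign_id)
    show "0 \<le> t \<sigma>" if "\<sigma> \<in> {\<sigma>. \<sigma> permutes {..<2*m}}" for \<sigma>
    proof (cases "(\<Prod>i<m. std_symplectic (\<sigma> (2*i)) (\<sigma> (2*i+1))) = 0")
      case True
      show ?thesis unfolding t_def True by simp
    next
      case False
      then have "t \<sigma> = 1" unfolding t_def using that by (intro sign_pairing) auto
      then show ?thesis by simp
    qed
  qed
  also have "(\<Sum>\<sigma> | \<sigma> permutes {..<2*m}. t \<sigma>) = (\<Sum>\<sigma> | \<sigma> permutes {..<2*m}.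
      of_int (sign \<sigma>) * (\<Prod>i<m. \<omega> (v (\<sigma> (2*i))) (v (\<sigma> (2*i+1)))))"
    by (intro sum.cong refl t[symmetric]) simp
  finally show ?thesis unfolding wedge_power_def by simp
qed

lemma continuous_on_wedge_power:
  assumes "\<And>j k. j < 2*m \<Longrightarrow> k < 2*m \<Longrightarrow> continuous_on S (\<lambda>a. \<omega> a (v a j) (v a k))"
  shows "continuous_on S (\<lambda>a. wedge_power m (\<omega> a) (v a))"
  unfolding wedge_power_def
proof (intro continuous_intros assms)
  fix \<sigma> i assume *: "\<sigma> \<in> {\<sigma>. \<sigma> permutes {..<2*m}}" "i \<in> {..<m}"
  then have p: "\<sigma> permutes {..<2*m}" and i: "2*i < 2*m" "2*i+1 < 2*m" by auto
  show "\<sigma> (2*i) < 2*m" "\<sigma> (2*i+1) < 2*m" using permutes_in_image[OF p] i by (simp_all add: lessThan_def)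
qed auto

text \<open>Independence of an indexed family includes that its members are distinct. The image set
  alone would not detect a repeated vector.\<close>

definition independent_family :: "nat \<Rightarrow> (nat \<Rightarrow> 'a::real_vector) \<Rightarrow> bool" where
  "independent_family d v \<longleftrightarrow> (\<forall>a. (\<Sum>i<d. a i *\<^sub>R v i) = 0 \<longrightarrow> (\<forall>i<d. a i = 0))"

lemma independent_familyD:
  assumes "independent_family d v" shows "inj_on v {..<d}" "independent (v ` {..<d})"
proof -
  show inj: "inj_on v {..<d}"
  proof (rule inj_onI)
    fix i j assume ij: "i \<in> {..<d}" "j \<in> {..<d}" "v i = v j"
    show "i = j"
    proof (rule ccontr)
      assume ne: "i \<noteq> j"
      define a where "a k = (if k = i then 1 else if k = j then -1 else (0::real))" for k
      have "(\<Sum>k<d. a k *\<^sub>R v k) = (\<Sum>k\<in>{i, j}. a k *\<^sub>R v k)"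
        by (rule sum.mono_neutral_right) (use ij in \<open>auto simp: a_def\<close>)
      also have "\<dots> = 0" using ne ij by (simp add: a_def)
      finally have "a i = 0" using assms ij(1) by (auto simp: independent_family_def)
      then show False by (simp add: a_def)
    qed
  qed
  show "independent (v ` {..<d})"
  proof (rule independent_if_scalars_zero)
    fix f x assume f: "(\<Sum>x\<in>v ` {..<d}. f x *\<^sub>R x) = 0" "x \<in> v ` {..<d}"
    then have "(\<Sum>i<d. f (v i) *\<^sub>R v i) = 0" by (simp add: sum.reindex[OF inj])
    with assms f(2) show "f x = 0" by (auto simp: independent_family_def)
  qed simp
qed

lemma independent_family_span_eq:
  fixes T :: "'a::euclidean_space set"
  assumes "independent_family d v" "\<And>i. i < d \<Longrightarrow> v i \<in> T" "subspace T" "dim T = d"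
  shows "span (v ` {..<d}) = T"
proof
  note ind = independent_familyD[OF assms(1)]
  have "card (v ` {..<d}) = d" using ind(1) by (simp add: card_image)
  then show "T \<subseteq> span (v ` {..<d})"
    using card_ge_dim_independent[of "v ` {..<d}" T] ind(2) assms by auto
  show "span (v ` {..<d}) \<subseteq> T" using assms(2,3) by (intro span_minimal) auto
qed

text \<open>Functionals dual to the \<open>v i\<close> bound each coefficient of a relation among
  the \<open>w i\<close> by a small multiple of the sum of the absolute values of all coefficients.
  Summation then forces them to vanish.\<close>

lemma independent_family_open:
  fixes v :: "nat \<Rightarrow> 'a::euclidean_space"
  assumes "independent_family d v"
  obtains \<epsilon> where "\<epsilon> > 0" "\<And>w. (\<And>i. i < d \<Longrightarrow> norm (w i - v i) < \<epsilon>) \<Longrightarrow> independent_family d w"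
proof -
  note ind = independent_familyD[OF assms]
  have "\<exists>g. linear g \<and> (\<forall>i<d. g (v i) = (if i = j then 1 else 0::real))" for j
  proof -
    obtain g :: "'a \<Rightarrow> real" where g: "linear g" "\<forall>x\<in>v ` {..<d}. g x = (if inv_into {..<d} v x
      = j then 1 else 0)"
      using linear_independent_extend[OF ind(2), of "\<lambda>x. if inv_into {..<d} v x = j then 1 else 0"] by blast
    then show ?thesis using inv_into_f_f[OF ind(1)] by (intro exI[of _ g]) auto
  qed
  then obtain g where g: "\<And>j. linear (g j)" "\<And>j i. i < d \<Longrightarrow> g j (v i) = (if i = j then 1 else 0::real)"
    by metis
  have "\<exists>K. \<forall>z. \<bar>g j z\<bar> \<le> K * norm z" for j
    using linear_bounded[OF g(1)[of j]] by auto
  then obtain K where K: "\<And>j z. \<bar>g j z\<bar> \<le> K j * norm z" by metis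
  \<comment> \<open>Evaluation at a unit vector shows that the constants \<open>K j\<close> are
    nonnegative.\<close>
  obtain z0 :: 'a where "norm z0 = 1" using vector_choose_size[of 1] by auto
  then have K0: "0 \<le> K j" for j using K[of j z0] by simp
  \<comment> \<open>The extra 1 makes N positive and the final factor (N - 1) / N smaller than
    1.\<close>
  define N where "N = (\<Sum>j<d. K j) + 1"
  have N: "N > 0" using K0 by (simp add: N_def sum_nonneg add_nonneg_pos)
  show thesis
  proof (rule that[of "1 / N"])
    show "1 / N > 0" using N by simp
    fix w assume w: "\<And>i. i < d \<Longrightarrow> norm (w i - v i) < 1 / N"
    show "independent_family d w" unfolding independent_family_def
    proof (intro allI impI)
      fix a i assume a: "(\<Sum>i<d. a i *\<^sub>R w i) = 0" and i: "i < d"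
      define s where "s = (\<Sum>i<d. \<bar>a i\<bar>)"
      have "\<bar>a j\<bar> \<le> K j * (s / N)" if j: "j < d" for j
      proof -
        have "g j (\<Sum>i<d. a i *\<^sub>R v i) = (\<Sum>i<d. if i = j then a j else 0)"
          unfolding linear_sum[OF g(1)] linear_cmul[OF g(1)] using g(2) by (intro sum.cong refl) auto
        then have "a j = g j (\<Sum>i<d. a i *\<^sub>R v i)" using j by simp
        also have "(\<Sum>i<d. a i *\<^sub>R v i) = (\<Sum>i<d. a i *\<^sub>R (v i - w i))"
          using a by (simp add: scaleR_diff_right sum_subtractf)
        also have "\<bar>g j \<dots>\<bar> \<le> K j * norm (\<Sum>i<d. a i *\<^sub>R (v i - w i))" by (rule K)
        also have "norm (\<Sum>i<d. a i *\<^sub>R (v i - w i)) \<le> (\<Sum>i<d. \<bar>a i\<bar> * (1 / N))"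
        proof (intro sum_norm_le)
          fix i assume "i \<in> {..<d}"
          then have "norm (v i - w i) \<le> 1 / N" using w[of i] by (simp add: norm_minus_commute)
          then show "norm (a i *\<^sub>R (v i - w i)) \<le> \<bar>a i\<bar> * (1 / N)"
            by (simp only: norm_scaleR mult_left_mono abs_ge_zero)
        qed
        also have "\<dots> = s / N" by (simp add: s_def sum_distrib_right[symmetric] sum_divide_distrib)
        finally show ?thesis using K0 by (simp add: mult_left_mono)
      qed
      then have "s \<le> (\<Sum>j<d. K j * (s / N))" unfolding s_def by (intro sum_mono) (auto simp: s_def)
      also have "\<dots> = (N - 1) * s / N" unfolding sum_distrib_right[symmetric] by (simp add: N_def)
      finally have "s \<le> 0" using N by (simp add: field_simps)
      then have "s = 0" by (simp add: s_def sum_nonneg antisym)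
      then show "a i = 0" using i by (simp add: s_def sum_nonneg_eq_0_iff)
    qed
  qed
qed

text \<open>Symplectic Gram-Schmidt: a nonzero vector orthogonal to a maximal system of hyperbolic
  pairs has a partner by nondegeneracy. The partner can be projected to the complement too, which
  gives one more pair. The length of such systems is bounded by \<open>dim T\<close>.\<close>

lemma darboux_basis:
  fixes T :: "'a::euclidean_space set" and \<omega> :: "'a \<Rightarrow> 'a \<Rightarrow> real"
  assumes T: "subspace T"
    and add: "\<And>u v w. u \<in> T \<Longrightarrow> v \<in> T \<Longrightarrow> w \<in> T \<Longrightarrow> \<omega> (u + v) w = \<omega> u w + \<omega> v w"
    and scale: "\<And>s u w. u \<in> T \<Longrightarrow> w \<in> T \<Longrightarrow> \<omega> (s *\<^sub>R u) w = s * \<omega> u w"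
    and anti: "\<And>u v. u \<in> T \<Longrightarrow> v \<in> T \<Longrightarrow> \<omega> v u = - \<omega> u v"
    and nondeg: "\<And>u. u \<in> T \<Longrightarrow> (\<And>v. v \<in> T \<Longrightarrow> \<omega> u v = 0) \<Longrightarrow> u = 0"
  shows "\<exists>m v. (\<forall>j<2*m. v j \<in> T) \<and> (\<forall>j<2*m. \<forall>k<2*m. \<omega> (v j) (v k) = std_symplectic j k) \<and>
    independent_family (2*m) v \<and> dim T = 2*m"
proof -
  define sys where "sys m v \<longleftrightarrow> (\<forall>j<2*m. v j \<in> T) \<and> (\<forall>j<2*m. \<forall>k<2*m. \<omega> (v j) (v k) = std_symplectic j k)"
    for m v
  have sum: "\<omega> (\<Sum>i\<in>I. a i *\<^sub>R v i) w = (\<Sum>i\<in>I. a i * \<omega> (v i) w)"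
    if "\<And>i. i \<in> I \<Longrightarrow> v i \<in> T" "w \<in> T" for I :: "nat set" and a v w
    using that
  proof (induction I rule: infinite_finite_induct)
    case (insert i I)
    then show ?case by (simp add: add scale T subspace_scale subspace_sum)
  qed (use scale[of 0 w 0] T in \<open>auto simp: subspace_0\<close>)
  \<comment> \<open>The index paired with \<open>k\<close> in the standard symplectic
    matrix.\<close>
  define pt where "pt k = (if even k then Suc k else k - 1)" for k :: nat
  have pt: "pt k < 2*m" "pt (pt k) = k" if "k < 2*m" for k m
    using that by (auto simp: pt_def)
  have ss: "std_symplectic j k = (if j = pt k then std_symplectic (pt k) k else 0)" for j k
    by (auto simp: pt_def std_symplectic_def)
  have sq: "std_symplectic (pt k) k * std_symplectic (pt k) k = 1" for k
    by (auto simp: pt_def std_symplectic_def)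
  have coeff: "\<omega> (\<Sum>j<2*m. a j *\<^sub>R v j) (v k) = a (pt k) * std_symplectic (pt k) k"
    if "sys m v" "k < 2*m" for m v k a
  proof -
    have "\<omega> (\<Sum>j<2*m. a j *\<^sub>R v j) (v k) = (\<Sum>j<2*m. a j * \<omega> (v j) (v k))"
      using that by (intro sum) (auto simp: sys_def)
    also have "\<dots> = (\<Sum>j<2*m. if j = pt k then a j * std_symplectic (pt k) k else 0)"
    proof (intro sum.cong refl)
      fix j assume "j \<in> {..<2*m}"
      then have "\<omega> (v j) (v k) = std_symplectic j k" using that by (simp add: sys_def)
      then show "a j * \<omega> (v j) (v k) = (if j = pt k then a j * std_symplectic (pt k) k else 0)"
        using ss[of j k] by (cases "j = pt k") simp_all
    qed
    finally show ?thesis using pt(1)[OF that(2)] by simp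
  qed
  have ind: "independent_family (2*m) v" if s: "sys m v" for m v
    unfolding independent_family_def
  proof (intro allI impI)
    fix a k assume a: "(\<Sum>j<2*m. a j *\<^sub>R v j) = 0" and k: "k < 2*m"
    have pk: "pt k < 2*m" by (rule pt(1)[OF k])
    have "\<omega> 0 (v (pt k)) = 0" using scale[of 0 "v (pt k)" 0] s pk T by (simp add: sys_def subspace_0)
    then have "a k * std_symplectic k (pt k) = 0"
      using coeff[OF s pk, of a] a pt(2)[OF k] by simp
    then show "a k = 0" using sq[of "pt k"] pt(2)[OF k] by auto
  qed
  have bound: "2*m \<le> dim T" if s: "sys m v" for m v
  proof -
    note i = independent_familyD[OF ind[OF s]]
    have "v ` {..<2*m} \<subseteq> T" using s by (auto simp: sys_def)
    then have "card (v ` {..<2*m}) \<le> dim T" using independent_card_le_dim[OF _ i(2)] by blast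
    then show ?thesis by (simp add: card_image[OF i(1)])
  qed
  define Q where "Q m \<longleftrightarrow> (\<exists>v. sys m v)" for m
  have bQ: "m \<le> dim T" if "Q m" for m using that bound unfolding Q_def by fastforce
  have "Q 0" by (auto simp: Q_def sys_def)
  then have "Q (Greatest Q)" using bQ by (rule GreatestI_nat)
  then obtain m v where s: "sys m v" and m: "m = Greatest Q" unfolding Q_def by blast
  have vT: "v j \<in> T" if "j < 2*m" for j using s that by (simp add: sys_def)
  \<comment> \<open>Each row of the standard matrix has a single nonzero entry, a sign, so the same
    sign inverts it and the projection has this explicit form.\<close>
  define pr where "pr u = u - (\<Sum>j<2*m. (std_symplectic j (pt j) * \<omega> u (v (pt j))) *\<^sub>R v j)" for u
  have sT: "(\<Sum>j<2*m. a j *\<^sub>R v j) \<in> T" for a using vT T by (intro subspace_sum subspace_scale) auto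
  have prT: "pr u \<in> T" if "u \<in> T" for u unfolding pr_def using that sT T by (intro subspace_diff)
  have diff: "\<omega> (u - u') w = \<omega> u w - \<omega> u' w" if "u \<in> T" "u' \<in> T" "w \<in> T" for u u' w
    using add[of u "(-1) *\<^sub>R u'" w] scale[of u' w "-1"] that T by (simp add: subspace_neg)
  have pr_v: "\<omega> (pr u) (v k) = 0" if "u \<in> T" "k < 2*m" for u k
    using coeff[OF s that(2), of "\<lambda>j. std_symplectic j (pt j) * \<omega> u (v (pt j))"] that sq[of k]
    unfolding pr_def diff[OF that(1) sT vT[OF that(2)]]
    by (simp add: pt(2)[OF that(2)] algebra_simps)
  have "pr u = 0" if u: "u \<in> T" for u
  proof (rule ccontr)
    assume "pr u \<noteq> 0"
    then obtain w where w: "w \<in> T" "\<omega> (pr u) w \<noteq> 0" using nondeg prT[OF u] by blast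
    have "\<omega> (\<Sum>j<2*m. a j *\<^sub>R v j) (pr u) = 0" for a
      using sum[of "{..<2*m}" v "pr u" a] vT prT[OF u] anti[OF prT[OF u] vT] pr_v[OF u] by simp
    then have "\<omega> (pr w) (pr u) = \<omega> w (pr u)"
      unfolding pr_def[of w] using diff[OF w(1) sT prT[OF u]] by simp
    then have a0: "\<omega> (pr u) (pr w) \<noteq> 0"
      using w(2) anti[OF prT[OF u] prT[OF w(1)]] anti[OF prT[OF u] w(1)] by simp
    \<comment> \<open>Dividing by the value of the form makes the pair hyperbolic.\<close>
    define a c where "a = pr u" and "c = (1 / \<omega> (pr u) (pr w)) *\<^sub>R pr w"
    have acT: "a \<in> T" "c \<in> T" using prT u w(1) T by (auto simp: a_def c_def subspace_scale)
    have ca: "\<omega> c a = -1" using a0 scale[OF prT[OF w(1)] prT[OF u]] anti[OF prT[OF u] prT[OF w(1)]]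
      by (simp add: a_def c_def)
    have ac: "\<omega> a c = 1" using anti[OF acT] ca by simp
    have self: "\<omega> z z = 0" if "z \<in> T" for z using anti[OF that that] by simp
    have av: "\<omega> a (v k) = 0" "\<omega> c (v k) = 0" "\<omega> (v k) a = 0" "\<omega> (v k) c = 0" if k: "k < 2*m" for k
    proof -
      show 1: "\<omega> a (v k) = 0" "\<omega> c (v k) = 0" unfolding a_def c_def
        using pr_v[OF u k] pr_v[OF w(1) k] scale[OF prT[OF w(1)] vT[OF k]] by simp_all
      show "\<omega> (v k) a = 0" "\<omega> (v k) c = 0" using 1 anti[OF acT(1) vT[OF k]] anti[OF acT(2) vT[OF k]]
        by simp_all
    qed
    define v' where "v' j = (if j < 2*m then v j else if j = 2*m then a else c)" for j
    have "sys (Suc m) v'" unfolding sys_def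
    proof (intro conjI allI impI)
      fix j k assume j: "j < 2 * Suc m" and k: "k < 2 * Suc m"
      have cases: "j < 2*m \<or> j = 2*m \<or> j = Suc (2*m)" "k < 2*m \<or> k = 2*m \<or> k = Suc (2*m)" using j k by auto
      have off: "std_symplectic j k = 0" if "j < 2*m" "k \<ge> 2*m \<or> k < j - 1" for j k
        using that by (auto simp: std_symplectic_def)
      show "v' j \<in> T" using acT vT by (simp add: v'_def)
      show "\<omega> (v' j) (v' k) = std_symplectic j k"
        using cases s av self acT ac ca off[of j k] off[of k j] std_symplectic_minus[of j k]
        by (elim disjE) (auto simp: v'_def sys_def std_symplectic_def)
    qed
    then have "Q (Suc m)" by (auto simp: Q_def)
    then have "Suc m \<le> Greatest Q" using bQ by (rule Greatest_le_nat)
    then show False using m by simp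
  qed
  then have "u = (\<Sum>j<2*m. (std_symplectic j (pt j) * \<omega> u (v (pt j))) *\<^sub>R v j)" if "u \<in> T" for u
    using that unfolding pr_def by (metis eq_iff_diff_eq_0)
  then have "u \<in> span (v ` {..<2*m})" if "u \<in> T" for u
    using that by (metis (no_types, lifting) imageI span_base span_scale span_sum)
  then have "T \<subseteq> span (v ` {..<2*m})" by blast
  then have "dim T \<le> card (v ` {..<2*m})" by (rule dim_le_card) simp
  also have "\<dots> \<le> 2*m" using card_image_le[of "{..<2*m}" v] by simp
  finally have "dim T = 2*m" using bound[OF s] by simp
  with s ind[OF s] show ?thesis unfolding sys_def by blast
qed

section \<open>Cayley charts of adjoint orbits\<close>

lemma bounded_bilinear_quat_matrix_mult:
  "bounded_bilinear ((**) :: quat^'n^'n \<Rightarrow> quat^'n^'n \<Rightarrow> quat^'n^'n)"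
  unfolding bilinear_conv_bounded_bilinear[symmetric] bilinear_def
  by (auto intro!: linearI simp: qmat_distrib qmat_scaleR)

definition resolvent :: "quat^'n^'n \<Rightarrow> quat^'n^'n" where
  "resolvent A = matrix_inv (mat 1 - A)"

text \<open>The identity R' - R = R' (A' - A) R, used twice, shows that the error of the linear
  approximation is R' D R D R with D = A' - A. It is quadratic in D because the resolvents are
  uniformly bounded.\<close>

lemma resolvent_near_0:
  obtains \<delta> where "\<delta> > 0"
    "\<And>A :: quat^'n^'n. norm A < \<delta> \<Longrightarrow> (mat 1 - A) ** resolvent A = mat 1 \<and> resolvent A ** (mat 1 - A) = mat 1"
    "\<And>A :: quat^'n^'n. norm A < \<delta> \<Longrightarrow> (resolvent has_derivative (\<lambda>D. resolvent A ** D ** resolvent A)) (at A)"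
proof -
  obtain K where K: "K > 0" "\<And>(A :: quat^'n^'n) (C :: quat^'n^'n). norm (A ** C) \<le> norm A * norm C * K"
    using bounded_bilinear.pos_bounded[OF bounded_bilinear_quat_matrix_mult[where 'n = 'n]] by blast
  \<comment> \<open>With this radius, left multiplication by \<open>A\<close> at least halves
    norms.\<close>
  define \<delta> where "\<delta> = 1 / (2 * K)"
  have small: "norm (A ** C) \<le> norm C / 2" if "norm A < \<delta>" for A C :: "quat^'n^'n"
  proof -
    have "norm A * K \<le> 1 / 2" using that K(1) by (simp add: \<delta>_def field_simps)
    then have "norm C * (norm A * K) \<le> norm C * (1 / 2)" by (intro mult_left_mono) auto
    then show ?thesis using K(2)[of A C] by (simp add: mult_ac)
  qed
  have inv: "(mat 1 - A) ** resolvent A = mat 1" "resolvent A ** (mat 1 - A) = mat 1"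
    if A: "norm A < \<delta>" for A :: "quat^'n^'n"
  proof -
    have "invertible (mat 1 - A)"
    proof (rule invertible_quat_matrixI)
      fix v assume "(mat 1 - A) *v v = 0"
      then have v: "A *v v = v" by (simp add: matrix_vector_mult_diff_rdistrib)
      \<comment> \<open>A matrix all of whose columns equal \<open>v\<close> brings the norm
        estimate for matrix products to bear on a vector.\<close>
      define D :: "quat^'n^'n" where "D = (\<chi> i j. v $ i)"
      have "(A ** D) $ i $ j = (A *v v) $ i" for i j
        by (simp add: D_def matrix_matrix_mult_def matrix_vector_mult_def)
      then have "A ** D = D" unfolding v by (simp add: D_def vec_eq_iff)
      then have "D = 0" using small[OF A, of D] by auto
      then show "v = 0" by (auto simp: D_def vec_eq_iff)
    qed
    then show "(mat 1 - A) ** resolvent A = mat 1" "resolvent A ** (mat 1 - A) = mat 1"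
      by (simp_all add: resolvent_def qmat_inv)
  qed
  \<comment> \<open>From R = 1 + A R the norm of R is at most norm 1 plus half of itself.\<close>
  define C where "C = 2 * norm (mat 1 :: quat^'n^'n)"
  have bound: "norm (resolvent A) \<le> C" if A: "norm A < \<delta>" for A :: "quat^'n^'n"
  proof -
    have "resolvent A = mat 1 + A ** resolvent A" using inv(1)[OF A] by (simp add: qmat_distrib algebra_simps)
    then have "norm (resolvent A) \<le> norm (mat 1 :: quat^'n^'n) + norm (A ** resolvent A)"
      using norm_triangle_ineq by metis
    then show ?thesis using small[OF A, of "resolvent A"] by (simp add: C_def)
  qed
  have diff: "resolvent A' - resolvent A = resolvent A' ** (A' - A) ** resolvent A"
    if "norm A < \<delta>" "norm A' < \<delta>" for A A' :: "quat^'n^'n"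
  proof -
    have eq: "A' - A = (mat 1 - A) - (mat 1 - A')" by simp
    have "resolvent A' ** (A' - A) ** resolvent A
      = resolvent A' ** ((mat 1 - A) ** resolvent A) - (resolvent A' ** (mat 1 - A')) ** resolvent A"
      unfolding eq by (simp only: qmat_distrib matrix_mul_assoc)
    then show ?thesis by (simp add: inv[OF that(1)] inv[OF that(2)])
  qed
  have deriv: "(resolvent has_derivative (\<lambda>D. resolvent A ** D ** resolvent A)) (at A)" if A: "norm A < \<delta>"
    for A :: "quat^'n^'n"
    unfolding has_derivative_iff_norm
  proof (intro conjI)
    interpret bounded_bilinear "(**) :: quat^'n^'n \<Rightarrow> quat^'n^'n \<Rightarrow> quat^'n^'n"
      by (rule bounded_bilinear_quat_matrix_mult)
    show "bounded_linear (\<lambda>D. resolvent A ** D ** resolvent A)"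
      by (rule bounded_linear_compose[OF bounded_linear_left bounded_linear_right])
    \<comment> \<open>Three resolvents and four multiplications occur in R' D R D R.\<close>
    define M where "M = C * C * C * K * K * K * K"
    have nonneg: "C \<ge> 0" "K \<ge> 0" using K by (auto simp: C_def)
    have est: "norm (resolvent A' - resolvent A - resolvent A ** (A' - A) ** resolvent A) / norm (A' - A)
      \<le> M * norm (A' - A)"
      if A': "norm A' < \<delta>" for A'
    proof -
      define D where "D = A' - A"
      have RD: "resolvent A' - resolvent A = resolvent A' ** D ** resolvent A" using diff[OF A A']
        by (simp add: D_def)
      have eq: "resolvent A' - resolvent A - resolvent A ** D ** resolvent A
        = resolvent A' ** D ** resolvent A ** D ** resolvent A"
      proof -
        have "resolvent A' - resolvent A - resolvent A ** D ** resolvent A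
          = (resolvent A' - resolvent A) ** D ** resolvent A"
          unfolding RD[symmetric] qmat_distrib using RD by simp
        then show ?thesis by (simp only: RD)
      qed
      have mul: "norm (P ** Q) \<le> p * q * K" if "norm P \<le> p" "norm Q \<le> q" for P Q :: "quat^'n^'n" and p q
      proof -
        have "norm P * norm Q \<le> p * q" using that order_trans[OF norm_ge_zero that(1)]
          by (intro mult_mono) auto
        then show ?thesis using K(2)[of P Q] mult_right_mono[of "norm P * norm Q" "p * q" K] nonneg by simp
      qed
      have 4: "norm (resolvent A' ** D ** resolvent A ** D ** resolvent A)
        \<le> (((C * norm D * K) * C * K) * norm D * K) * C * K"
        by (intro mul bound A A' order_refl)
      have "(((C * norm D * K) * C * K) * norm D * K) * C * K = M * norm D * norm D"
        by (simp add: M_def mult_ac)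
      then have "norm (resolvent A' - resolvent A - resolvent A ** D ** resolvent A) \<le> M * norm D * norm D"
        using 4 unfolding eq by linarith
      then show ?thesis unfolding D_def[symmetric]
        by (cases "D = 0") (simp_all add: field_simps)
    qed
    show "((\<lambda>A'. norm (resolvent A' - resolvent A - resolvent A ** (A' - A) ** resolvent A) / norm (A' - A)) \<longlongrightarrow>
      0) (at A)"
    proof (rule Lim_null_comparison)
      have "open (ball 0 \<delta> :: (quat^'n^'n) set)" "A \<in> ball 0 \<delta>" using A by auto
      then have "eventually (\<lambda>A'. A' \<in> ball 0 \<delta>) (at A)" by (rule eventually_at_in_open')
      then show "\<forall>\<^sub>F A' in at A. norm (norm (resolvent A' - resolvent A - resolvent A ** (A' - A) ** resolvent
        A) / norm (A' - A)) \<le> M * norm (A' - A)"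
        by (rule eventually_mono) (use est in auto)
      have "((\<lambda>A'. M * norm (A' - A)) \<longlongrightarrow> M * norm (A - A)) (at A)" by (intro tendsto_intros)
      then show "((\<lambda>A'. M * norm (A' - A)) \<longlongrightarrow> 0) (at A)" by simp
    qed
  qed
  have "\<delta> > 0" using K(1) by (simp add: \<delta>_def)
  then show thesis using that[of \<delta>] inv deriv by blast
qed

section \<open>Tangent spaces and the symplectic form of an orbit\<close>

context quaternionic_skew_form begin

lemma SO_star_inverse:
  assumes "g \<in> SO_star B"
  shows "adjoint_star g ** g = mat 1" "g ** adjoint_star g = mat 1" "adjoint_star g \<in> SO_star B"
proof -
  have inv: "invertible g" and 1: "adjoint_star g ** g = mat 1" using assms by (auto simp: SO_iff)
  have "adjoint_star g = adjoint_star g ** (g ** matrix_inv g)" by (simp add: qmat_inv[OF inv])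
  also have "\<dots> = matrix_inv g" by (simp add: matrix_mul_assoc 1)
  finally have eq: "adjoint_star g = matrix_inv g" .
  show "adjoint_star g ** g = mat 1" "g ** adjoint_star g = mat 1" "adjoint_star g \<in> SO_star B"
    using 1 qmat_inv[OF inv] SO_star_inv(1)[OF assms] unfolding eq by auto
qed

lemma orbit_memE:
  assumes "y \<in> adj_orbit (SO_star B) x"
  obtains g where "g \<in> SO_star B" "y = g ** x ** adjoint_star g"
proof -
  obtain g where g: "g \<in> SO_star B" "g ** x = y ** g" using assms by (rule adj_orbit_memE)
  have "y = y ** (g ** adjoint_star g)" by (simp add: SO_star_inverse[OF g(1)])
  also have "\<dots> = g ** x ** adjoint_star g" by (simp add: matrix_mul_assoc g(2))
  finally show thesis using that g(1) by blast
qed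

lemma Ad_in_L: "X \<in> L \<Longrightarrow> g ** X ** adjoint_star g \<in> L"
  by (simp add: L_iff star_mult star_star qmat_minus matrix_mul_assoc)

lemma orbit_subset_L: "x \<in> L \<Longrightarrow> y \<in> adj_orbit (SO_star B) x \<Longrightarrow> y \<in> L"
  using Ad_in_L by (metis orbit_memE)

text \<open>Conjugation by \<open>g\<close> preserves \<open>L\<close> and brackets, so it carries
  the tangent space at \<open>x\<close> isomorphically onto the one at \<open>y\<close>. This makes
  the arbitrary base point in \<open>orbit_dim\<close> harmless.\<close>

lemma dim_orbit_tangent:
  assumes "y \<in> adj_orbit (SO_star B) x"
  shows "dim (orbit_tangent L y) = dim (orbit_tangent L x)"
proof -
  obtain g where g: "g \<in> SO_star B" "y = g ** x ** adjoint_star g" using assms by (rule orbit_memE)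
  note i = SO_star_inverse[OF g(1)]
  define Ad where "Ad z = g ** z ** adjoint_star g" for z
  have lin: "linear Ad" by (rule linearI) (simp_all add: Ad_def qmat_distrib qmat_scaleR)
  have Ad_inv: "adjoint_star g ** Ad z ** g = z" "Ad (adjoint_star g ** z ** g) = z" for z
  proof -
    have "adjoint_star g ** Ad z ** g = (adjoint_star g ** g) ** z ** (adjoint_star g ** g)"
      by (simp only: Ad_def matrix_mul_assoc)
    then show "adjoint_star g ** Ad z ** g = z" by (simp add: i)
    have "Ad (adjoint_star g ** z ** g) = (g ** adjoint_star g) ** z ** (g ** adjoint_star g)"
      by (simp only: Ad_def matrix_mul_assoc)
    then show "Ad (adjoint_star g ** z ** g) = z" by (simp add: i)
  qed
  have Ad_mult: "Ad a ** Ad c = Ad (a ** c)" for a c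
  proof -
    have "Ad a ** Ad c = g ** a ** (adjoint_star g ** g) ** c ** adjoint_star g"
      by (simp only: Ad_def matrix_mul_assoc)
    then show ?thesis by (simp add: i Ad_def matrix_mul_assoc)
  qed
  have Ad_br: "Ad (lie_bracket X x) = lie_bracket (Ad X) y" for X
    unfolding lie_bracket_def g(2) Ad_def[symmetric] Ad_mult linear_diff[OF lin] ..
  have "orbit_tangent L y = Ad ` orbit_tangent L x"
  proof (intro equalityI subsetI)
    fix z assume "z \<in> orbit_tangent L y"
    then obtain Y where Y: "Y \<in> L" "z = lie_bracket Y y" by (auto simp: orbit_tangent_def)
    have "adjoint_star g ** Y ** g \<in> L" using Ad_in_L[OF Y(1), of "adjoint_star g"] by (simp add: star_star)
    moreover have "z = Ad (lie_bracket (adjoint_star g ** Y ** g) x)" by (simp add: Ad_br Ad_inv Y)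
    ultimately show "z \<in> Ad ` orbit_tangent L x" by (auto simp: orbit_tangent_def)
  next
    fix z assume "z \<in> Ad ` orbit_tangent L x"
    then obtain X where X: "X \<in> L" "z = Ad (lie_bracket X x)" by (auto simp: orbit_tangent_def)
    have "Ad X \<in> L" using Ad_in_L[OF X(1)] by (simp add: Ad_def)
    then show "z \<in> orbit_tangent L y" unfolding X(2) Ad_br by (auto simp: orbit_tangent_def)
  qed
  moreover have "inj Ad" using Ad_inv(1) by (metis injI)
  ultimately show ?thesis using dim_image_eq[OF lin] inj_on_subset by (metis subset_UNIV)
qed

lemma orbit_dim_eq: "orbit_dim L (adj_orbit (SO_star B) x) = dim (orbit_tangent L x)"
proof -
  have "x \<in> adj_orbit (SO_star B) x" by (rule adj_orbit_memI[OF SO_star_one]) simp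
  then have "(SOME y. y \<in> adj_orbit (SO_star B) x) \<in> adj_orbit (SO_star B) x" by (metis someI)
  then show ?thesis unfolding orbit_dim_def by (rule dim_orbit_tangent)
qed

lemma orbit_tangent_subspace: "subspace (orbit_tangent L y)"
proof -
  have "linear (\<lambda>X. lie_bracket X y)" by (rule linearI) (simp_all add: lie_bracket_linear)
  moreover have "orbit_tangent L y = (\<lambda>X. lie_bracket X y) ` L" by (auto simp: orbit_tangent_def)
  ultimately show ?thesis using L_subspace by (simp add: linear_subspace_image)
qed

lemma lie_bracket_anti: "lie_bracket A C = - lie_bracket C A"
  by (simp add: lie_bracket_def)

text \<open>Invariance lets the trace form be written through [X, y] or through [y, Y], so the
  arbitrary representatives in \<open>orbit_symplectic\<close> may be replaced by any
  others.\<close>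

lemma orbit_symplectic_eq:
  assumes y: "y \<in> L" and X: "X \<in> L" and Y: "Y \<in> L"
  shows "orbit_symplectic L y (lie_bracket X y) (lie_bracket Y y)
    = - (4 * (real CARD('n) - 1)) * re_trace (lie_bracket X y ** Y)"
proof -
  define X' Y' where "X' = (SOME X'. X' \<in> L \<and> lie_bracket X' y = lie_bracket X y)"
    and "Y' = (SOME Y'. Y' \<in> L \<and> lie_bracket Y' y = lie_bracket Y y)"
  have X': "X' \<in> L" "lie_bracket X' y = lie_bracket X y"
    using someI[of "\<lambda>X'. X' \<in> L \<and> lie_bracket X' y = lie_bracket X y" X] X unfolding X'_def by auto
  have Y': "Y' \<in> L" "lie_bracket Y' y = lie_bracket Y y"
    using someI[of "\<lambda>Y'. Y' \<in> L \<and> lie_bracket Y' y = lie_bracket Y y" Y] Y unfolding Y'_def by auto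
  have swap: "re_trace (lie_bracket X y ** Z) = re_trace (X ** lie_bracket y Z)" for Z
    by (simp add: re_trace_lie_bracket)
  have "lie_bracket y Y' = lie_bracket y Y" using Y'(2) lie_bracket_anti by metis
  then have "re_trace (lie_bracket X' y ** Y') = re_trace (lie_bracket X y ** Y)"
    unfolding X'(2) swap by simp
  moreover have "re_trace (y ** lie_bracket X' Y') = - re_trace (lie_bracket X' y ** Y')"
    unfolding re_trace_lie_bracket by (subst lie_bracket_anti) (simp add: qmat_minus re_trace_simps)
  moreover have "orbit_symplectic L y (lie_bracket X y) (lie_bracket Y y)
    = killing_form L y (lie_bracket X' Y')"
    by (simp add: orbit_symplectic_def X'_def Y'_def Let_def)
  ultimately show ?thesis using killing_form_eq[OF y L_bracket[OF X'(1) Y'(1)]] by (simp add: algebra_simps)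
qed

text \<open>A tangent vector u = [X, x] in the radical satisfies
  \<open>re_trace (u ** Y) = 0\<close> for all Y in \<open>L\<close>, so it vanishes by
  nondegeneracy of the trace form. The basis comes with representatives in \<open>L\<close>, which
  serve as directions of the chart.\<close>

lemma orbit_symplectic_darboux:
  assumes x: "x \<in> L" and n: "CARD('n) \<noteq> 1"
  shows "\<exists>m X. (\<forall>i<2*m. X i \<in> L) \<and> (\<forall>i<2*m. \<forall>j<2*m.
       orbit_symplectic L x (lie_bracket (X i) x) (lie_bracket (X j) x) = std_symplectic i j) \<and>
    independent_family (2*m) (\<lambda>i. lie_bracket (X i) x) \<and> dim (orbit_tangent L x) = 2*m"
proof -
  let ?T = "orbit_tangent L x" and ?\<omega> = "orbit_symplectic L x"
  define k where "k = - (4 * (real CARD('n) - 1))"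
  have k: "k \<noteq> 0" using n by (simp add: k_def)
  have T: "\<exists>X. X \<in> L \<and> u = lie_bracket X x" if "u \<in> ?T" for u using that by (auto simp: orbit_tangent_def)
  have eq: "?\<omega> u (lie_bracket Y x) = k * re_trace (u ** Y)" if "u \<in> ?T" "Y \<in> L" for u Y
    using T[OF that(1)] orbit_symplectic_eq[OF x _ that(2)] by (auto simp: k_def)
  have 1: "?\<omega> (u + v) w = ?\<omega> u w + ?\<omega> v w" if "u \<in> ?T" "v \<in> ?T" "w \<in> ?T" for u v w
    using T[OF that(3)] that(1,2) subspace_add[OF orbit_tangent_subspace that(1,2)]
    by (auto simp: eq qmat_distrib re_trace_simps algebra_simps)
  have 2: "?\<omega> (s *\<^sub>R u) w = s * ?\<omega> u w" if "u \<in> ?T" "w \<in> ?T" for s u w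
    using T[OF that(2)] that(1) subspace_scale[OF orbit_tangent_subspace that(1)]
    by (auto simp: eq qmat_scaleR re_trace_simps)
  have 3: "?\<omega> v u = - ?\<omega> u v" if uv: "u \<in> ?T" "v \<in> ?T" for u v
  proof -
    obtain X Y where X: "X \<in> L" "u = lie_bracket X x" and Y: "Y \<in> L" "v = lie_bracket Y x"
      using T[OF uv(1)] T[OF uv(2)] by blast
    have "re_trace (lie_bracket Y x ** X) = re_trace (Y ** lie_bracket x X)"
      by (simp add: re_trace_lie_bracket)
    also have "\<dots> = - re_trace (lie_bracket X x ** Y)"
      unfolding lie_bracket_anti[of x X] qmat_minus re_trace_simps re_trace_commute[of Y "lie_bracket X x"] ..
    finally show ?thesis using eq[OF uv(1) Y(1)] eq[OF uv(2) X(1)] X(2) Y(2) by simp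
  qed
  have 4: "u = 0" if u: "u \<in> ?T" and 0: "\<And>v. v \<in> ?T \<Longrightarrow> ?\<omega> u v = 0" for u
  proof (rule re_trace_nondegenerate)
    show "u \<in> L" using T[OF u] L_bracket x by auto
    fix c assume c: "c \<in> L"
    then have "lie_bracket c x \<in> ?T" by (auto simp: orbit_tangent_def)
    from 0[OF this] show "re_trace (u ** c) = 0" using eq[OF u c] k by simp
  qed
  have "\<exists>m v. (\<forall>j<2*m. v j \<in> ?T) \<and> (\<forall>j<2*m. \<forall>k<2*m. ?\<omega> (v j) (v k) = std_symplectic j k) \<and>
    independent_family (2*m) v \<and> dim ?T = 2*m"
    by (rule darboux_basis) (fact orbit_tangent_subspace | fact 1 | fact 2 | fact 3 | fact 4)+
  then obtain m v where v: "\<forall>j<2*m. v j \<in> ?T"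
    "\<forall>j<2*m. \<forall>k<2*m. ?\<omega> (v j) (v k) = std_symplectic j k"
    "independent_family (2*m) v" "dim ?T = 2*m" by (elim exE conjE)
  have "\<forall>j. \<exists>Y. j < 2*m \<longrightarrow> Y \<in> L \<and> v j = lie_bracket Y x" using T v(1) by blast
  then obtain X where X: "\<forall>j. j < 2*m \<longrightarrow> X j \<in> L \<and> v j = lie_bracket (X j) x" by (rule choice[THEN exE])
  have "independent_family (2*m) (\<lambda>i. lie_bracket (X i) x)"
    using v(3) X unfolding independent_family_def by simp
  moreover have "\<forall>i<2*m. \<forall>j<2*m. ?\<omega> (lie_bracket (X i) x) (lie_bracket (X j) x) = std_symplectic i j"
    using X v(2) by metis
  ultimately show ?thesis using X v(4) by blast
qed

end

section \<open>The Cayley transform and exact differences along the orbit\<close>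

locale cayley_chart = quaternionic_skew_form B for B :: "quat^'n \<Rightarrow> quat^'n \<Rightarrow> quat" +
  fixes x :: "quat^'n^'n" and \<delta> :: real
  assumes x: "x \<in> so_star B" and \<delta>: "0 < \<delta>"
    and inv: "\<And>A :: quat^'n^'n. norm A < \<delta> \<Longrightarrow> (mat 1 - A) ** resolvent A = mat 1 \<and> resolvent A ** (mat 1 - A)
      = mat 1"
    and deriv: "\<And>A :: quat^'n^'n. norm A < \<delta>
      \<Longrightarrow> (resolvent has_derivative (\<lambda>D. resolvent A ** D ** resolvent A)) (at A)"
begin

text \<open>The Cayley transform (1 + A)(1 - A)^(-1), written as an affine function of the resolvent
  so that its differences and derivative are those of the resolvent. It maps small elements of
  \<open>L\<close> into the group, with inverse \<open>cay (- A)\<close>.\<close>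

definition cay :: "quat^'n^'n \<Rightarrow> quat^'n^'n" where
  "cay A = 2 *\<^sub>R resolvent A - mat 1"

definition curve :: "quat^'n^'n \<Rightarrow> quat^'n^'n" where
  "curve A = cay A ** x ** cay (- A)"

text \<open>The linear map in \<open>D\<close> that turns A - A' exactly into
  \<open>curve A - curve A'\<close>. For A = A' it is the derivative of
  \<open>curve\<close>.\<close>

definition slope :: "quat^'n^'n \<Rightarrow> quat^'n^'n \<Rightarrow> quat^'n^'n \<Rightarrow> quat^'n^'n" where
  "slope A A' D = 2 *\<^sub>R (resolvent A ** D ** resolvent A' ** x ** cay (- A)
     - cay A' ** x ** resolvent (- A) ** D ** resolvent (- A'))"

text \<open>The derivative of \<open>cay\<close> at \<open>A\<close> along \<open>D\<close>,
  multiplied on the right by the inverse of \<open>cay A\<close>. It lies in \<open>L\<close> and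
  exhibits \<open>slope A A D\<close> as a tangent vector of the orbit.\<close>

definition direction :: "quat^'n^'n \<Rightarrow> quat^'n^'n \<Rightarrow> quat^'n^'n" where
  "direction A D = 2 *\<^sub>R (resolvent A ** D ** resolvent (- A))"

lemma cay_eq:
  assumes "norm A < \<delta>"
  shows "cay A = (mat 1 + A) ** resolvent A" "cay A = resolvent A ** (mat 1 + A)"
proof -
  have "resolvent A - A ** resolvent A = mat 1" "resolvent A - resolvent A ** A = mat 1"
    using inv[OF assms] by (simp_all add: qmat_distrib)
  then show "cay A = (mat 1 + A) ** resolvent A" "cay A = resolvent A ** (mat 1 + A)"
    unfolding cay_def by (simp_all add: qmat_distrib scaleR_2 algebra_simps)
qed

lemma inv_minus:
  fixes A :: "quat^'n^'n"
  assumes "norm A < \<delta>"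
  shows "(mat 1 + A) ** resolvent (- A) = mat 1" "resolvent (- A) ** (mat 1 + A) = mat 1"
  using inv[of "- A"] assms by auto

lemma resolvent_cay:
  assumes "norm A < \<delta>"
  shows "resolvent (- A) ** cay A = resolvent A" "cay A ** resolvent (- A) = resolvent A"
    "cay (- A) ** cay A = mat 1"
proof -
  show 1: "resolvent (- A) ** cay A = resolvent A"
    unfolding cay_eq(1)[OF assms] by (simp add: matrix_mul_assoc inv_minus[OF assms])
  show "cay A ** resolvent (- A) = resolvent A"
    unfolding cay_eq(2)[OF assms] by (simp add: matrix_mul_assoc[symmetric] inv_minus[OF assms])
  have "cay (- A) = (mat 1 - A) ** resolvent (- A)" using cay_eq(1)[of "- A"] assms by simp
  then show "cay (- A) ** cay A = mat 1" using inv[OF assms] by (simp add: matrix_mul_assoc[symmetric] 1)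
qed

lemma star_resolvent:
  assumes A: "A \<in> L" "norm A < \<delta>" shows "adjoint_star (resolvent A) = resolvent (- A)"
proof -
  have "adjoint_star (resolvent A) ** (mat 1 + A) = mat 1"
    using arg_cong[OF conjunct1[OF inv[OF A(2)]], of adjoint_star] A(1)
    by (simp add: star_mult star_linear L_iff)
  then have "adjoint_star (resolvent A) ** ((mat 1 + A) ** resolvent (- A)) = resolvent (- A)"
    by (simp add: matrix_mul_assoc)
  then show ?thesis by (simp add: inv_minus[OF A(2)])
qed

lemma star_cay: "A \<in> L \<Longrightarrow> norm A < \<delta> \<Longrightarrow> adjoint_star (cay A) = cay (- A)"
  by (simp add: cay_def star_linear star_resolvent)

lemma cay_in_SO:
  assumes A: "A \<in> L" "norm A < \<delta>" shows "cay A \<in> SO_star B"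
proof -
  have "cay A ** cay (- A) = mat 1" using resolvent_cay(3)[of "- A"] A by simp
  then show ?thesis
    unfolding SO_iff star_cay[OF A] using resolvent_cay(3)[OF A(2)] qmat_inv_unique(2) by blast
qed

lemma curve_in_orbit:
  assumes A: "A \<in> L" "norm A < \<delta>" shows "curve A \<in> adj_orbit (SO_star B) x"
  by (rule adj_orbit_memI[OF cay_in_SO[OF A]])
    (simp add: curve_def matrix_mul_assoc[symmetric] resolvent_cay[OF A(2)])

lemma direction_in_L:
  assumes A: "A \<in> L" "norm A < \<delta>" and D: "D \<in> L" shows "direction A D \<in> L"
proof -
  have "adjoint_star (resolvent (- A)) = resolvent A"
    using star_resolvent[of "- A"] subspace_neg[OF L_subspace A(1)] A(2) by simp
  then show ?thesis using D unfolding L_iff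
    by (simp add: direction_def star_linear star_mult star_resolvent[OF A] qmat_minus matrix_mul_assoc)
qed

lemma slope_eq_bracket:
  assumes "norm A < \<delta>" shows "slope A A D = lie_bracket (direction A D) (curve A)"
proof -
  have A': "norm (- A) < \<delta>" using assms by simp
  have "direction A D ** curve A = 2 *\<^sub>R (resolvent A ** D ** (resolvent (- A) ** cay A) ** x ** cay (- A))"
    by (simp only: direction_def curve_def qmat_scaleR matrix_mul_assoc)
  moreover have "curve A ** direction A D
    = 2 *\<^sub>R (cay A ** x ** (cay (- A) ** resolvent A) ** D ** resolvent (- A))"
    by (simp only: direction_def curve_def qmat_scaleR matrix_mul_assoc)
  ultimately show ?thesis using resolvent_cay(1)[OF assms] resolvent_cay(2)[OF A']
    by (simp add: lie_bracket_def slope_def scaleR_diff_right)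
qed

lemma curve_diff:
  assumes "norm A < \<delta>" "norm A' < \<delta>" shows "curve A - curve A' = slope A A' (A - A')"
proof -
  have res: "resolvent A - resolvent A' = resolvent A ** (A - A') ** resolvent A'"
    if "norm A < \<delta>" "norm A' < \<delta>" for A A' :: "quat^'n^'n"
  proof -
    have eq: "A - A' = (mat 1 - A') - (mat 1 - A)" by simp
    have "resolvent A ** (A - A') ** resolvent A'
      = resolvent A ** ((mat 1 - A') ** resolvent A') - (resolvent A ** (mat 1 - A)) ** resolvent A'"
      unfolding eq by (simp only: qmat_distrib matrix_mul_assoc)
    then show ?thesis by (simp add: inv[OF that(1)] inv[OF that(2)])
  qed
  have 1: "cay A - cay A' = 2 *\<^sub>R (resolvent A ** (A - A') ** resolvent A')"
    unfolding res[OF assms, symmetric] by (simp add: cay_def scaleR_diff_right)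
  have "resolvent (- A) - resolvent (- A') = resolvent (- A) ** (- (A - A')) ** resolvent (- A')"
    using res[of "- A" "- A'"] assms by simp
  then have 2: "cay (- A) - cay (- A') = - (2 *\<^sub>R (resolvent (- A) ** (A - A') ** resolvent (- A')))"
    unfolding cay_def qmat_minus by (simp add: scaleR_diff_right[symmetric])
  have "curve A - curve A' = (cay A - cay A') ** x ** cay (- A) + cay A' ** x ** (cay (- A) - cay (- A'))"
    by (simp add: curve_def qmat_distrib)
  also have "\<dots> = slope A A' (A - A')"
    unfolding 1 2 slope_def by (simp only: qmat_scaleR qmat_minus scaleR_diff_right matrix_mul_assoc) simp
  finally show ?thesis .
qed

lemma slope_linear: "linear (slope A A')"
  by (rule linearI)
    (simp_all add: slope_def qmat_distrib qmat_scaleR scaleR_add_right scaleR_diff_right mult.commute)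

lemma curve_deriv:
  assumes "norm A < \<delta>" shows "(curve has_derivative slope A A) (at A)"
proof -
  note bb = bounded_bilinear_quat_matrix_mult
  have c: "(cay has_derivative (\<lambda>D. 2 *\<^sub>R (resolvent A ** D ** resolvent A))) (at A)" if "norm A < \<delta>" for A
    unfolding cay_def by (auto intro!: derivative_eq_intros deriv[OF that])
  have "(cay has_derivative (\<lambda>D. 2 *\<^sub>R (resolvent (- A) ** D ** resolvent (- A)))) (at (- A))"
    using c[of "- A"] assms by simp
  then have c': "((\<lambda>A. cay (- A)) has_derivative (\<lambda>D. 2 *\<^sub>R (resolvent (- A) ** (- D) ** resolvent (- A))))
    (at A)"
    by (rule has_derivative_compose[rotated]) (auto intro!: derivative_eq_intros)
  show ?thesis unfolding curve_def
    by (rule has_derivative_eq_rhs[OF bounded_bilinear.FDERIV[OF bb bounded_bilinear.FDERIV[OF bb c[OF assms]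
      has_derivative_const] c']])
      (simp add: fun_eq_iff slope_def qmat_scaleR qmat_minus scaleR_diff_right matrix_mul_assoc qmat_distrib)
qed

lemma resolvent_continuous: "continuous_on (ball 0 \<delta>) (resolvent :: quat^'n^'n \<Rightarrow> _)"
  by (rule has_derivative_continuous_on[OF has_derivative_at_withinI[OF deriv]]) simp

lemma continuous_on_matrix_mult:
  "continuous_on S f \<Longrightarrow> continuous_on S g \<Longrightarrow> continuous_on S (\<lambda>s. (f s :: quat^'n^'n) ** (g s :: quat^'n^'n))"
  by (rule bounded_bilinear.continuous_on[OF bounded_bilinear_quat_matrix_mult])

lemma resolvent_continuous_compose:
  assumes "continuous_on S f" "\<And>s. s \<in> S \<Longrightarrow> norm (f s :: quat^'n^'n) < \<delta>"
  shows "continuous_on S (\<lambda>s. resolvent (f s))"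
  by (rule continuous_on_compose2[OF resolvent_continuous assms(1)]) (use assms(2) in auto)

lemma slope_continuous: "continuous_on (ball 0 \<delta> \<times> ball 0 \<delta>) (\<lambda>z. slope (fst z) (snd z) D)"
  unfolding slope_def cay_def
  by (intro continuous_intros continuous_on_matrix_mult resolvent_continuous_compose) auto

lemma curve_continuous: "continuous_on (ball 0 \<delta>) curve"
  unfolding curve_def cay_def
  by (intro continuous_intros continuous_on_matrix_mult resolvent_continuous_compose) auto

lemma direction_continuous: "continuous_on (ball 0 \<delta>) (\<lambda>A. direction A D)"
  unfolding direction_def
  by (intro continuous_intros continuous_on_matrix_mult resolvent_continuous_compose) auto

lemma at_0: "curve 0 = x" "slope 0 0 D = 2 *\<^sub>R lie_bracket D x"
proof -
  have r: "resolvent 0 = (mat 1 :: quat^'n^'n)" using inv[of 0] \<delta> by simp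
  then have "cay 0 = mat 1" by (simp add: cay_def scaleR_2)
  then show "curve 0 = x" "slope 0 0 D = 2 *\<^sub>R lie_bracket D x"
    by (simp_all add: curve_def slope_def r lie_bracket_def)
qed

end

section \<open>Dilations of the Liouville measure\<close>

lemma wedge_power_cong_scale:
  assumes "\<And>j k. j < 2*m \<Longrightarrow> k < 2*m \<Longrightarrow> \<omega>' (v' j) (v' k) = s * \<omega> (v j) (v k)"
  shows "wedge_power m \<omega>' v' = s ^ m * wedge_power m \<omega> v"
proof -
  have "(\<Prod>i<m. \<omega>' (v' (\<sigma> (2*i))) (v' (\<sigma> (2*i+1)))) = s ^ m * (\<Prod>i<m. \<omega> (v (\<sigma> (2*i))) (v (\<sigma> (2*i+1))))"
    if p: "\<sigma> permutes {..<2*m}" for \<sigma>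
  proof -
    have "(\<Prod>i<m. \<omega>' (v' (\<sigma> (2*i))) (v' (\<sigma> (2*i+1)))) = (\<Prod>i<m. s * \<omega> (v (\<sigma> (2*i))) (v (\<sigma> (2*i+1))))"
    proof (intro prod.cong refl assms)
      fix i assume "i \<in> {..<m}"
      then show "\<sigma> (2*i) < 2*m" "\<sigma> (2*i+1) < 2*m"
        using permutes_in_image[OF p, of "2*i"] permutes_in_image[OF p, of "2*i+1"] by simp_all
    qed
    then show ?thesis by (simp add: prod.distrib)
  qed
  then show ?thesis unfolding wedge_power_def
    by (simp add: sum_distrib_left mult_ac)
qed

text \<open>Local parametrizations of an orbit come without measurability, so that the library versions of the
  following facts do not apply to them.\<close>

lemma nn_integral_cmult_any:
  fixes k :: real
  assumes "k > 0" shows "(\<integral>\<^sup>+ x. ennreal k * f x \<partial>M) = ennreal k * (\<integral>\<^sup>+ x. f x \<partial>M)"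
proof -
  \<comment> \<open>Scaled simple minorants give this inequality without measurability of
    \<open>f\<close>; applied with 1 / k it gives the opposite one.\<close>
  have le: "ennreal k * (\<integral>\<^sup>+ x. f x \<partial>M) \<le> (\<integral>\<^sup>+ x. ennreal k * f x \<partial>M)" for k and f :: "'a \<Rightarrow> ennreal"
    unfolding nn_integral_def[of M f] SUP_mult_left_ennreal
  proof (rule SUP_least, clarify)
    fix g assume g: "simple_function M g" "g \<le> f"
    have "ennreal k * integral\<^sup>S M g = (\<integral>\<^sup>+ x. ennreal k * g x \<partial>M)"
      using g(1) by (simp add: nn_integral_cmult nn_integral_eq_simple_integral
        borel_measurable_simple_function)
    also have "\<dots> \<le> (\<integral>\<^sup>+ x. ennreal k * f x \<partial>M)"
      using g(2) by (intro nn_integral_mono mult_left_mono) (auto simp: le_fun_def)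
    finally show "ennreal k * integral\<^sup>S M g \<le> (\<integral>\<^sup>+ x. ennreal k * f x \<partial>M)" .
  qed
  have inv: "ennreal k * ennreal (1 / k) = 1" using assms by (simp add: ennreal_mult[symmetric])
  have "ennreal (1 / k) * (\<integral>\<^sup>+ x. ennreal k * f x \<partial>M) \<le> (\<integral>\<^sup>+ x. ennreal (1 / k) * (ennreal k * f x) \<partial>M)"
    by (rule le)
  also have "\<dots> = (\<integral>\<^sup>+ x. f x \<partial>M)" using inv by (simp add: mult.assoc[symmetric] mult.commute)
  finally have "ennreal k * (ennreal (1 / k) * (\<integral>\<^sup>+ x. ennreal k * f x \<partial>M)) \<le> ennreal k * (\<integral>\<^sup>+ x. f x \<partial>M)"
    by (rule mult_left_mono) simp
  then have "(\<integral>\<^sup>+ x. ennreal k * f x \<partial>M) \<le> ennreal k * (\<integral>\<^sup>+ x. f x \<partial>M)"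
    by (simp add: mult.assoc[symmetric] inv)
  with le show ?thesis by (simp add: antisym)
qed

lemma measure_space_cmult_vimage:
  assumes \<nu>: "measure_space \<Omega> M \<nu>" and T: "\<And>A. A \<in> M \<Longrightarrow> T -` A \<inter> \<Omega> \<in> M"
  shows "measure_space \<Omega> M (\<lambda>A. c * \<nu> (T -` A \<inter> \<Omega>))"
  unfolding measure_space_def
proof (intro conjI)
  show "sigma_algebra \<Omega> M" using \<nu> by (simp add: measure_space_def)
  show "positive M (\<lambda>A. c * \<nu> (T -` A \<inter> \<Omega>))" using \<nu> by (simp add: measure_space_def positive_def)
  show "countably_additive M (\<lambda>A. c * \<nu> (T -` A \<inter> \<Omega>))"
    unfolding countably_additive_def
  proof (intro allI impI)
    fix A :: "nat \<Rightarrow> 'a set" assume A: "range A \<subseteq> M" "disjoint_family A" "\<Union> (range A) \<in> M"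
    define C where "C i = T -` A i \<inter> \<Omega>" for i
    have U: "\<Union> (range C) = T -` \<Union> (range A) \<inter> \<Omega>" by (auto simp: C_def)
    have "range C \<subseteq> M" "\<Union> (range C) \<in> M" using A T unfolding U by (auto simp: C_def)
    moreover have "disjoint_family C" using A(2) by (auto simp: C_def disjoint_family_on_def)
    ultimately have "(\<Sum>i. \<nu> (C i)) = \<nu> (\<Union> (range C))"
      using \<nu> by (simp add: measure_space_def countably_additive_def)
    then show "(\<Sum>i. c * \<nu> (T -` A i \<inter> \<Omega>)) = c * \<nu> (T -` \<Union> (range A) \<inter> \<Omega>)"
      unfolding U C_def by simp
  qed
qed

text \<open>\<open>measure_of\<close> yields the zero measure for a set function that is not a
  measure. Hence it must be shown that both set functions are measures or neither is; the inverse
  \<open>T'\<close> carries additivity back.\<close>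

lemma emeasure_measure_of_cmult_vimage:
  assumes M: "sigma_algebra \<Omega> M" and k: "(k :: real) > 0" and A: "A \<in> M"
    and T: "\<And>A. A \<in> M \<Longrightarrow> T -` A \<inter> \<Omega> \<in> M" "\<And>A. A \<in> M \<Longrightarrow> T' -` A \<inter> \<Omega> \<in> M"
    and inverse: "\<And>z. z \<in> \<Omega> \<Longrightarrow> T z \<in> \<Omega>" "\<And>z. z \<in> \<Omega> \<Longrightarrow> T' (T z) = z"
    and \<nu>': "\<And>A. A \<in> M \<Longrightarrow> \<nu>' A = ennreal k * \<nu> (T -` A \<inter> \<Omega>)"
  shows "emeasure (measure_of \<Omega> M \<nu>') A = ennreal k * emeasure (measure_of \<Omega> M \<nu>) (T -` A \<inter> \<Omega>)"
proof -
  interpret sigma_algebra \<Omega> M by fact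
  have inv: "ennreal (1 / k) * ennreal k = 1" using k by (simp add: ennreal_mult[symmetric])
  have cong: "measure_space \<Omega> M \<mu> = measure_space \<Omega> M \<mu>'" if "\<And>A. A \<in> M \<Longrightarrow> \<mu> A = \<mu>' A" for \<mu> \<mu>'
    using measure_space_eq[OF space_closed, of \<mu> \<mu>'] that by (simp add: sigma_sets_eq)
  have 1: "measure_space \<Omega> M \<nu>'" if "measure_space \<Omega> M \<nu>"
  proof -
    have "measure_space \<Omega> M \<nu>' = measure_space \<Omega> M (\<lambda>A. ennreal k * \<nu> (T -` A \<inter> \<Omega>))"
      by (rule cong) (rule \<nu>')
    with measure_space_cmult_vimage[OF that T(1)] show ?thesis by blast
  qed
  have 2: "measure_space \<Omega> M \<nu>" if "measure_space \<Omega> M \<nu>'"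
  proof -
    have "\<nu> A = ennreal (1 / k) * \<nu>' (T' -` A \<inter> \<Omega>)" if A: "A \<in> M" for A
    proof -
      have "T -` (T' -` A \<inter> \<Omega>) \<inter> \<Omega> = A" using inverse sets_into_space[OF A] by auto
      then show ?thesis using \<nu>'[OF T(2)[OF A]] by (simp add: mult.assoc[symmetric] inv)
    qed
    then have "measure_space \<Omega> M \<nu> = measure_space \<Omega> M (\<lambda>A. ennreal (1 / k) * \<nu>' (T' -` A \<inter> \<Omega>))"
      by (rule cong)
    with measure_space_cmult_vimage[OF that T(2)] show ?thesis by blast
  qed
  show ?thesis
  proof (cases "measure_space \<Omega> M \<nu>")
    case True
    then show ?thesis using 1 A T(1)[OF A] by (simp add: emeasure_measure_of_conv sigma_sets_eq \<nu>')
  next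
    case False
    then have "\<not> measure_space \<Omega> M \<nu>'" using 2 by blast
    with False show ?thesis by (simp add: emeasure_measure_of_conv sigma_sets_eq)
  qed
qed

lemma emeasure_distr_density_scale:
  fixes c :: "'a \<Rightarrow> 'b::real_normed_vector"
  assumes k: "k > 0" and s: "s \<noteq> 0" and f': "\<And>u. u \<in> space R \<Longrightarrow> f' u = ennreal k * f u" and A: "A \<in> sets borel"
  shows "emeasure (distr (density R f') borel (\<lambda>u. s *\<^sub>R c u)) A
    = ennreal k * emeasure (distr (density R f) borel c) ((\<lambda>y. s *\<^sub>R y) -` A)"
proof -
  have density: "emeasure (density R f') C = ennreal k * emeasure (density R f) C" for C
  proof (cases "C \<in> sets R")
    case True
    have "emeasure (density R f') C = ennreal k * emeasure (density R f) (id -` C \<inter> space R)"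
      unfolding density_def
    proof (rule emeasure_measure_of_cmult_vimage[OF _ k True, where T' = id])
      fix A assume A: "A \<in> sets R"
      have "(\<integral>\<^sup>+ x. f' x * indicator A x \<partial>R) = (\<integral>\<^sup>+ x. ennreal k * (f x * indicator A x) \<partial>R)"
        by (intro nn_integral_cong) (simp add: f' mult.assoc)
      also have "\<dots> = ennreal k * (\<integral>\<^sup>+ x. f x * indicator A x \<partial>R)" by (rule nn_integral_cmult_any[OF k])
      finally show "(\<integral>\<^sup>+ x. f' x * indicator A x \<partial>R)
        = ennreal k * (\<integral>\<^sup>+ x. f x * indicator (id -` A \<inter> space R) x \<partial>R)"
        using sets.sets_into_space[OF A] by (simp add: Int_absorb2)
    qed (auto simp: sets.sigma_algebra_axioms)
    then show ?thesis using sets.sets_into_space[OF True] by (simp add: Int_absorb2)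
  qed (simp add: emeasure_notin_sets)
  have "emeasure (distr (density R f') borel (\<lambda>u. s *\<^sub>R c u)) A
    = ennreal k * emeasure (distr (density R f) borel c) ((\<lambda>y. s *\<^sub>R y) -` A \<inter> space borel)"
    unfolding distr_def
  proof (rule emeasure_measure_of_cmult_vimage[OF _ k A, where T' = "\<lambda>y. (1 / s) *\<^sub>R y"])
    show "(\<lambda>y. t *\<^sub>R y) -` A \<inter> space borel \<in> sets borel" if "A \<in> sets borel" for A :: "'b set" and t
      by (rule measurable_sets[OF borel_measurable_continuous_onI that]) (intro continuous_intros)
    then show "(\<lambda>y. (1 / s) *\<^sub>R y) -` A \<inter> space borel \<in> sets borel" if "A \<in> sets borel" for A :: "'b set"
      using that by blast
    fix A :: "'b set" assume "A \<in> sets borel"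
    have "(\<lambda>u. s *\<^sub>R c u) -` A = c -` ((\<lambda>y. s *\<^sub>R y) -` A)" by auto
    then show "emeasure (density R f') ((\<lambda>u. s *\<^sub>R c u) -` A \<inter> space (density R f'))
      = ennreal k * emeasure (density R f) (c -` ((\<lambda>y. s *\<^sub>R y) -` A \<inter> space borel) \<inter> space (density R f))"
      by (simp add: density)
  next
    show "sigma_algebra (space borel) (sets (borel :: 'b measure))" by (rule sets.sigma_algebra_axioms)
  qed (use s in auto)
  then show ?thesis by simp
qed

section \<open>Measures of charts and their behaviour under dilations\<close>

definition chart_measure ::
    "(quat^'n^'n) set \<Rightarrow> (quat^'n^'n) set \<Rightarrow> (nat \<Rightarrow> real) set \<times> ((nat \<Rightarrow> real) \<Rightarrow> quat^'n^'n) \<times>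
     (nat \<Rightarrow> (nat \<Rightarrow> real) \<Rightarrow> quat^'n^'n) \<Rightarrow> (quat^'n^'n) measure" where
  "chart_measure L Orb = (\<lambda>(U, c, c').
     distr (density (restrict_space (PiM {..<orbit_dim L Orb} (\<lambda>_. lborel)) U)
       (\<lambda>u. ennreal \<bar>wedge_power (orbit_dim L Orb div 2) (orbit_symplectic L (c u)) (\<lambda>i. c' i u)\<bar>)) borel c)"

lemma liouville_measure_eq:
  "liouville_measure L Orb = (SUP p \<in> {(U, c, c'). orbit_param L Orb U c c'}. chart_measure L Orb p)"
  unfolding liouville_measure_def chart_measure_def Let_def case_prod_unfold by simp

lemma sets_chart_measure: "sets (chart_measure L Orb p) = sets borel"
  by (simp add: chart_measure_def case_prod_unfold)

lemma chart_measure_le_liouville: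
  assumes "orbit_param L Orb U c c'"
  shows "chart_measure L Orb (U, c, c') \<le> liouville_measure L Orb"
    "sets (liouville_measure L Orb) = sets borel"
proof -
  have p: "(U, c, c') \<in> {(U, c, c'). orbit_param L Orb U c c'}" using assms by simp
  show "chart_measure L Orb (U, c, c') \<le> liouville_measure L Orb"
    unfolding liouville_measure_eq by (rule SUP_upper[OF p])
  show "sets (liouville_measure L Orb) = sets borel"
    unfolding liouville_measure_eq by (rule sets_SUP) (use p in \<open>auto simp: sets_chart_measure\<close>)
qed

context quaternionic_skew_form begin

text \<open>The elements representing s u at s y are exactly those representing u at y, so the
  choices on both sides agree and a single factor \<open>s\<close> remains from the first argument
  of the Killing form.\<close>

lemma orbit_symplectic_scaleR:
  assumes y: "y \<in> L" and s: "s \<noteq> 0" and u: "u \<in> orbit_tangent L y" and v: "v \<in> orbit_tangent L y"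
  shows "orbit_symplectic L (s *\<^sub>R y) (s *\<^sub>R u) (s *\<^sub>R v) = s * orbit_symplectic L y u v"
proof -
  define X Y where "X = (SOME X. X \<in> L \<and> lie_bracket X y = u)" and "Y = (SOME Y. Y \<in> L \<and> lie_bracket Y y = v)"
  have "X \<in> L" "Y \<in> L"
    using u v someI_ex[of "\<lambda>X. X \<in> L \<and> lie_bracket X y = u"] someI_ex[of "\<lambda>X. X \<in> L \<and> lie_bracket X y = v"]
    unfolding X_def Y_def orbit_tangent_def by auto
  moreover have "lie_bracket Z (s *\<^sub>R y) = s *\<^sub>R w \<longleftrightarrow> lie_bracket Z y = w" for Z w
    using s by (simp add: lie_bracket_linear)
  ultimately show ?thesis
    using killing_form_scaleR[OF y L_bracket, of X Y s]
    by (simp add: orbit_symplectic_def Let_def X_def[symmetric] Y_def[symmetric])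
qed

lemma orbit_tangent_scaleR: "orbit_tangent L (s *\<^sub>R y) = (\<lambda>z. s *\<^sub>R z) ` orbit_tangent L y"
  by (auto simp: orbit_tangent_def lie_bracket_linear)

lemma orbit_param_scaleR:
  assumes p: "orbit_param L Orb U c c'" and s: "s \<noteq> 0" and Orb: "\<And>y. y \<in> Orb \<Longrightarrow> s *\<^sub>R y \<in> Orb"
  shows "orbit_param L Orb U (\<lambda>u. s *\<^sub>R c u) (\<lambda>i u. s *\<^sub>R c' i u)"
proof -
  define d where "d = orbit_dim L Orb"
  note p = p[unfolded orbit_param_def Let_def, folded d_def]
  have "span ((\<lambda>i. s *\<^sub>R c' i u) ` {..<d}) = orbit_tangent L (s *\<^sub>R c u)" if "u \<in> U" for u
  proof -
    have lin: "linear (\<lambda>z::quat^'n^'n. s *\<^sub>R z)" by (rule linearI) (auto simp: scaleR_add_right)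
    have "span ((\<lambda>i. s *\<^sub>R c' i u) ` {..<d}) = span ((\<lambda>z. s *\<^sub>R z) ` (\<lambda>i. c' i u) ` {..<d})"
      by (simp add: image_image)
    also have "\<dots> = (\<lambda>z. s *\<^sub>R z) ` span ((\<lambda>i. c' i u) ` {..<d})" by (rule linear_span_image[OF lin])
    also have "\<dots> = orbit_tangent L (s *\<^sub>R c u)" using p that by (simp add: orbit_tangent_scaleR)
    finally show ?thesis .
  qed
  moreover have "inj_on (\<lambda>u. s *\<^sub>R c u) U" using p s by (auto simp: inj_on_def)
  moreover have "((\<lambda>t. s *\<^sub>R c (u(i := t))) has_vector_derivative s *\<^sub>R c' i u) (at (u i))" if "i < d" "u \<in> U"
    for i u
    using p that bounded_linear.has_vector_derivative[OF bounded_linear_scaleR_right] by blast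
  moreover have "continuous_map (subtopology (product_topology (\<lambda>_. euclideanreal) {..<d}) U) euclidean (\<lambda>u. s
    *\<^sub>R c' i u)"
    if "i < d" for i
  proof -
    have "continuous_map euclidean euclidean (\<lambda>z::quat^'n^'n. s *\<^sub>R z)" by (simp add: continuous_intros)
    then show ?thesis using p that continuous_map_compose[of _ euclidean "c' i" euclidean "\<lambda>z. s *\<^sub>R z"]
      by (simp add: o_def)
  qed
  ultimately show ?thesis
    unfolding orbit_param_def Let_def d_def[symmetric] using p Orb by auto
qed

text \<open>The symplectic form scales by \<open>s\<close>, hence its exterior power of order d / 2
  by s^(d / 2). The tangent vectors are dilated with the chart, so no Jacobian appears.\<close>

lemma chart_measure_scaleR:
  assumes p: "orbit_param L Orb U c c'" and s: "s \<noteq> 0" and Orb: "Orb \<subseteq> L" and A: "A \<in> sets borel"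
  shows "emeasure (chart_measure L Orb (U, \<lambda>u. s *\<^sub>R c u, \<lambda>i u. s *\<^sub>R c' i u)) A
    = ennreal (\<bar>s\<bar> ^ (orbit_dim L Orb div 2)) * emeasure (chart_measure L Orb (U, c, c')) ((\<lambda>y. s *\<^sub>R y) -`
      A)"
  unfolding chart_measure_def prod.case
proof (rule emeasure_distr_density_scale[OF _ s _ A])
  define d where "d = orbit_dim L Orb"
  note p = p[unfolded orbit_param_def Let_def, folded d_def]
  show "0 < \<bar>s\<bar> ^ (orbit_dim L Orb div 2)" using s by simp
  fix u assume "u \<in> space (restrict_space (PiM {..<orbit_dim L Orb} (\<lambda>_. lborel)) U)"
  then have u: "u \<in> U" by (simp add: space_restrict_space)
  have "wedge_power (d div 2) (orbit_symplectic L (s *\<^sub>R c u)) (\<lambda>i. s *\<^sub>R c' i u)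
    = s ^ (d div 2) * wedge_power (d div 2) (orbit_symplectic L (c u)) (\<lambda>i. c' i u)"
  proof (rule wedge_power_cong_scale)
    fix j k assume "j < 2 * (d div 2)" "k < 2 * (d div 2)"
    then have "j < d" "k < d" by auto
    then have "c' j u \<in> span ((\<lambda>i. c' i u) ` {..<d})" "c' k u \<in> span ((\<lambda>i. c' i u) ` {..<d})"
      by (auto intro!: span_base)
    moreover have "span ((\<lambda>i. c' i u) ` {..<d}) = orbit_tangent L (c u)" "c u \<in> L" using p u Orb by auto
    ultimately show "orbit_symplectic L (s *\<^sub>R c u) (s *\<^sub>R c' j u) (s *\<^sub>R c' k u)
      = s * orbit_symplectic L (c u) (c' j u) (c' k u)"
      using s orbit_symplectic_scaleR[of "c u" s "c' j u" "c' k u"] by simp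
  qed
  then show "ennreal \<bar>wedge_power (orbit_dim L Orb div 2) (orbit_symplectic L (s *\<^sub>R c u)) (\<lambda>i. s *\<^sub>R c' i u)\<bar>
    =
     ennreal (\<bar>s\<bar> ^ (orbit_dim L Orb div 2)) * ennreal \<bar>wedge_power (orbit_dim L Orb div 2) (orbit_symplectic
       L (c u)) (\<lambda>i. c' i u)\<bar>"
    by (simp add: d_def[symmetric] abs_mult power_abs ennreal_mult)
qed

text \<open>The dilation of any chart is a chart, so its measure lies below the supremum;
  transported back, this bounds every member of the supremum. The chart given by \<open>p0\<close>
  ensures that the supremum is taken over a nonempty set and has the Borel sets.\<close>

lemma liouville_measure_scaleR_le:
  assumes s: "s \<noteq> 0" and Orb: "Orb \<subseteq> L" "\<And>y. y \<in> Orb \<Longrightarrow> s *\<^sub>R y \<in> Orb" and p0: "orbit_param L Orb U0 c0 c0'"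
  shows "liouville_measure L Orb \<le> scale_measure (ennreal (1 / \<bar>s\<bar> ^ (orbit_dim L Orb div 2)))
    (distr (liouville_measure L Orb) borel (\<lambda>y. (1 / s) *\<^sub>R y))" (is "?\<mu> \<le> ?N")
proof -
  note sets_\<mu> = chart_measure_le_liouville(2)[OF p0]
  define k where "k = \<bar>s\<bar> ^ (orbit_dim L Orb div 2)"
  have k: "k > 0" using s by (simp add: k_def)
  have inv: "ennreal (1 / k) * ennreal k = 1" using k by (simp add: ennreal_mult[symmetric])
  have "chart_measure L Orb (U, c, c') \<le> ?N" if p: "orbit_param L Orb U c c'" for U c c'
  proof -
    have le: "emeasure (chart_measure L Orb (U, c, c')) A \<le> emeasure ?N A" if A: "A \<in> sets borel" for A
    proof -
      let ?p' = "(U, \<lambda>u. s *\<^sub>R c u, \<lambda>i u. s *\<^sub>R c' i u)"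
      define C where "C = (\<lambda>y. (1 / s) *\<^sub>R y) -` A"
      have meas: "(\<lambda>y::quat^'n^'n. (1 / s) *\<^sub>R y) \<in> borel_measurable borel"
        by (intro borel_measurable_continuous_onI continuous_intros)
      have C: "C \<in> sets borel" using measurable_sets[OF meas A] by (simp add: C_def)
      have "(\<lambda>y. s *\<^sub>R y) -` C = A" using s by (auto simp: C_def)
      then have "ennreal k * emeasure (chart_measure L Orb (U, c, c')) A
        = emeasure (chart_measure L Orb ?p') C"
        using chart_measure_scaleR[OF p s Orb(1) C] by (simp add: k_def)
      also have "\<dots> \<le> emeasure ?\<mu> C"
        using chart_measure_le_liouville(1)[OF orbit_param_scaleR[OF p s Orb(2)]]
        by (rule le_measureD3) (assumption, rule trans[OF sets_chart_measure sets_\<mu>[symmetric]])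
      finally have "ennreal (1 / k) * (ennreal k * emeasure (chart_measure L Orb (U, c, c')) A)
        \<le> ennreal (1 / k) * emeasure ?\<mu> C"
        by (rule mult_left_mono) simp
      moreover have "emeasure (distr ?\<mu> borel (\<lambda>y. (1 / s) *\<^sub>R y)) A = emeasure ?\<mu> C"
        by (subst emeasure_distr) (use A meas sets_eq_imp_space_eq[OF sets_\<mu>] in
          \<open>auto simp: C_def measurable_cong_sets[OF sets_\<mu> refl]\<close>)
      ultimately show ?thesis unfolding k_def[symmetric] by (simp add: mult.assoc[symmetric] inv)
    qed
    have "emeasure (chart_measure L Orb (U, c, c')) A \<le> emeasure ?N A" for A
      using le[of A] by (cases "A \<in> sets borel") (simp_all add: emeasure_notin_sets sets_chart_measure)
    then show ?thesis
      by (simp add: le_measure_iff le_fun_def sets_chart_measure sets_eq_imp_space_eq[OF sets_chart_measure]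
        space_scale_measure)
  qed
  then show ?thesis unfolding liouville_measure_eq[of L Orb] by (intro SUP_least) auto
qed

lemma not_admits_gibbs_state:
  assumes Orb: "Orb \<subseteq> L" "\<And>y. y \<in> Orb \<Longrightarrow> 4 *\<^sub>R y \<in> Orb" "\<And>y. y \<in> Orb \<Longrightarrow> - y \<in> Orb"
    and d: "2 \<le> orbit_dim L Orb" and p0: "orbit_param L Orb U0 c0 c0'"
    and pos: "emeasure (chart_measure L Orb (U0, c0, c0')) UNIV > 0"
  shows "\<not> admits_gibbs_state L Orb"
proof
  assume "admits_gibbs_state L Orb"
  then obtain \<beta> where \<beta>: "linear \<beta>" "partition_function L Orb \<beta> < \<infinity>" by (auto simp: admits_gibbs_state_def)
  define \<mu> where "\<mu> = liouville_measure L Orb"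
  have sets_\<mu>: "sets \<mu> = sets borel" unfolding \<mu>_def by (rule chart_measure_le_liouville(2)[OF p0])
  have "continuous_on UNIV \<beta>" using \<beta>(1) by (simp add: linear_continuous_on linear_conv_bounded_linear)
  then have [measurable]: "\<beta> \<in> borel_measurable borel" by (rule borel_measurable_continuous_onI)
  have meas: "f \<in> borel_measurable \<mu> \<longleftrightarrow> f \<in> borel_measurable borel" for f :: "_ \<Rightarrow> ennreal"
    by (simp add: measurable_cong_sets[OF sets_\<mu> refl])
  \<comment> \<open>For s = -1 the scaling factor is 1.\<close>
  have "\<mu> \<le> distr \<mu> borel uminus"
  proof -
    have "(\<lambda>y::quat^'n^'n. (1 / (-1)) *\<^sub>R y) = uminus" by auto
    then show ?thesis using liouville_measure_scaleR_le[of "-1", OF _ Orb(1) _ p0] Orb(3) by (simp add: \<mu>_def)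
  qed
  then have "(\<integral>\<^sup>+ y. ennreal (exp (\<beta> y)) \<partial>\<mu>) \<le> (\<integral>\<^sup>+ y. ennreal (exp (\<beta> y)) \<partial>distr \<mu> borel uminus)"
    by (intro nn_integral_mono_measure) (simp add: sets_\<mu>)
  also have "\<dots> = (\<integral>\<^sup>+ y. ennreal (exp (\<beta> (- y))) \<partial>\<mu>)"
    by (rule nn_integral_distr) (simp_all add: measurable_cong_sets[OF sets_\<mu> refl])
  also have "\<dots> = partition_function L Orb \<beta>"
    unfolding partition_function_def \<mu>_def by (simp add: linear_neg[OF \<beta>(1)])
  finally have "(\<integral>\<^sup>+ y. ennreal (exp (\<beta> y)) \<partial>\<mu>) < \<infinity>" using \<beta>(2) by simp
  moreover have "(\<integral>\<^sup>+ y. ennreal (exp (- \<beta> y)) \<partial>\<mu>) < \<infinity>" using \<beta>(2) by (simp add: partition_function_def \<mu>_def)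
  moreover have "emeasure \<mu> UNIV \<le> (\<integral>\<^sup>+ y. ennreal (exp (\<beta> y)) \<partial>\<mu>) + (\<integral>\<^sup>+ y. ennreal (exp (- \<beta> y)) \<partial>\<mu>)"
  proof -
    have "1 \<le> exp t + exp (- t)" for t :: real
      using exp_ge_add_one_self[of t] exp_ge_add_one_self[of "- t"] by linarith
    then have "(\<integral>\<^sup>+ y. 1 \<partial>\<mu>) \<le> (\<integral>\<^sup>+ y. ennreal (exp (\<beta> y)) + ennreal (exp (- \<beta> y)) \<partial>\<mu>)"
      by (intro nn_integral_mono) (simp add: ennreal_plus[symmetric] del: ennreal_plus)
    also have "\<dots> = (\<integral>\<^sup>+ y. ennreal (exp (\<beta> y)) \<partial>\<mu>) + (\<integral>\<^sup>+ y. ennreal (exp (- \<beta> y)) \<partial>\<mu>)"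
      by (rule nn_integral_add) (simp_all add: meas)
    finally show ?thesis using sets_eq_imp_space_eq[OF sets_\<mu>] by simp
  qed
  ultimately have fin: "emeasure \<mu> UNIV < \<infinity>"
    by (metis ennreal_add_less_top infinity_ennreal_def le_less_trans)
  \<comment> \<open>Dilation by 4 bounds the volume by itself divided by 4^(d / 2), a proper
    contraction because d \<ge> 2.\<close>
  define k :: real where "k = 1 / 4 ^ (orbit_dim L Orb div 2)"
  have "\<mu> \<le> scale_measure (ennreal k) (distr \<mu> borel (\<lambda>y. (1 / 4) *\<^sub>R y))"
    using liouville_measure_scaleR_le[of 4, OF _ Orb(1,2) p0] by (simp add: \<mu>_def k_def)
  then have "emeasure \<mu> UNIV \<le> ennreal k * emeasure (distr \<mu> borel (\<lambda>y. (1 / 4) *\<^sub>R y)) UNIV"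
    using le_measureD3 sets_\<mu> by fastforce
  also have "(\<lambda>y::quat^'n^'n. (1 / 4) *\<^sub>R y) \<in> measurable \<mu> borel"
    unfolding measurable_cong_sets[OF sets_\<mu> refl]
      by (intro borel_measurable_continuous_onI continuous_intros)
  then have "emeasure (distr \<mu> borel (\<lambda>y. (1 / 4) *\<^sub>R y)) UNIV = emeasure \<mu> UNIV"
    using sets_eq_imp_space_eq[OF sets_\<mu>] by (simp add: emeasure_distr)
  finally have le: "emeasure \<mu> UNIV \<le> ennreal k * emeasure \<mu> UNIV" .
  have "(1::real) < 4 ^ (orbit_dim L Orb div 2)" using d by (intro one_less_power) auto
  then have k: "0 \<le> k" "k < 1" by (auto simp: k_def)
  obtain V where V: "emeasure \<mu> UNIV = ennreal V" "V \<ge> 0" using fin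
    by (metis enn2real_nonneg ennreal_enn2real infinity_ennreal_def)
  have "V \<le> k * V" using le V k by (simp add: ennreal_mult[symmetric])
  then have "V \<le> 0" using k by (simp add: mult_le_cancel_right1)
  then have "emeasure \<mu> UNIV = 0" using V by simp
  moreover have "emeasure (chart_measure L Orb (U0, c0, c0')) UNIV \<le> emeasure \<mu> UNIV"
    unfolding \<mu>_def using chart_measure_le_liouville[OF p0]
      by (intro le_measureD3) (simp_all add: sets_chart_measure)
  ultimately show False using pos by simp
qed

end

section \<open>The volume of an orbit\<close>

context cayley_chart begin

lemma eventually_near_0:
  assumes "continuous_on (ball 0 \<delta>) (f :: quat^'n^'n \<Rightarrow> real)" "0 < f 0"
  obtains \<eta> where "\<eta> > 0" "\<And>A. norm A < \<eta> \<Longrightarrow> 0 < f A"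
proof -
  have "isCont f 0" using assms(1) \<delta> by (simp add: continuous_on_eq_continuous_at)
  then have "(f \<longlongrightarrow> f 0) (nhds 0)" by (simp add: continuous_within tendsto_at_iff_tendsto_nhds)
  then have "\<forall>\<^sub>F A in nhds 0. 0 < f A" using assms(2) by (rule order_tendstoD(1))
  then show thesis using that unfolding eventually_nhds_metric by (auto simp: dist_norm)
qed

text \<open>Two base points are allowed because distinct ones yield injectivity of the chart, while
  equal ones yield independence of its partial derivatives.\<close>

lemma slopes_independent_near_0:
  assumes "independent_family d (\<lambda>i. slope 0 0 (X i))"
  obtains \<eta> where "\<eta> > 0" "\<And>A A'. norm A < \<eta> \<Longrightarrow> norm A' < \<eta> \<Longrightarrow> independent_family d (\<lambda>i. slope A A' (X i))"
proof -
  obtain \<epsilon> where \<epsilon>: "\<epsilon> > 0"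
    "\<And>w. (\<And>i. i < d \<Longrightarrow> norm (w i - slope 0 0 (X i)) < \<epsilon>) \<Longrightarrow> independent_family d w"
    using independent_family_open[OF assms] by blast
  have "\<forall>\<^sub>F z in nhds (0, 0). norm (slope (fst z) (snd z) (X i) - slope 0 0 (X i)) < \<epsilon>" for i
  proof -
    have "isCont (\<lambda>z. slope (fst z) (snd z) (X i)) (0, 0)"
      using slope_continuous[of "X i"] \<delta> by (simp add: continuous_on_eq_continuous_at open_Times)
    then have "((\<lambda>z. slope (fst z) (snd z) (X i)) \<longlongrightarrow> slope 0 0 (X i)) (nhds (0, 0))"
      using tendsto_at_iff_tendsto_nhds[of "\<lambda>z. slope (fst z) (snd z) (X i)" "(0, 0)"]
        by (simp add: continuous_within)
    then show ?thesis using \<epsilon>(1) by (auto simp: tendsto_iff dist_norm)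
  qed
  then have "\<forall>\<^sub>F z in nhds (0, 0). \<forall>i\<in>{..<d}. norm (slope (fst z) (snd z) (X i) - slope 0 0 (X i)) < \<epsilon>"
    by (intro eventually_ball_finite) auto
  then obtain \<eta> where \<eta>: "\<eta> > 0"
    "\<And>z. dist z (0, 0) < \<eta> \<Longrightarrow> \<forall>i\<in>{..<d}. norm (slope (fst z) (snd z) (X i) - slope 0 0 (X i)) < \<epsilon>"
    unfolding eventually_nhds_metric by blast
  show thesis
  proof (rule that[of "\<eta> / 2"])
    show "\<eta> / 2 > 0" using \<eta> by simp
    fix A A' :: "quat^'n^'n" assume "norm A < \<eta> / 2" "norm A' < \<eta> / 2"
    then have "norm ((A, A') - (0, 0)) < \<eta>" using norm_Pair_le[of A A'] by simp
    then have "\<forall>i\<in>{..<d}. norm (slope A A' (X i) - slope 0 0 (X i)) < \<epsilon>"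
      using \<eta>(2)[of "(A, A')"] by (simp add: dist_norm)
    then show "independent_family d (\<lambda>i. slope A A' (X i))" by (intro \<epsilon>(2)) simp
  qed
qed

text \<open>The chart is \<open>curve\<close> on a small cube in the span of elements of
  \<open>L\<close> whose brackets with \<open>x\<close> form a Darboux basis. At the centre the
  density is positive by the choice of the basis, and nearby by continuity.\<close>

lemma exists_positive_chart:
  assumes n: "CARD('n) \<noteq> 1"
  defines "Orb \<equiv> adj_orbit (SO_star B) x"
  shows "\<exists>U c c'. orbit_param L Orb U c c' \<and> emeasure (chart_measure L Orb (U, c, c')) UNIV > 0"
proof -
  obtain m Y where Y: "\<forall>i<2*m. Y i \<in> L"
    "\<forall>i<2*m. \<forall>j<2*m.
       orbit_symplectic L x (lie_bracket (Y i) x) (lie_bracket (Y j) x) = std_symplectic i j"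
    "independent_family (2*m) (\<lambda>i. lie_bracket (Y i) x)" "dim (orbit_tangent L x) = 2*m"
    using orbit_symplectic_darboux[OF x n] by (elim exE conjE)
  define d where "d = 2 * m"
  \<comment> \<open>The Cayley transform has derivative 2 at 0; halving makes the slopes at 0 equal
    to the Darboux basis.\<close>
  define X where "X i = (1/2) *\<^sub>R Y i" for i
  have XL: "X i \<in> L" if "i < d" for i
    using Y(1) that subspace_scale[OF L_subspace] by (simp add: X_def d_def)
  have slope0: "slope 0 0 (X i) = lie_bracket (Y i) x" for i by (simp add: at_0 X_def lie_bracket_linear)
  have dim: "orbit_dim L Orb = d" unfolding Orb_def orbit_dim_eq d_def by (rule Y(4))
  have "independent_family d (\<lambda>i. slope 0 0 (X i))" unfolding slope0 d_def by (rule Y(3))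
  then obtain \<eta>1 where \<eta>1: "\<eta>1 > 0"
    "\<And>A A'. norm A < \<eta>1 \<Longrightarrow> norm A' < \<eta>1 \<Longrightarrow> independent_family d (\<lambda>i. slope A A' (X i))"
    by (rule slopes_independent_near_0) blast
  \<comment> \<open>The Gram matrix of the symplectic form in the partial derivatives of the chart,
    expressed without arbitrary choices so that continuity in \<open>A\<close> is visible.\<close>
  define gram where "gram A i j = - (4 * (real CARD('n) - 1)) * re_trace (slope A A (X i) ** direction A (X
    j))" for A i j
  define \<rho> where "\<rho> A = wedge_power m (gram A) (\<lambda>i. i)" for A
  have gram: "orbit_symplectic L (curve A) (slope A A (X i)) (slope A A (X j)) = gram A i j"
    if A: "A \<in> L" "norm A < \<delta>" and ij: "i < d" "j < d" for A i j
    unfolding slope_eq_bracket[OF A(2)] gram_def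
    using orbit_subset_L[OF x curve_in_orbit[OF A]] direction_in_L[OF A XL[OF ij(1)]] direction_in_L[OF A
      XL[OF ij(2)]]
    by (rule orbit_symplectic_eq)
  \<comment> \<open>The scaling rule with factor 1 acts as a congruence rule for indices below 2
    m.\<close>
  have \<rho>: "wedge_power m (orbit_symplectic L (curve A)) (\<lambda>i. slope A A (X i)) = \<rho> A"
    if A: "A \<in> L" "norm A < \<delta>" for A
    unfolding \<rho>_def
    using wedge_power_cong_scale[of m "orbit_symplectic L (curve A)" "\<lambda>i. slope A A (X i)" 1 "gram A" "\<lambda>i. i"]
      gram[OF A]
    by (simp add: d_def)
  have "continuous_on (ball 0 \<delta>) (\<lambda>A. gram A i j)" for i j
  proof -
    have "bounded_linear (re_trace :: quat^'n^'n \<Rightarrow> real)"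
      unfolding linear_conv_bounded_linear[symmetric] by (rule linearI) (simp_all add: re_trace_simps)
    then have re: "continuous_on UNIV (re_trace :: quat^'n^'n \<Rightarrow> real)" by (rule linear_continuous_on)
    have "continuous_on (ball 0 \<delta>) (\<lambda>A. slope A A (X i))"
      by (rule continuous_on_compose2[OF slope_continuous, of _ "\<lambda>A. (A, A)", simplified]) (auto intro!:
        continuous_intros)
    then show ?thesis unfolding gram_def
      by (intro continuous_intros continuous_on_compose2[OF re] continuous_on_matrix_mult
        direction_continuous) auto
  qed
  then have \<rho>_cont: "continuous_on (ball 0 \<delta>) \<rho>"
    unfolding \<rho>_def by (intro continuous_on_wedge_power)
  have "0 < \<rho> 0" unfolding \<rho>_def
  proof (rule wedge_power_standard_pos)
    fix i j assume "i < 2*m" "j < 2*m"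
    then show "gram 0 i j = std_symplectic i j"
      using gram[of 0 i j] Y(2) \<delta> subspace_0[OF L_subspace] by (simp add: at_0(1) slope0 d_def)
  qed
  then obtain \<eta>2 where \<eta>2: "\<eta>2 > 0" "\<And>A. norm A < \<eta>2 \<Longrightarrow> 0 < \<rho> A"
    using eventually_near_0[OF \<rho>_cont] by blast
  define \<eta> where "\<eta> = min \<delta> (min \<eta>1 \<eta>2)"
  have \<eta>: "\<eta> > 0" "\<eta> \<le> \<delta>" "\<eta> \<le> \<eta>1" "\<eta> \<le> \<eta>2" using \<delta> \<eta>1 \<eta>2 by (auto simp: \<eta>_def)
  \<comment> \<open>The extra 1 allows the division below and makes the bound on \<open>A u\<close>
    strict.\<close>
  define S where "S = (\<Sum>i<d. norm (X i)) + 1"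
  have S: "S > 0" by (simp add: S_def add_nonneg_pos sum_nonneg)
  define \<epsilon> where "\<epsilon> = \<eta> / S"
  have \<epsilon>: "\<epsilon> > 0" using \<eta> S by (simp add: \<epsilon>_def)
  define A where "A u = (\<Sum>i<d. u i *\<^sub>R X i)" for u :: "nat \<Rightarrow> real"
  define U where "U = PiE {..<d} (\<lambda>_. {-\<epsilon><..<\<epsilon>})"
  have AL: "A u \<in> L" for u unfolding A_def using XL
    by (intro subspace_sum[OF L_subspace] subspace_scale[OF L_subspace]) auto
  have A_small: "norm (A u) < \<eta>" if u: "u \<in> U" for u
  proof -
    have "norm (A u) \<le> (\<Sum>i<d. \<epsilon> * norm (X i))"
      unfolding A_def
    proof (rule sum_norm_le)
      fix i assume "i \<in> {..<d}"
      then have "\<bar>u i\<bar> \<le> \<epsilon>" using u by (force simp: U_def PiE_iff)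
      then show "norm (u i *\<^sub>R X i) \<le> \<epsilon> * norm (X i)" by (simp add: mult_right_mono)
    qed
    also have "\<dots> = \<epsilon> * (S - 1)" by (simp add: S_def sum_distrib_left)
    also have "\<dots> < \<epsilon> * S" using \<epsilon> by simp
    also have "\<dots> = \<eta>" using S by (simp add: \<epsilon>_def)
    finally show ?thesis .
  qed
  have A_\<delta>: "norm (A u) < \<delta>" if "u \<in> U" for u using A_small[OF that] \<eta> by simp
  define c where "c u = curve (A u)" for u
  define c' where "c' i u = slope (A u) (A u) (X i)" for i u
  let ?T = "subtopology (product_topology (\<lambda>_. euclideanreal) {..<d}) U"
  have "orbit_param L Orb U c c'"
    unfolding orbit_param_def Let_def dim
  proof (intro conjI allI impI ballI)
    show "openin (product_topology (\<lambda>_. euclideanreal) {..<d}) U"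
      unfolding U_def by (simp add: openin_PiE)
    show "inj_on c U"
    proof (rule inj_onI)
      fix u w assume uw: "u \<in> U" "w \<in> U" "c u = c w"
      have "(\<Sum>i<d. (u i - w i) *\<^sub>R slope (A u) (A w) (X i)) = slope (A u) (A w) (\<Sum>i<d. (u i - w i) *\<^sub>R X i)"
        by (simp add: linear_sum[OF slope_linear] linear_cmul[OF slope_linear])
      also have "(\<Sum>i<d. (u i - w i) *\<^sub>R X i) = A u - A w" by (simp add: A_def scaleR_diff_left sum_subtractf)
      also have "slope (A u) (A w) (A u - A w) = 0"
        using curve_diff[OF A_\<delta>[OF uw(1)] A_\<delta>[OF uw(2)]] uw(3) by (simp add: c_def)
      \<comment> \<open>Equal values make the two-point slope vanish on the difference, and
        independence then forces equal coordinates.\<close>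
      finally have "\<forall>i<d. u i - w i = 0"
        using \<eta>1(2)[of "A u" "A w"] A_small[OF uw(1)] A_small[OF uw(2)] \<eta>(3)
        unfolding independent_family_def by (meson less_le_trans)
      then show "u = w" using uw(1,2) unfolding U_def by (intro PiE_ext[of u "{..<d}" _ w]) auto
    qed
    show "c ` U \<subseteq> Orb" using curve_in_orbit[OF AL A_\<delta>] by (auto simp: c_def Orb_def)
    show "((\<lambda>t. c (u(i := t))) has_vector_derivative c' i u) (at (u i))" if i: "i < d" and u: "u \<in> U" for i u
    proof -
      have A_upd: "A (u(i := t)) = A u + (t - u i) *\<^sub>R X i" for t
      proof -
        have "A (u(i := t)) = (\<Sum>j<d. u j *\<^sub>R X j + (if j = i then (t - u i) *\<^sub>R X i else 0))"
          unfolding A_def by (intro sum.cong refl) (auto simp: scaleR_diff_left)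
        then show ?thesis using i by (simp add: sum.distrib A_def)
      qed
      have "((\<lambda>t. A u + (t - u i) *\<^sub>R X i) has_derivative (\<lambda>t. t *\<^sub>R X i)) (at (u i))"
        by (auto intro!: derivative_eq_intros)
      moreover have "(curve has_derivative slope (A u) (A u)) (at (A u + (u i - u i) *\<^sub>R X i))"
        using curve_deriv[OF A_\<delta>[OF u]] by simp
      ultimately have "((\<lambda>t. curve (A u + (t - u i) *\<^sub>R X i)) has_derivative (\<lambda>t. slope (A u) (A u) (t *\<^sub>R X
        i))) (at (u i))"
        by (rule has_derivative_compose)
      then show ?thesis
        unfolding has_vector_derivative_def c_def c'_def A_upd by (simp add: linear_cmul[OF slope_linear])
    qed
    have A_cont: "continuous_map ?T (top_of_set (ball 0 \<delta>)) A"
    proof (rule continuous_map_into_subtopology)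
      show "continuous_map ?T euclidean A"
        unfolding A_def
      proof (rule continuous_map_sum)
        fix i assume "i \<in> {..<d}"
        then have "continuous_map ?T euclideanreal (\<lambda>u. u i)"
          by (intro continuous_map_from_subtopology continuous_map_product_projection)
        moreover have "continuous_map euclideanreal euclidean (\<lambda>t. t *\<^sub>R X i)"
          by (simp add: continuous_intros)
        ultimately have "continuous_map ?T euclidean
            ((\<lambda>t. t *\<^sub>R X i) \<circ> (\<lambda>u. u i))" by (rule continuous_map_compose)
        then show "continuous_map ?T euclidean (\<lambda>u. u i *\<^sub>R X i)"
          by (simp only: o_def)
      qed simp
      show "A \<in> topspace ?T \<rightarrow> ball 0 \<delta>"
        using A_\<delta> by auto
    qed
    show "continuous_map ?T euclidean (c' i)" for i
    proof -
      have "continuous_on (ball 0 \<delta>) (\<lambda>A. slope A A (X i))"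
        by (rule continuous_on_compose2[OF slope_continuous, of _ "\<lambda>A. (A, A)", simplified]) (auto intro!:
          continuous_intros)
      then have "continuous_map (top_of_set (ball 0 \<delta>)) euclidean (\<lambda>A. slope A A (X i))" by simp
      from continuous_map_compose[OF A_cont this] show ?thesis by (simp add: o_def c'_def[abs_def])
    qed
    show "span ((\<lambda>i. c' i u) ` {..<d}) = orbit_tangent L (c u)" if u: "u \<in> U" for u
    proof (rule independent_family_span_eq)
      show "independent_family d (\<lambda>i. c' i u)"
        unfolding c'_def using A_small[OF u] \<eta>(3) by (intro \<eta>1(2)) auto
      show "c' i u \<in> orbit_tangent L (c u)" if "i < d" for i
        unfolding c'_def c_def slope_eq_bracket[OF A_\<delta>[OF u]] orbit_tangent_def
        using direction_in_L[OF AL A_\<delta>[OF u] XL[OF that]] by blast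
      show "subspace (orbit_tangent L (c u))" by (rule orbit_tangent_subspace)
      show "dim (orbit_tangent L (c u)) = d"
        unfolding c_def dim_orbit_tangent[OF curve_in_orbit[OF AL A_\<delta>[OF u]]] using Y(4) by (simp add: d_def)
    qed
  qed
  moreover have "emeasure (chart_measure L Orb (U, c, c')) UNIV > 0"
  proof -
    let ?P = "PiM {..<d} (\<lambda>_. lborel :: real measure)"
    let ?R = "restrict_space ?P U"
    let ?f = "\<lambda>u. ennreal \<bar>wedge_power (d div 2) (orbit_symplectic L (c u)) (\<lambda>i. c' i u)\<bar>"
    interpret product_sigma_finite "\<lambda>_::nat. lborel :: real measure" by standard
    have U: "U \<in> sets ?P" unfolding U_def by (rule sets_PiM_I_finite) auto
    have sp: "space ?R = U" using sets.sets_into_space[OF U] by (simp add: space_restrict_space Int_absorb2)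
    have "A \<in> borel_measurable ?P" unfolding A_def
      by (intro borel_measurable_sum borel_measurable_scaleR measurable_component_singleton[THEN
        measurable_compose] borel_measurable_const) auto
    then have A_meas: "A \<in> measurable ?R (restrict_space borel (ball 0 \<delta>))"
      using A_\<delta> by (intro measurable_restrict_space3) auto
    have c_meas: "c \<in> borel_measurable ?R"
      using measurable_compose[OF A_meas borel_measurable_continuous_on_restrict[OF curve_continuous]]
      by (simp add: c_def[abs_def])
    have f_eq: "?f u = ennreal \<bar>\<rho> (A u)\<bar>" if "u \<in> U" for u
      using \<rho>[OF AL A_\<delta>[OF that]] by (simp add: c_def c'_def d_def)
    have "(\<lambda>u. \<rho> (A u)) \<in> borel_measurable ?R"
      by (rule measurable_compose[OF A_meas borel_measurable_continuous_on_restrict[OF \<rho>_cont]])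
    then have "(\<lambda>u. ennreal \<bar>\<rho> (A u)\<bar>) \<in> borel_measurable ?R" by measurable
    then have f_meas: "?f \<in> borel_measurable ?R"
      by (subst measurable_cong[of ?R _ "\<lambda>u. ennreal \<bar>\<rho> (A u)\<bar>"]) (simp_all only: sp f_eq)
    have f_pos: "?f u \<noteq> 0" if "u \<in> U" for u
      using \<eta>2(2)[of "A u"] A_small[OF that] \<eta>(4) f_eq[OF that] by simp
    have "emeasure (chart_measure L Orb (U, c, c')) UNIV = emeasure (density ?R ?f) (space ?R)"
      unfolding chart_measure_def prod.case dim
      by (subst emeasure_distr) (use c_meas in \<open>auto simp: sp\<close>)
    also have "\<dots> = (\<integral>\<^sup>+ u. ?f u * indicator (space ?R) u \<partial>?R)"
      by (rule emeasure_density[OF f_meas]) simp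
    also have "\<dots> = (\<integral>\<^sup>+ u. ?f u \<partial>?R)" by (intro nn_integral_cong) simp
    also have "\<dots> \<noteq> 0"
    proof -
      \<comment> \<open>The density vanishes nowhere on the cube, and the cube has positive Lebesgue
        measure.\<close>
      have "{u \<in> space ?R. ?f u \<noteq> 0} = U" using f_pos by (auto simp: sp)
      moreover have "emeasure ?R U = emeasure ?P U"
        by (rule emeasure_restrict_space) (use U sets.Int_space_eq2 in auto)
      moreover have "emeasure ?P U = (\<Prod>i<d. emeasure lborel {-\<epsilon><..<\<epsilon>})" unfolding U_def
        by (rule emeasure_PiM) auto
      moreover have "\<dots> \<noteq> 0" using \<epsilon> by simp
      ultimately show ?thesis by (simp only: nn_integral_0_iff[OF f_meas]) simp
    qed
    finally show ?thesis by (simp add: zero_less_iff_neq_zero)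
  qed
  ultimately show ?thesis by blast
qed

end

section \<open>The splitting criterion and its consequence for Gibbs states\<close>

theorem theorem4p5:
  fixes B :: "quat^'n \<Rightarrow> quat^'n \<Rightarrow> quat"
    and x y h :: "quat^'n^'n"
    and b :: "nat \<Rightarrow> nat \<Rightarrow> nat \<Rightarrow> real"
    and W :: "nat \<Rightarrow> 'w::quat_vector set"
    and \<phi> :: "nat \<Rightarrow> 'w \<Rightarrow> 'w \<Rightarrow> quat"
  assumes "skew_hermitian_on UNIV B" and "nondegenerate_on UNIV B"
    and "standard_triple (so_star B) x y h"
    and "\<And>r. normalized_form r (b r)"
    and "multiplicity_spaces B x y h b W \<phi>"
  shows
    "(\<forall>r. odd r \<longrightarrow> hermitian_on (W r) (\<phi> r) \<and> nondegenerate_on (W r) (\<phi> r) \<and>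
        (\<exists>!s. has_signature (W r) (\<phi> r) s)) \<and>
     (uminus ` adj_orbit (SO_star B) x = adj_orbit (SO_star B) x \<longleftrightarrow>
        (\<forall>r. odd r \<longrightarrow> (\<forall>p q. has_signature (W r) (\<phi> r) (p, q) \<longrightarrow> p = q))) \<and>
     (uminus ` adj_orbit (SO_star B) x = adj_orbit (SO_star B) x \<longrightarrow>
        \<not> admits_gibbs_state (so_star B) (adj_orbit (SO_star B) x))"
proof -
  define Orb where "Orb = adj_orbit (SO_star B) x"
  obtain \<Psi> where \<Psi>: "bij_betw \<Psi> (isotypic_sum W) UNIV"
    "\<forall>F\<in>isotypic_sum W.
          (\<forall>G\<in>isotypic_sum W. \<Psi> (\<lambda>r k. F r k + G r k) = \<Psi> F + \<Psi> G) \<and>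
          (\<forall>a. \<Psi> (\<lambda>r k. F r k *\<^sub>Q a) = \<Psi> F *\<^sub>Q a) \<and>
          \<Psi> (\<lambda>r. actX r (F r)) = x *v \<Psi> F \<and>
          \<Psi> (\<lambda>r. actY r (F r)) = y *v \<Psi> F \<and>
          \<Psi> (\<lambda>r. actH r (F r)) = h *v \<Psi> F \<and>
          (\<forall>G\<in>isotypic_sum W.
             B (\<Psi> F) (\<Psi> G) =
               (\<Sum>r | F r \<noteq> (\<lambda>_. 0). tensor_form r (b r) (\<phi> r) (F r) (G r)))"
    using assms(5) unfolding multiplicity_spaces_def by blast
  have W: "qsubspace (W r)" "sesquilinear_on (W r) (\<phi> r)" for r
    using assms(5) unfolding multiplicity_spaces_def by blast+
  interpret isotypic_decomposition B x b W \<phi> \<Psi>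
    by unfold_locales (use assms(1,2,4) W \<Psi> in blast)+
  interpret Q: quaternionic_skew_form B by unfold_locales (use assms(1,2) in blast)+
  have x: "x \<in> so_star B" and h: "h \<in> so_star B" and x0: "x \<noteq> 0" and hx: "lie_bracket h x = 2 *\<^sub>R x"
    using assms(3) by (auto simp: standard_triple_def)
  have n: "CARD('n) \<noteq> 1" by (rule standard_triple_card[OF assms(3)])
  have gibbs: "\<not> admits_gibbs_state (so_star B) Orb" if "uminus ` Orb = Orb"
  proof -
    obtain \<delta> where \<delta>: "\<delta> > 0"
      "\<And>A :: quat^'n^'n. norm A < \<delta> \<Longrightarrow> (mat 1 - A) ** resolvent A = mat 1 \<and> resolvent A ** (mat 1 - A) = mat 1"
      "\<And>A :: quat^'n^'n. norm A < \<delta> \<Longrightarrow> (resolvent has_derivative (\<lambda>D. resolvent A ** D ** resolvent A)) (at A)"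
      using resolvent_near_0 by metis
    interpret C: cayley_chart B x \<delta> by unfold_locales (use x \<delta> in blast)+
    obtain U c c' where chart: "orbit_param (so_star B) Orb U c c'"
      "emeasure (chart_measure (so_star B) Orb (U, c, c')) UNIV > 0"
      using C.exists_positive_chart[OF n] unfolding Orb_def by blast
    \<comment> \<open>The relation [h, x] = 2 x makes \<open>x\<close> tangent to its own orbit, so
      the tangent space is nonzero.\<close>
    have "2 *\<^sub>R x \<in> orbit_tangent (so_star B) x" using h hx by (force simp: orbit_tangent_def)
    then have "dim (orbit_tangent (so_star B) x) \<noteq> 0" using x0 by auto
    moreover have "even (dim (orbit_tangent (so_star B) x))"
      using Q.orbit_symplectic_darboux[OF x n] by auto
    moreover have "2 \<le> k" if "k \<noteq> 0" "even k" for k :: nat using that by (auto elim!: evenE)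
    ultimately have "2 \<le> orbit_dim (so_star B) Orb" unfolding Orb_def Q.orbit_dim_eq by blast
    moreover have "4 *\<^sub>R z \<in> Orb" "- z \<in> Orb" "z \<in> so_star B" if "z \<in> Orb" for z
      using scaleR_adj_orbit[OF four_scaleR_in_orbit] that \<open>uminus ` Orb = Orb\<close> Q.orbit_subset_L[OF x]
      by (auto simp: Orb_def)
    ultimately show ?thesis using Q.not_admits_gibbs_state[OF _ _ _ _ chart] by blast
  qed
  have "- x \<in> adj_orbit (SO_star B) x \<longleftrightarrow>
      (\<forall>r. odd r \<longrightarrow> (\<forall>p q. has_signature (W r) (\<phi> r) (p, q) \<longrightarrow> p = q))"
  proof
    assume "- x \<in> adj_orbit (SO_star B) x"
    then show "\<forall>r. odd r \<longrightarrow> (\<forall>p q. has_signature (W r) (\<phi> r) (p, q) \<longrightarrow> p = q)"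
      using uminus_in_orbit_imp_split by blast
  next
    assume "\<forall>r. odd r \<longrightarrow> (\<forall>p q. has_signature (W r) (\<phi> r) (p, q) \<longrightarrow> p = q)"
    then show "- x \<in> adj_orbit (SO_star B) x" by (intro uminus_in_orbit) blast
  qed
  moreover have "\<forall>r. odd r \<longrightarrow> hermitian_on (W r) (\<phi> r) \<and> nondegenerate_on (W r) (\<phi> r) \<and>
      (\<exists>!s. has_signature (W r) (\<phi> r) s)"
    using hermitian nondegenerate signature by simp
  ultimately show ?thesis
    using gibbs unfolding uminus_adj_orbit_iff[symmetric] Orb_def by (intro conjI impI) simp_all
qed

end
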